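(* Let $\mathcal{K}$ be a Fraïssé class in a finite relational language $\mathcal{L}$ (with relation symbols of arbitrary arity) whose Fraïssé limit $\mathbf{K}$ satisfies $\mathrm{SDAP}^+$. Then $\mathbf{K}$ is indivisible: for every substructure $\mathbf{A}$ of $\mathbf{K}$ with exactly one element, and every coloring of the set of copies of $\mathbf{A}$ in $\mathbf{K}$ into finitely many colors, there is a substructure $\mathbf{K}'$ of $\mathbf{K}$ isomorphic to $\mathbf{K}$ such that all copies of $\mathbf{A}$ in $\mathbf{K}'$ have the same color (i.e. the big Ramsey degree $T(\mathbf{A},\mathbf{K})$ exists and equals $1$).
   Context: Standing conventions. $\mathcal L$ is a finite relational language containing at least one relation symbol of arity at least $2$. A Fraïssé class is a nonempty class $\mathcal K$ of finite $\mathcal L$-structures closed under isomorphism and substructures, with the joint embedding and amalgamation properties; its Fraïssé limit is the unique countable ultrahomogeneous structure with age $\mathcal K$. It is assumed that relations hold only of tuples of distinct elements, that each relation symbol holds of some tuple and fails of some tuple in the Fraïssé limit, and that if $\mathcal L$ has unary relation symbols then there are at least two of them and every element of every structure in $\mathcal K$ satisfies exactly one of them. Types are complete quantifier-free $1$-types in the variable $x$ over finite parameter sets; $\mathrm{tp}(v/\mathbf B)$ is the type of $v$ over $\mathbf B$, and for a type $\sigma$ over $\mathbf B\supseteq\mathbf A$, $\sigma\restriction\mathbf A$ is its restriction to parameters from $\mathbf A$. $\mathcal K$ has the disjoint amalgamation property (DAP) if amalgams can be chosen in which the images of the two structures meet exactly in the image of the common substructure. A copy of $\mathbf A$ in $\mathbf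 M$ is a substructure of $\mathbf M$ isomorphic to $\mathbf A$. SDAP. $\mathcal K$ has SDAP if it has DAP and: whenever $\mathbf A,\mathbf C\in\mathcal K$ with $\mathbf A$ a substructure of $\mathbf C$ and $\mathrm C\setminus\mathrm A=\{v,w\}$, there exist $\mathbf A',\mathbf C'\in\mathcal K$, with $\mathbf A'$ containing a copy of $\mathbf A$ as a substructure and $\mathbf C'$ a disjoint amalgamation of $\mathbf A'$ and $\mathbf C$ over $\mathbf A$, such that, writing $v',w'$ for the two vertices of $\mathrm C'\setminus\mathrm A'$: for every $\mathbf B\in\mathcal K$ containing $\mathbf A'$ as a substructure, all $1$-types $\sigma,\tau$ over $\mathbf B$ with $\sigma\restriction\mathbf A'=\mathrm{tp}(v'/\mathbf A')$, $\tau\restriction\mathbf A'=\mathrm{tp}(w'/\mathbf A')$, and every $\mathbf D\in\mathcal K$ extending $\mathbf B$ by one vertex $v''$ with $\mathrm{tp}(v''/\mathbf B)=\sigma$, there is $\mathbf E\in\mathcal K$ extending $\mathbf D$ by one vertex $w''$ with $\mathrm{tp}(w''/\mathbf B)=\tau$ and $\mathbf E\restriction(\mathrm A\cup\{v'',w''\})\cong\mathbf C$. Coding trees. An enumerated Fraïssé limit $\mathbf K$ has universe $\omega$; $v_n$ denotes $n$ and $\mathbf K_n$ the substructure on $\{v_i:i<n\}$. The coding tree $\mathbb S=\mathbb S(\mathbf K)$ is the set of all types $\mathrm{tp}(v_i/\mathbf K_n)$, $n\le i<\omega$, ordered by inclusion; $\mathbb S(n)$ is the set of those over $\mathbf K_n$,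 and these have length $n+1$. The $n$-th coding node is $c_n=\mathrm{tp}(v_n/\mathbf K_n)$; it represents $v_n$. For $\ell\le|s|$, $s\restriction\ell$ is the restriction of $s$ to parameters in $\mathbf K_{\ell-1}$; for $1\le i<|s|$, $s(i)$ is the set of formulas of $s\restriction\mathbf K_i$ in which $v_{i-1}$ occurs. The meet $s\wedge t$ is $s\restriction m$ for the largest $m$ with $s\restriction m=t\restriction m$. $\Gamma=\mathbb S(0)$. With $\mathcal L^-$ the non-unary symbols of $\mathcal L$, the tree $\mathbb U=\mathbb U(\mathbf K)$ is defined like $\mathbb S$ using $\mathcal L^-$-types over the $\mathcal L^-$-reducts $\mathbf K^-_n$, its $n$-th coding node being the $\mathcal L^-$-type of $v_n$ over $\mathbf K^-_n$ together with the $\gamma\in\Gamma$ satisfied by $v_n$. All notions below are defined identically in $\mathbb S$ and $\mathbb U$. $\prec$ is the linear order on the tree lexicographic with respect to a fixed linear order of atomic and negated atomic formulas (negated ones first); thus $s\subsetneq t$ implies $s\prec t$, and for incomparable $s,t$ with $|s\wedge t|=n$, $s\prec t$ iff $s\restriction(n+1)\prec t\restriction(n+1)$. Subtrees and passing types. For a subset $A$, $c^A_0,c^A_1,\dots$ enumerate its coding nodes by increasing length, $N^A=\{i:c_i\in A\}$, $N^A_n$ is the set of indices of the first $n$ of them, $v^A_n$ is the vertex represented by $c^A_n$, and $\mathbf K\restriction A$ is the substructure of $\mathbf K$ on $\{v_i:i\in N^A\}$. $T$ is a subtree if it is closed under meets and $t\restriction\ell\in T$ whenever $t\in T$ and $\ell\le|t|$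 is the length of a coding node of $T$ or of a meet of two incomparable nodes of $T$. For $|s|<|t|$, $t(|s|)$ is the passing type of $t$ at $s$. For a coding node $c_n$ with $|c_n|<|t|$, $t(c_n;A)$ is the set of formulas in $t(|c_n|)$ all of whose parameters lie in $\{v_i:i\in N^A_m\cup\{n\}\}$, $m$ least with $|c^A_m|\ge|c_n|$; $t(n;A)=t(c^A_n;A)$. If $|N^A\cap m|=|N^B\cap n|=p$, let $f$ be the increasing bijection $N^A_p\to N^B_p$ extended by $m\mapsto n$, and $f^*$ the map $v_i\mapsto v_{f(i)}$, $x\mapsto x$; then $s(c_m;A)\sim t(c_n;B)$ means: for every relation symbol $R$ of arity $k$ and every $k$-tuple $\bar z$ from $\{v_i:i\in N^A_p\cup\{m\}\}\cup\{x\}$ containing $x$, $R(\bar z)\in s(c_m;A)$ iff $R(f^*(\bar z))\in t(c_n;B)$. $s(n;A)\sim t(n;B)$ means $s(c^A_n;A)\sim t(c^B_n;B)$. Similarity. For meet-closed $S,T$, a bijection $f:S\to T$ is a similarity map if for all $s,t\in S$: $s\prec t$ iff $f(s)\prec f(t)$; $f(s\wedge t)=f(s)\wedge f(t)$; $|s|<|t|$ iff $|f(s)|<|f(t)|$; $s\subseteq t$ iff $f(s)\subseteq f(t)$; $f(c^S_n)=c^T_n$ and $v^S_n,v^T_n$ satisfy the same $\gamma\in\Gamma$; and $s(n;S)\sim f(s)(n;T)$ whenever $|c^S_n|<|s|$. $S\sim T$ if such a map exists. Diagonal coding trees. A subtree $T$ is diagonal if each level contains at most one splitting node, each splitting node has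 exactly two immediate successors, and no splitting node has the length of a coding node of $T$. Let $\ell^T_n=|c^T_n|$, $\widehat T=\{t\restriction n:t\in T,n\le|t|\}$, $t^+$ the immediate successor in $\widehat T$ of a non-splitting $t$, $T\restriction\ell$ the nodes of $\widehat T$ of length $\ell$, and $T{\restriction}{\le}\ell$ the nodes of $T$ of length $<\ell$ together with $T\restriction\ell$. A diagonal subtree $T$ of $\mathbb U$ (resp. $\mathbb S$) is a diagonal coding subtree if (1) $\mathbf K\restriction T\cong\mathbf K$; (2) for each $n$ the collection of $1$-types in $T\restriction(\ell^T_n+1)$ over $\mathbf K\restriction(T{\restriction}{\le}\ell^T_n)$ is in one-to-one correspondence with the collection of $1$-types in $\mathbb U(n+1)$ (resp. $\mathbb S(n+1)$); (3) if $m<n$ and $c^T_n\supseteq c^T_m$ then, with $A=T{\restriction}{\le}(\ell^T_m-1)$, $(c^T_n)^+(c^T_n;A)\sim(c^T_m)^+(c^T_m;A)$. A tree is perfect if it has no terminal nodes and every node has two incomparable extensions. $\mathcal K$ has the Diagonal Coding Tree Property if for every enumerated Fraïssé limit $\mathbf K$ there is a perfect diagonal coding subtree of $\mathbb S(\mathbf K)$ or of $\mathbb U(\mathbf K)$. Extension Property. Fix a diagonal coding subtree $\mathbf T$ and let $\mathcal T$ be the set of subtrees $T\subseteq\mathbf T$ with $T\sim\mathbf T$. Critical (splitting or coding) nodes of a diagonal tree $T$ have distinct lengths; enumerate them $d^T_0,d^T_1,\dots$ by length, let $T(m)$ be the nodes of $T$ of length $|d^T_m|$ and $r_k(T)=\bigcup_{m<k}T(m)$;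 for $A\subseteq T$, $r_k(A)$ is the first $k$ levels of the tree induced by the meet-closure of $A$. For finite $A$, $\max(A)$ is the set of its nodes of maximal length $\ell_A$ and $\max(A)^+$ the nodes of length $\ell_A+1$ in $T$ extending them. Finite $A,B$ are $+$-similar if $A\sim B$ via $f$ and either $\max(A)$ has a splitting node, in which case $\max(B)$ has one and $f$ maps one to the other, or $\max(A)$ has a coding node $c^A_n$ and $s^+(n;A)\sim f(s)^+(n;B)$ for all $s\in\max(A)$. $\mathbf K$ has the Extension Property if (1) or (2) holds. (1) Whenever $A$ is a finite or infinite subtree of some $T\in\mathcal T$, $k<\omega$, $\max(r_{k+1}(A))$ contains a splitting node $u$, and $B\subseteq T$ is a $+$-similarity copy of $r_k(A)$, letting $s$ be the node of $\max(B)^+$ which must be extended to a splitting node to obtain a $+$-similarity copy of $r_{k+1}(A)$: if $s^*\in T$ is a splitting node extending $s$, then the other nodes of $\max(B)^+$ can be extended to the length of $s^*$ so as to give a $+$-similarity copy of $r_{k+1}(A)$ which can be extended to a copy of $A$. (2) There are $2\le q<\omega$ and a function $\psi$ from the splitting nodes of $\mathbf T$ onto $q$ such that: (a) as in (1), but assuming also that the similarity map $f:r_k(A)\to B$ satisfies $\psi(t)=\psi(f(t))$ for splitting nodes $t$, and concluding that for every $s'\supseteq s$ in $T$ there is a splitting node $s^*\in T$ extending $s'$ with $\psi(s^* )=\psi(u)$, and for any such $s^*$ the other nodes of $\max(B)^+$ can be extended to the length of $s^*$ giving a $+$-similarity copy of $r_{k+1}(A)$ that extends to a copy of $A$; (b)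 $\mathcal L$ has a binary relation symbol and $\psi$ is determined by a partition $Q_0,\dots,Q_{q-1}$ of all pairs of partial $1$-types involving only binary relation symbols over a one-element structure, so that $\psi(s)=m$ iff whenever $c^{\mathbf T}_j,c^{\mathbf T}_k$ are coding nodes with $c^{\mathbf T}_j\wedge c^{\mathbf T}_k=s$, the pair of partial $1$-types of $v^{\mathbf T}_j,v^{\mathbf T}_k$ over $\mathbf K\restriction\{v_i\}$ is in $Q_m$. $\mathrm{SDAP}^+$: a Fraïssé structure $\mathbf K$ satisfies $\mathrm{SDAP}^+$ if its age has SDAP and the Diagonal Coding Tree Property, and $\mathbf K$ has the Extension Property (these do not depend on the chosen enumeration). *)

theory Defs
  imports
    Main
    "HOL-Library.Countable_Set"
    "HOL-Library.Infinite_Set"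
    "HOL-Library.Disjoint_Sets"
begin

section \<open>Relational structures and Fraisse classes\<close>

text \<open>
  A finite relational language is a finite type \<open>'r\<close> of relation symbols with an arity function
  \<open>ar\<close>. Members of a class of finite structures are carried by finite sets of natural numbers;
  since such a class is closed under isomorphism, this loses nothing.
\<close>

record ('a, 'r) rstruct =
  univ :: "'a set"
  interp :: "'r \<Rightarrow> 'a list set"

definition is_struct :: "('r \<Rightarrow> nat) \<Rightarrow> ('a, 'r) rstruct \<Rightarrow> bool" where
  "is_struct ar M \<longleftrightarrow> (\<forall>R. interp M R \<subseteq> {xs. length xs = ar R \<and> set xs \<subseteq> univ M})"

definition restr_struct :: "('a, 'r) rstruct \<Rightarrow> 'a set \<Rightarrow> ('a, 'r) rstruct" where
  "restr_struct M Y =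
     \<lparr>univ = univ M \<inter> Y, interp = (\<lambda>R. {xs \<in> interp M R. set xs \<subseteq> Y})\<rparr>"

definition substruct :: "('a, 'r) rstruct \<Rightarrow> ('a, 'r) rstruct \<Rightarrow> bool" where
  "substruct A M \<longleftrightarrow> univ A \<subseteq> univ M \<and> A = restr_struct M (univ A)"

definition embedding :: "('a \<Rightarrow> 'b) \<Rightarrow> ('a, 'r) rstruct \<Rightarrow> ('b, 'r) rstruct \<Rightarrow> bool" where
  "embedding f A M \<longleftrightarrow>
     inj_on f (univ A) \<and> f ` univ A \<subseteq> univ M \<and>
     (\<forall>R xs. set xs \<subseteq> univ A \<longrightarrow> (xs \<in> interp A R \<longleftrightarrow> map f xs \<in> interp M R))"

definition isomorphism :: "('a \<Rightarrow> 'b) \<Rightarrow> ('a, 'r) rstruct \<Rightarrow> ('b, 'r) rstruct \<Rightarrow> bool" where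
  "isomorphism f A B \<longleftrightarrow> embedding f A B \<and> f ` univ A = univ B"

definition isomorphic :: "('a, 'r) rstruct \<Rightarrow> ('b, 'r) rstruct \<Rightarrow> bool" where
  "isomorphic A B \<longleftrightarrow> (\<exists>f. isomorphism f A B)"

definition fin_struct :: "('r \<Rightarrow> nat) \<Rightarrow> ('a, 'r) rstruct \<Rightarrow> bool" where
  "fin_struct ar A \<longleftrightarrow> is_struct ar A \<and> finite (univ A)"

definition joint_embedding :: "(nat, 'r) rstruct set \<Rightarrow> bool" where
  "joint_embedding \<K> \<longleftrightarrow>
     (\<forall>A\<in>\<K>. \<forall>B\<in>\<K>. \<exists>C\<in>\<K>. \<exists>f g. embedding f A C \<and> embedding g B C)"

definition amalgamation :: "(nat, 'r) rstruct set \<Rightarrow> bool" where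
  "amalgamation \<K> \<longleftrightarrow>
     (\<forall>A\<in>\<K>. \<forall>B\<in>\<K>. \<forall>C\<in>\<K>. \<forall>f g. embedding f A B \<and> embedding g A C \<longrightarrow>
        (\<exists>D\<in>\<K>. \<exists>f' g'. embedding f' B D \<and> embedding g' C D \<and>
           (\<forall>a\<in>univ A. f' (f a) = g' (g a))))"

definition disjoint_amalgamation :: "(nat, 'r) rstruct set \<Rightarrow> bool" where
  "disjoint_amalgamation \<K> \<longleftrightarrow>
     (\<forall>A\<in>\<K>. \<forall>B\<in>\<K>. \<forall>C\<in>\<K>. \<forall>f g. embedding f A B \<and> embedding g A C \<longrightarrow>
        (\<exists>D\<in>\<K>. \<exists>f' g'. embedding f' B D \<and> embedding g' C D \<and>
           (\<forall>a\<in>univ A. f' (f a) = g' (g a)) \<and>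
           f' ` univ B \<inter> g' ` univ C = (\<lambda>a. f' (f a)) ` univ A))"

definition fraisse_class :: "('r \<Rightarrow> nat) \<Rightarrow> (nat, 'r) rstruct set \<Rightarrow> bool" where
  "fraisse_class ar \<K> \<longleftrightarrow>
     \<K> \<noteq> {} \<and> (\<forall>A\<in>\<K>. fin_struct ar A) \<and>
     (\<forall>A\<in>\<K>. \<forall>B. fin_struct ar B \<and> isomorphic A B \<longrightarrow> B \<in> \<K>) \<and>
     (\<forall>A\<in>\<K>. \<forall>B. substruct B A \<longrightarrow> B \<in> \<K>) \<and>
     joint_embedding \<K> \<and> amalgamation \<K>"

definition age :: "('r \<Rightarrow> nat) \<Rightarrow> ('a, 'r) rstruct \<Rightarrow> (nat, 'r) rstruct set" where
  "age ar M = {A. fin_struct ar A \<and> (\<exists>f. embedding f A M)}"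

definition ultrahomogeneous :: "('a, 'r) rstruct \<Rightarrow> bool" where
  "ultrahomogeneous M \<longleftrightarrow>
     (\<forall>A B f. substruct A M \<and> substruct B M \<and> finite (univ A) \<and> isomorphism f A B \<longrightarrow>
        (\<exists>g. isomorphism g M M \<and> (\<forall>a\<in>univ A. g a = f a)))"

definition fraisse_limit ::
  "('r \<Rightarrow> nat) \<Rightarrow> (nat, 'r) rstruct set \<Rightarrow> ('a, 'r) rstruct \<Rightarrow> bool" where
  "fraisse_limit ar \<K> M \<longleftrightarrow>
     is_struct ar M \<and> countable (univ M) \<and> ultrahomogeneous M \<and> age ar M = \<K>"

definition enumerated_limit ::
  "('r \<Rightarrow> nat) \<Rightarrow> (nat, 'r) rstruct set \<Rightarrow> (nat, 'r) rstruct \<Rightarrow> bool" where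
  "enumerated_limit ar \<K> K \<longleftrightarrow> fraisse_limit ar \<K> K \<and> univ K = UNIV"

text \<open>
  In the second conjunct of \<open>nontrivial_relations\<close> the failing tuple is asked to have distinct
  entries: relations never hold of other tuples, so without this the condition would be vacuous
  for non-unary symbols.
\<close>

definition distinct_relations :: "(nat, 'r) rstruct set \<Rightarrow> bool" where
  "distinct_relations \<K> \<longleftrightarrow> (\<forall>A\<in>\<K>. \<forall>R. \<forall>xs\<in>interp A R. distinct xs)"

definition nontrivial_relations :: "('r \<Rightarrow> nat) \<Rightarrow> ('a, 'r) rstruct \<Rightarrow> bool" where
  "nontrivial_relations ar M \<longleftrightarrow>
     (\<forall>R. (\<exists>xs. xs \<in> interp M R) \<and>
          (\<exists>xs. length xs = ar R \<and> set xs \<subseteq> univ M \<and> distinct xs \<and> xs \<notin> interp M R))"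

definition unary_convention :: "('r \<Rightarrow> nat) \<Rightarrow> (nat, 'r) rstruct set \<Rightarrow> bool" where
  "unary_convention ar \<K> \<longleftrightarrow>
     ((\<exists>R. ar R = 1) \<longrightarrow>
        (\<exists>R R'. R \<noteq> R' \<and> ar R = 1 \<and> ar R' = 1) \<and>
        (\<forall>A\<in>\<K>. \<forall>a\<in>univ A. \<exists>!R. ar R = 1 \<and> [a] \<in> interp A R))"

definition language_convention :: "('r \<Rightarrow> nat) \<Rightarrow> bool" where
  "language_convention ar \<longleftrightarrow> (\<forall>R. 1 \<le> ar R) \<and> (\<exists>R. 2 \<le> ar R)"

definition copies :: "('a, 'r) rstruct \<Rightarrow> ('a, 'r) rstruct \<Rightarrow> ('a, 'r) rstruct set" where
  "copies A M = {B. substruct B M \<and> isomorphic B A}"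

definition indivisible :: "('a, 'r) rstruct \<Rightarrow> bool" where
  "indivisible M \<longleftrightarrow>
     (\<forall>A. substruct A M \<and> card (univ A) = 1 \<longrightarrow>
        (\<forall>(n :: nat) (\<chi> :: ('a, 'r) rstruct \<Rightarrow> nat). \<chi> ` copies A M \<subseteq> {..<n} \<longrightarrow>
           (\<exists>M'. substruct M' M \<and> isomorphic M' M \<and>
              (\<forall>B\<in>copies A M'. \<forall>B'\<in>copies A M'. \<chi> B = \<chi> B'))))"

section \<open>Quantifier-free types\<close>

text \<open>
  \<open>X\<close> is the variable \<open>x\<close> and \<open>V i\<close> the parameter \<open>i\<close>. A complete quantifier-free type is
  represented by its set of relational literals. Equality literals are omitted: only types of
  vertices outside the parameter set are considered, and all of these contain the same ones.
  The argument \<open>L\<close> of \<open>qftp\<close> is the set of symbols used, so that reducts need no separate treatment.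
\<close>

datatype tm = X | V nat

datatype 'r lit = Pos 'r "tm list" | Neg 'r "tm list"

fun params :: "'r lit \<Rightarrow> nat set" where
  "params (Pos R ts) = {i. V i \<in> set ts}"
| "params (Neg R ts) = {i. V i \<in> set ts}"

fun tm_val :: "nat \<Rightarrow> tm \<Rightarrow> nat" where
  "tm_val v X = v"
| "tm_val v (V i) = i"

definition qftp ::
  "('r \<Rightarrow> nat) \<Rightarrow> 'r set \<Rightarrow> (nat, 'r) rstruct \<Rightarrow> nat \<Rightarrow> nat set \<Rightarrow> 'r lit set" where
  "qftp ar L M v B =
     {Pos R ts | R ts. R \<in> L \<and> length ts = ar R \<and> set ts \<subseteq> insert X (V ` B) \<and>
        map (tm_val v) ts \<in> interp M R} \<union>
     {Neg R ts | R ts. R \<in> L \<and> length ts = ar R \<and> set ts \<subseteq> insert X (V ` B) \<and>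
        map (tm_val v) ts \<notin> interp M R}"

definition type_restr :: "'r lit set \<Rightarrow> nat set \<Rightarrow> 'r lit set" where
  "type_restr \<sigma> B = {\<phi> \<in> \<sigma>. params \<phi> \<subseteq> B}"

definition one_point_ext :: "(nat, 'r) rstruct \<Rightarrow> (nat, 'r) rstruct \<Rightarrow> nat \<Rightarrow> bool" where
  "one_point_ext B D v \<longleftrightarrow> substruct B D \<and> v \<notin> univ B \<and> univ D = insert v (univ B)"

text \<open>The 1-types over \<open>B\<close> are those realized by a new vertex in some member of the class.\<close>

definition one_types ::
  "('r \<Rightarrow> nat) \<Rightarrow> (nat, 'r) rstruct set \<Rightarrow> (nat, 'r) rstruct \<Rightarrow> 'r lit set set" where
  "one_types ar \<K> B = {qftp ar UNIV D v (univ B) | D v. D \<in> \<K> \<and> one_point_ext B D v}"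

section \<open>SDAP\<close>

text \<open>
  \<open>h\<close> embeds \<open>C\<close> into \<open>C'\<close>, and \<open>h ` univ A\<close> is the copy of \<open>A\<close> in \<open>A'\<close> over which \<open>A'\<close> and \<open>C\<close> are
  amalgamated; thus \<open>v' = h v\<close> and \<open>w' = h w\<close>. The final isomorphism with \<open>C\<close> is the one respecting
  this identification.
\<close>

definition SDAP :: "('r \<Rightarrow> nat) \<Rightarrow> (nat, 'r) rstruct set \<Rightarrow> bool" where
  "SDAP ar \<K> \<longleftrightarrow> disjoint_amalgamation \<K> \<and>
     (\<forall>A\<in>\<K>. \<forall>C\<in>\<K>. \<forall>v w.
        substruct A C \<and> v \<noteq> w \<and> univ C - univ A = {v, w} \<longrightarrow>
        (\<exists>A'\<in>\<K>. \<exists>C'\<in>\<K>. \<exists>h.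
           substruct A' C' \<and> embedding h C C' \<and>
           univ C' = univ A' \<union> h ` univ C \<and> univ A' \<inter> h ` univ C = h ` univ A \<and>
           (\<forall>B\<in>\<K>. substruct A' B \<longrightarrow>
             (\<forall>\<sigma>\<in>one_types ar \<K> B. \<forall>\<tau>\<in>one_types ar \<K> B.
                type_restr \<sigma> (univ A') = qftp ar UNIV C' (h v) (univ A') \<and>
                type_restr \<tau> (univ A') = qftp ar UNIV C' (h w) (univ A') \<longrightarrow>
                (\<forall>D\<in>\<K>. \<forall>v''. one_point_ext B D v'' \<and> qftp ar UNIV D v'' (univ B) = \<sigma> \<longrightarrow>
                  (\<exists>E\<in>\<K>. \<exists>w''. one_point_ext D E w'' \<and> qftp ar UNIV E w'' (univ B) = \<tau> \<and>
                    (\<exists>g. isomorphism g C (restr_struct E (h ` univ A \<union> {v'', w''})) \<and>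
                       (\<forall>a\<in>univ A. g a = h a) \<and> g v = v'' \<and> g w = w'')))))))"

section \<open>Coding trees\<close>

text \<open>
  \<open>ord\<close> is the fixed linear order of the atomic and negated atomic formulas.
\<close>

definition formula_order :: "'r lit rel \<Rightarrow> bool" where
  "formula_order ord \<longleftrightarrow>
     linear_order ord \<and> (\<forall>R ts R' ts'. (Neg R ts, Pos R' ts') \<in> ord)"

text \<open>
  With \<open>L = UNIV\<close> the locale describes the tree \<open>\<S>(K)\<close>, and with \<open>L\<close> the set of non-unary symbols the
  tree \<open>\<U>(K)\<close>. In the latter the \<open>n\<close>-th coding node is the unique coding node of its length, so its
  label is determined by \<open>n\<close>; it is recovered as \<open>unary_label n\<close>.
\<close>

locale coding_tree =
  fixes ar :: "'r \<Rightarrow> nat"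
    and K :: "(nat, 'r) rstruct"
    and L :: "'r set"
    and ord :: "'r lit rel"
begin

definition tp :: "nat \<Rightarrow> nat \<Rightarrow> 'r lit set" where
  "tp i n = qftp ar L K i {..<n}"

definition tree_level :: "nat \<Rightarrow> 'r lit set set" where
  "tree_level n = {tp i n | i. n \<le> i}"

definition tree :: "'r lit set set" where
  "tree = (\<Union>n. tree_level n)"

definition cn :: "nat \<Rightarrow> 'r lit set" where
  "cn n = tp n n"

definition unary_label :: "nat \<Rightarrow> 'r lit set" where
  "unary_label i = qftp ar UNIV K i {}"

text \<open>
  A type over \<open>K\<^sub>n\<close> has length \<open>n + 1\<close>; \<open>n\<close> can be read off because \<open>L\<close> has a symbol of arity at
  least 2. The empty set, of length 0, is not a node; it is the value of \<open>meet\<close> on nodes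
  that have no common initial segment.
\<close>

definition len :: "'r lit set \<Rightarrow> nat" where
  "len s = (if s = {} then 0 else Suc (LEAST n. \<forall>\<phi>\<in>s. params \<phi> \<subseteq> {..<n}))"

definition restr :: "'r lit set \<Rightarrow> nat \<Rightarrow> 'r lit set" where
  "restr s l = (if l = 0 then {} else type_restr s {..<l - 1})"

definition meet :: "'r lit set \<Rightarrow> 'r lit set \<Rightarrow> 'r lit set" where
  "meet s t = restr s (GREATEST m. m \<le> len s \<and> m \<le> len t \<and> restr s m = restr t m)"

definition comparable :: "'r lit set \<Rightarrow> 'r lit set \<Rightarrow> bool" where
  "comparable s t \<longleftrightarrow> s \<subseteq> t \<or> t \<subseteq> s"

text \<open>The formulas \<open>s(i)\<close>.\<close>

definition entry :: "'r lit set \<Rightarrow> nat \<Rightarrow> 'r lit set" where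
  "entry s i = {\<phi> \<in> type_restr s {..<i}. i - 1 \<in> params \<phi>}"

text \<open>
  Lexicographic comparison of two distinct types over the same parameters, listed in increasing
  order of their formulas: the first formula on which they differ belongs to the smaller one.
\<close>

definition lex_less :: "'r lit set \<Rightarrow> 'r lit set \<Rightarrow> bool" where
  "lex_less s t \<longleftrightarrow> (\<exists>\<phi>\<in>s - t. \<forall>\<psi>\<in>(s - t) \<union> (t - s). (\<phi>, \<psi>) \<in> ord)"

definition prec :: "'r lit set \<Rightarrow> 'r lit set \<Rightarrow> bool" where
  "prec s t \<longleftrightarrow> s \<subset> t \<or>
     (\<not> comparable s t \<and>
      lex_less (restr s (Suc (len (meet s t)))) (restr t (Suc (len (meet s t)))))"

subsection \<open>Subtrees and passing types\<close>

definition NA :: "'r lit set set \<Rightarrow> nat set" where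
  "NA A = {i. cn i \<in> A}"

text \<open>\<open>has_cn A n\<close>: \<open>A\<close> has an \<open>n\<close>-th coding node, namely \<open>cn (idx A n)\<close> (counting from 0).\<close>

definition has_cn :: "'r lit set set \<Rightarrow> nat \<Rightarrow> bool" where
  "has_cn A n \<longleftrightarrow> infinite (NA A) \<or> n < card (NA A)"

definition idx :: "'r lit set set \<Rightarrow> nat \<Rightarrow> nat" where
  "idx A n = enumerate (NA A) n"

definition sub_K :: "'r lit set set \<Rightarrow> (nat, 'r) rstruct" where
  "sub_K A = restr_struct K (NA A)"

definition meet_closed :: "'r lit set set \<Rightarrow> bool" where
  "meet_closed A \<longleftrightarrow> (\<forall>s\<in>A. \<forall>t\<in>A. meet s t \<noteq> {} \<longrightarrow> meet s t \<in> A)"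

definition subtree :: "'r lit set set \<Rightarrow> bool" where
  "subtree T \<longleftrightarrow> T \<subseteq> tree \<and> meet_closed T \<and>
     (\<forall>t\<in>T. \<forall>l. 0 < l \<and> l \<le> len t \<and>
        ((\<exists>i\<in>NA T. l = len (cn i)) \<or>
         (\<exists>s\<in>T. \<exists>u\<in>T. \<not> comparable s u \<and> l = len (meet s u))) \<longrightarrow> restr t l \<in> T)"

text \<open>
  \<open>pass t n A\<close> is \<open>t(c\<^sub>n; A)\<close>: the set \<open>N\<^sup>A\<^sub>m\<close>, for \<open>m\<close> least with \<open>\<bar>c\<^sup>A\<^sub>m\<bar> \<ge> \<bar>c\<^sub>n\<bar>\<close>, consists of the elements of
  \<open>N\<^sup>A\<close> below \<open>n\<close>.
\<close>

definition pass :: "'r lit set \<Rightarrow> nat \<Rightarrow> 'r lit set set \<Rightarrow> 'r lit set" where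
  "pass t n A = {\<phi> \<in> entry t (len (cn n)). params \<phi> \<subseteq> (NA A \<inter> {..<n}) \<union> {n}}"

fun tm_map :: "(nat \<Rightarrow> nat) \<Rightarrow> tm \<Rightarrow> tm" where
  "tm_map f X = X"
| "tm_map f (V i) = V (f i)"

definition index_map ::
  "nat \<Rightarrow> 'r lit set set \<Rightarrow> nat \<Rightarrow> 'r lit set set \<Rightarrow> nat \<Rightarrow> nat" where
  "index_map m A n B i = (if i = m then n else idx B (card (NA A \<inter> {..<i})))"

text \<open>\<open>pass_sim s m A t n B\<close> is \<open>s(c\<^sub>m; A) \<sim> t(c\<^sub>n; B)\<close>.\<close>

definition pass_sim ::
  "'r lit set \<Rightarrow> nat \<Rightarrow> 'r lit set set \<Rightarrow> 'r lit set \<Rightarrow> nat \<Rightarrow> 'r lit set set \<Rightarrow> bool" where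
  "pass_sim s m A t n B \<longleftrightarrow>
     card (NA A \<inter> {..<m}) = card (NA B \<inter> {..<n}) \<and>
     (\<forall>R zs. length zs = ar R \<and> X \<in> set zs \<and>
        set zs \<subseteq> insert X (V ` ((NA A \<inter> {..<m}) \<union> {m})) \<longrightarrow>
        (Pos R zs \<in> pass s m A \<longleftrightarrow>
         Pos R (map (tm_map (index_map m A n B)) zs) \<in> pass t n B))"

subsection \<open>Similarity\<close>

text \<open>
  Meets are preserved also when they are empty, in which case they lie outside the domain of \<open>f\<close>.
\<close>

definition similarity_map ::
  "('r lit set \<Rightarrow> 'r lit set) \<Rightarrow> 'r lit set set \<Rightarrow> 'r lit set set \<Rightarrow> bool" where
  "similarity_map f S T \<longleftrightarrow>
     meet_closed S \<and> meet_closed T \<and> bij_betw f S T \<and>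
     (\<forall>s\<in>S. \<forall>t\<in>S.
        (prec s t \<longleftrightarrow> prec (f s) (f t)) \<and>
        meet (f s) (f t) = (if meet s t = {} then {} else f (meet s t)) \<and>
        (len s < len t \<longleftrightarrow> len (f s) < len (f t)) \<and>
        (s \<subseteq> t \<longleftrightarrow> f s \<subseteq> f t)) \<and>
     (\<forall>n. has_cn S n \<longleftrightarrow> has_cn T n) \<and>
     (\<forall>n. has_cn S n \<longrightarrow>
        f (cn (idx S n)) = cn (idx T n) \<and>
        unary_label (idx S n) = unary_label (idx T n) \<and>
        (\<forall>s\<in>S. len (cn (idx S n)) < len s \<longrightarrow> pass_sim s (idx S n) S (f s) (idx T n) T))"

definition similar :: "'r lit set set \<Rightarrow> 'r lit set set \<Rightarrow> bool" where
  "similar S T \<longleftrightarrow> (\<exists>f. similarity_map f S T)"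

subsection \<open>Diagonal coding subtrees\<close>

definition hat :: "'r lit set set \<Rightarrow> 'r lit set set" where
  "hat T = {restr t n | t n. t \<in> T \<and> 0 < n \<and> n \<le> len t}"

definition succs :: "'r lit set set \<Rightarrow> 'r lit set \<Rightarrow> 'r lit set set" where
  "succs T t = {u \<in> hat T. t \<subset> u \<and> len u = Suc (len t)}"

definition splitting :: "'r lit set set \<Rightarrow> 'r lit set \<Rightarrow> bool" where
  "splitting T t \<longleftrightarrow> t \<in> T \<and> (\<exists>u\<in>succs T t. \<exists>v\<in>succs T t. u \<noteq> v)"

definition diagonal :: "'r lit set set \<Rightarrow> bool" where
  "diagonal T \<longleftrightarrow>
     (\<forall>s t. splitting T s \<and> splitting T t \<and> len s = len t \<longrightarrow> s = t) \<and>
     (\<forall>s. splitting T s \<longrightarrow> card (succs T s) = 2) \<and>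
     (\<forall>s. splitting T s \<longrightarrow> (\<forall>i\<in>NA T. len s \<noteq> len (cn i)))"

text \<open>\<open>plus T t\<close> is \<open>t\<^sup>+\<close>.\<close>

definition plus :: "'r lit set set \<Rightarrow> 'r lit set \<Rightarrow> 'r lit set" where
  "plus T t = (THE u. u \<in> succs T t)"

definition at_length :: "'r lit set set \<Rightarrow> nat \<Rightarrow> 'r lit set set" where
  "at_length T l = {t \<in> hat T. len t = l}"

definition up_to_length :: "'r lit set set \<Rightarrow> nat \<Rightarrow> 'r lit set set" where
  "up_to_length T l = {t \<in> T. len t < l} \<union> at_length T l"

definition coding_length :: "'r lit set set \<Rightarrow> nat \<Rightarrow> nat" where
  "coding_length T n = len (cn (idx T n))"

definition diagonal_coding_subtree :: "'r lit set set \<Rightarrow> bool" where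
  "diagonal_coding_subtree T \<longleftrightarrow>
     subtree T \<and> diagonal T \<and>
     isomorphic (sub_K T) K \<and>
     (\<forall>n. \<exists>g. bij_betw g
        ((\<lambda>t. type_restr t (NA (up_to_length T (coding_length T n)))) `
           at_length T (Suc (coding_length T n)))
        (tree_level (Suc n))) \<and>
     (\<forall>m n. m < n \<and> cn (idx T m) \<subseteq> cn (idx T n) \<longrightarrow>
        (let A = up_to_length T (coding_length T m - 1) in
           pass_sim (plus T (cn (idx T n))) (idx T n) A (plus T (cn (idx T m))) (idx T m) A))"

definition perfect :: "'r lit set set \<Rightarrow> bool" where
  "perfect T \<longleftrightarrow>
     (\<forall>t\<in>T. (\<exists>u\<in>T. t \<subset> u) \<and>
        (\<exists>u\<in>T. \<exists>v\<in>T. t \<subseteq> u \<and> t \<subseteq> v \<and> \<not> comparable u v))"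

subsection \<open>The Extension Property\<close>

definition similar_subtrees :: "'r lit set set \<Rightarrow> 'r lit set set set" where
  "similar_subtrees \<T> = {T. subtree T \<and> T \<subseteq> \<T> \<and> similar T \<T>}"

definition meet_closure :: "'r lit set set \<Rightarrow> 'r lit set set" where
  "meet_closure A = (A \<union> {meet s t | s t. s \<in> A \<and> t \<in> A}) - {{}}"

definition induced_tree :: "'r lit set set \<Rightarrow> 'r lit set set" where
  "induced_tree A =
     {restr t (len u) | t u. t \<in> A \<and> u \<in> meet_closure A \<and> len u \<le> len t}"

text \<open>
  The first \<open>k\<close> levels of the induced tree, a level being given by the length of a node of the
  meet-closure. For a diagonal tree all of whose nodes have the length of a critical node, these
  are the levels of its first \<open>k\<close> critical nodes.
\<close>

definition rk :: "nat \<Rightarrow> 'r lit set set \<Rightarrow> 'r lit set set" where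
  "rk k A = {t \<in> induced_tree A. card {l \<in> len ` meet_closure A. l < len t} < k}"

definition max_nodes :: "'r lit set set \<Rightarrow> 'r lit set set" where
  "max_nodes A = {t \<in> A. \<forall>u\<in>A. len u \<le> len t}"

text \<open>
  Splitting nodes and immediate successors are those of the ambient tree \<open>T\<close>: a maximal node of a
  finite set has no successors in that set.
\<close>

definition plus_similarity ::
  "'r lit set set \<Rightarrow> ('r lit set \<Rightarrow> 'r lit set) \<Rightarrow> 'r lit set set \<Rightarrow> 'r lit set set \<Rightarrow> bool" where
  "plus_similarity T f A B \<longleftrightarrow>
     finite A \<and> finite B \<and> similarity_map f A B \<and>
     ((\<exists>u\<in>max_nodes A. splitting T u \<and> f u \<in> max_nodes B \<and> splitting T (f u)) \<or>
      (\<exists>n. has_cn A n \<and> cn (idx A n) \<in> max_nodes A \<and>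
         (\<forall>s\<in>max_nodes A. pass_sim (plus T s) (idx A n) A (plus T (f s)) (idx B n) B)))"

text \<open>
  \<open>u\<close> is a splitting node in the last level of \<open>rk (Suc k) A\<close> and \<open>f\<close> maps \<open>rk k A\<close> to \<open>B\<close>. The
  node \<open>s\<close> of \<open>max(B)\<^sup>+\<close> which has to be extended to a splitting node is the immediate successor of
  \<open>f d\<close>, where \<open>d\<close> is the node of \<open>max_nodes (rk k A)\<close> below \<open>u\<close>; if \<open>d\<close> is itself a splitting node, it
  is the \<open>prec\<close>-smaller or the \<open>prec\<close>-larger one of the two according to the side of \<open>d\<close> on which \<open>u\<close> lies.
\<close>

definition to_be_split ::
  "'r lit set set \<Rightarrow> ('r lit set \<Rightarrow> 'r lit set) \<Rightarrow> 'r lit set set \<Rightarrow> 'r lit set \<Rightarrow> 'r lit set \<Rightarrow> bool" where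
  "to_be_split T f A' u s \<longleftrightarrow>
     (\<exists>d\<in>max_nodes A'. d \<subset> u \<and> s \<in> succs T (f d) \<and>
        ((\<exists>d'\<in>succs T d. prec d' (restr u (Suc (len d)))) \<longleftrightarrow>
         (\<exists>s'\<in>succs T (f d). prec s' s)))"

definition ep_situation ::
  "'r lit set set \<Rightarrow> 'r lit set set \<Rightarrow> nat \<Rightarrow> 'r lit set \<Rightarrow>
   ('r lit set \<Rightarrow> 'r lit set) \<Rightarrow> 'r lit set set \<Rightarrow> 'r lit set \<Rightarrow> bool" where
  "ep_situation T A k u f B s \<longleftrightarrow>
     subtree A \<and> A \<subseteq> T \<and>
     u \<in> max_nodes (rk (Suc k) A) \<and> u \<notin> rk k A \<and> splitting T u \<and>
     B \<subseteq> T \<and> plus_similarity T f (rk k A) B \<and>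
     to_be_split T f (rk k A) u s"

text \<open>
  The new nodes of \<open>C\<close> have the length of \<open>s'\<close> and extend the required nodes of \<open>max(B)\<^sup>+\<close> because
  \<open>g\<close> is a similarity map extending \<open>f\<close>.
\<close>

definition ep_extends ::
  "'r lit set set \<Rightarrow> 'r lit set set \<Rightarrow> nat \<Rightarrow> 'r lit set \<Rightarrow>
   ('r lit set \<Rightarrow> 'r lit set) \<Rightarrow> 'r lit set \<Rightarrow> bool" where
  "ep_extends T A k u f s' \<longleftrightarrow>
     (\<exists>g C. C \<subseteq> T \<and> plus_similarity T g (rk (Suc k) A) C \<and>
        (\<forall>t\<in>rk k A. g t = f t) \<and> g u = s' \<and>
        (\<exists>h D. D \<subseteq> T \<and> similarity_map h A D \<and> (\<forall>t\<in>A \<inter> rk (Suc k) A. h t = g t)))"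

definition EP1 :: "'r lit set set \<Rightarrow> bool" where
  "EP1 \<T> \<longleftrightarrow>
     (\<forall>T\<in>similar_subtrees \<T>. \<forall>A k u f B s. ep_situation T A k u f B s \<longrightarrow>
        (\<forall>s'. splitting T s' \<and> s \<subseteq> s' \<longrightarrow> ep_extends T A k u f s'))"

definition EP2a :: "'r lit set set \<Rightarrow> ('r lit set \<Rightarrow> nat) \<Rightarrow> bool" where
  "EP2a \<T> \<psi> \<longleftrightarrow>
     (\<forall>T\<in>similar_subtrees \<T>. \<forall>A k u f B s. ep_situation T A k u f B s \<and>
        (\<forall>t\<in>rk k A. splitting T t \<longrightarrow> splitting T (f t) \<and> \<psi> t = \<psi> (f t)) \<longrightarrow>
        (\<forall>s0\<in>T. s \<subseteq> s0 \<longrightarrow> (\<exists>s'. splitting T s' \<and> s0 \<subseteq> s' \<and> \<psi> s' = \<psi> u)) \<and>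
        (\<forall>s'. splitting T s' \<and> s \<subseteq> s' \<and> \<psi> s' = \<psi> u \<longrightarrow> ep_extends T A k u f s'))"

text \<open>
  The partial 1-type of \<open>v\<^sub>j\<close> over \<open>v\<^sub>i\<close> in the binary symbols. The parameter \<open>v\<^sub>i\<close> is renamed
  to \<open>V 0\<close>, so that types over different one-element structures can be compared.
\<close>

definition binary_type :: "nat \<Rightarrow> nat \<Rightarrow> 'r lit set" where
  "binary_type j i =
     {Pos R (map (tm_map (\<lambda>_. 0)) ts) | R ts. Pos R ts \<in> qftp ar {R. ar R = 2} K j {i}} \<union>
     {Neg R (map (tm_map (\<lambda>_. 0)) ts) | R ts. Neg R ts \<in> qftp ar {R. ar R = 2} K j {i}}"

definition binary_types :: "'r lit set set" where
  "binary_types = {binary_type j i | j i. j \<noteq> i}"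

text \<open>
  If \<open>c\<^sub>j \<and> c\<^sub>k = s\<close> then \<open>c\<^sub>j\<close> and \<open>c\<^sub>k\<close> first differ on formulas about \<open>v\<^sub>i\<close>, where \<open>\<bar>s\<bar> = i + 1\<close>.
\<close>

definition EP2b :: "'r lit set set \<Rightarrow> nat \<Rightarrow> ('r lit set \<Rightarrow> nat) \<Rightarrow> bool" where
  "EP2b \<T> q \<psi> \<longleftrightarrow>
     (\<exists>R. ar R = 2) \<and>
     (\<exists>Q. disjoint_family_on Q {..<q} \<and> (\<forall>m<q. Q m \<noteq> {}) \<and>
        (\<Union>m<q. Q m) = binary_types \<times> binary_types \<and>
        (\<forall>s m. splitting \<T> s \<and> m < q \<longrightarrow>
           (\<psi> s = m \<longleftrightarrow>
            (\<forall>j\<in>NA \<T>. \<forall>k\<in>NA \<T>. meet (cn j) (cn k) = s \<longrightarrow>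
               (binary_type j (len s - 1), binary_type k (len s - 1)) \<in> Q m))))"

definition extension_property_for :: "'r lit set set \<Rightarrow> bool" where
  "extension_property_for \<T> \<longleftrightarrow>
     EP1 \<T> \<or>
     (\<exists>q \<psi>. 2 \<le> q \<and> \<psi> ` {s. splitting \<T> s} = {..<q} \<and> EP2a \<T> \<psi> \<and> EP2b \<T> q \<psi>)"

end

section \<open>SDAP$^+$\<close>

definition tree_symbols :: "('r \<Rightarrow> nat) \<Rightarrow> 'r set set" where
  "tree_symbols ar = {UNIV, {R. ar R \<noteq> 1}}"

definition diagonal_coding_tree_property ::
  "('r \<Rightarrow> nat) \<Rightarrow> (nat, 'r) rstruct set \<Rightarrow> bool" where
  "diagonal_coding_tree_property ar \<K> \<longleftrightarrow>
     (\<forall>K. enumerated_limit ar \<K> K \<longrightarrow>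
        (\<exists>L\<in>tree_symbols ar. \<exists>T.
           coding_tree.diagonal_coding_subtree ar K L T \<and> coding_tree.perfect T))"

text \<open>
  The diagonal coding subtree fixed in the Extension Property is one as provided by the Diagonal
  Coding Tree Property.
\<close>

definition extension_property ::
  "('r \<Rightarrow> nat) \<Rightarrow> 'r lit rel \<Rightarrow> (nat, 'r) rstruct \<Rightarrow> bool" where
  "extension_property ar ord K \<longleftrightarrow>
     (\<exists>L\<in>tree_symbols ar. \<exists>\<T>.
        coding_tree.diagonal_coding_subtree ar K L \<T> \<and> coding_tree.perfect \<T> \<and>
        coding_tree.extension_property_for ar K L ord \<T>)"

definition SDAP_plus :: "('r \<Rightarrow> nat) \<Rightarrow> 'r lit rel \<Rightarrow> ('a, 'r) rstruct \<Rightarrow> bool" where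
  "SDAP_plus ar ord M \<longleftrightarrow>
     SDAP ar (age ar M) \<and> diagonal_coding_tree_property ar (age ar M) \<and>
     (\<exists>K. enumerated_limit ar (age ar M) K \<and> isomorphic K M \<and> extension_property ar ord K)"

end

theory Submission
  imports Defs
begin

text \<open>
  Call an orbit \<open>P\<close> of a vertex under the stabilizer of a finite set large if there is a copy of \<open>K\<close> whose
  vertices of the given sort \<open>\<Gamma>\<close> all lie in \<open>P\<close>. If all such orbits are large, then \<open>K\<close> is indivisible: a
  colour either misses some orbit, and then the other colour contains a copy, or it meets every
  orbit, and then a copy can be built inside it one vertex at a time.

  To see that orbits are large, let \<open>d\<^sub>0\<close> be the first splitting node of the perfect diagonal coding tree \<open>T\<close>.
  It divides \<open>\<Gamma>\<close> into at most two sides \<open>A\<close> and \<open>B\<close>. Applying the Extension Property just above \<open>d\<^sub>0\<close>, to \<open>T\<close>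
  without its first coding levels, gives copies in which \<open>A\<close> goes above any prescribed node over the
  first side and \<open>B\<close> above any prescribed node over the second. Hence an orbit that is infinite on both
  sides is large. If translates of a small orbit \<open>P\<close> under the automorphism group were to lie on
  different sides, then ``belonging to a common translate of \<open>P\<close>'' would be an invariant equivalence
  relation on \<open>\<Gamma>\<close> with exactly two classes. This contradicts the Diagonal Coding Tree Property: for an
  enumeration starting with a vertex \<open>v\<^sub>0\<close> in \<open>\<Gamma>\<close> the root is the coding node of \<open>v\<^sub>0\<close>, so it does not split in a
  diagonal tree, and there is a copy of \<open>K\<close> whose vertices in \<open>\<Gamma>\<close> all have the same type over \<open>v\<^sub>0\<close>. So all
  translates of \<open>P\<close> lie on one side, say \<open>A\<close>. If every orbit is infinite on \<open>A\<close>, then \<open>A\<close> contains a copy, which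
  can be moved into \<open>P\<close>. Otherwise some orbit lives on \<open>B\<close>; it is small too, all its translates live on \<open>B\<close>,
  and yet by transitivity one of them meets \<open>P\<close>, hence in an infinite set.
\<close>

section \<open>Permutation groups and indivisibility\<close>

locale perm_group =
  fixes \<G> :: "(nat \<Rightarrow> nat) set"
  assumes id_mem: "id \<in> \<G>"
    and comp_mem: "G \<in> \<G> \<Longrightarrow> H \<in> \<G> \<Longrightarrow> G \<circ> H \<in> \<G>"
    and inv_mem: "G \<in> \<G> \<Longrightarrow> inv G \<in> \<G>"
    and bij_mem: "G \<in> \<G> \<Longrightarrow> bij G"
begin

text \<open>The orbit of \<open>x\<close> under the pointwise stabilizer of \<open>F\<close>. For
  the automorphism group of an ultrahomogeneous structure and finite \<open>F\<close> not containing
  \<open>x\<close>, these sets are the realizations of complete types over \<open>F\<close>.\<close>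

definition orb :: "nat set \<Rightarrow> nat \<Rightarrow> nat set" where
  "orb F x = {G x | G. G \<in> \<G> \<and> (\<forall>f\<in>F. G f = f)}"

text \<open>Membership in the closure of the group under pointwise convergence. For the automorphism
  group of the limit these maps are the self-embeddings (\<open>loc_iff\<close>), so a map in
  \<open>loc\<close> stands for a copy of the structure.\<close>

definition loc :: "(nat \<Rightarrow> nat) \<Rightarrow> bool" where
  "loc e \<longleftrightarrow> (\<forall>F. finite F \<longrightarrow> (\<exists>G\<in>\<G>. \<forall>f\<in>F. e f = G f))"

lemma inv_f: "G \<in> \<G> \<Longrightarrow> inv G (G x) = x" "G \<in> \<G> \<Longrightarrow> G (inv G x) = x"
  using bij_mem by (simp_all add: bij_is_inj bij_is_surj surj_f_inv_f)

lemma mem_inj: "G \<in> \<G> \<Longrightarrow> G x = G y \<longleftrightarrow> x = y"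
  using bij_mem bij_is_inj inj_eq by metis

lemma orb_self: "x \<in> orb F x"
  unfolding orb_def by (intro CollectI exI[of _ id]) (simp add: id_mem)

lemma orb_step: "y \<in> orb F x \<Longrightarrow> H \<in> \<G> \<Longrightarrow> (\<And>f. f \<in> F \<Longrightarrow> H f = f) \<Longrightarrow> H y \<in> orb F x"
proof -
  assume "y \<in> orb F x" and H: "H \<in> \<G>" "\<And>f. f \<in> F \<Longrightarrow> H f = f"
  then obtain G where G: "G \<in> \<G>" "\<forall>f\<in>F. G f = f" "y = G x" unfolding orb_def by auto
  have "H \<circ> G \<in> \<G>" "\<forall>f\<in>F. (H \<circ> G) f = f" "H y = (H \<circ> G) x"
    using G H comp_mem by auto
  then show ?thesis unfolding orb_def by blast
qed

lemma orb_empty_inv: "G \<in> \<G> \<Longrightarrow> x \<in> orb {} y \<Longrightarrow> G x \<in> orb {} y"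
  by (rule orb_step) auto

lemma orb_sym: "y \<in> orb F x \<Longrightarrow> x \<in> orb F y"
proof -
  assume "y \<in> orb F x"
  then obtain G where G: "G \<in> \<G>" "\<forall>f\<in>F. G f = f" "y = G x" unfolding orb_def by auto
  have "\<forall>f\<in>F. inv G f = f" using G inv_f(1) by metis
  moreover have "x = inv G y" using G inv_f by simp
  ultimately show ?thesis unfolding orb_def using inv_mem[OF G(1)] by blast
qed

lemma orb_subset: "y \<in> orb F x \<Longrightarrow> orb F y \<subseteq> orb F x"
proof
  fix z assume y: "y \<in> orb F x" and "z \<in> orb F y"
  then obtain G where "G \<in> \<G>" "\<forall>f\<in>F. G f = f" "z = G y" unfolding orb_def by auto
  then show "z \<in> orb F x" using orb_step[OF y] by auto
qed

lemma orb_eq: "y \<in> orb F x \<Longrightarrow> orb F y = orb F x"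
  using orb_subset orb_sym by blast

lemma orb_antimono: "F \<subseteq> F' \<Longrightarrow> orb F' x \<subseteq> orb F x"
  unfolding orb_def by blast

lemma orb_notin: "x \<notin> F \<Longrightarrow> y \<in> orb F x \<Longrightarrow> y \<notin> F"
  unfolding orb_def using mem_inj by fastforce

text \<open>Conjugation by \<open>H\<close> turns the stabilizer of \<open>F\<close> into that of
  its image under \<open>H\<close>.\<close>

lemma orb_image: 
  assumes "H \<in> \<G>" shows "H ` orb F x = orb (H ` F) (H x)"
proof -
  have sub: "H ` orb F x \<subseteq> orb (H ` F) (H x)" if H: "H \<in> \<G>" for H F x
  proof
    fix z assume "z \<in> H ` orb F x"
    then obtain G where G: "G \<in> \<G>" "\<forall>f\<in>F. G f = f" "z = H (G x)" unfolding orb_def by auto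
    let ?G = "H \<circ> G \<circ> inv H"
    have "?G \<in> \<G>" "\<forall>f\<in>H ` F. ?G f = f" "z = ?G (H x)"
      using G H comp_mem inv_mem inv_f by auto
    then show "z \<in> orb (H ` F) (H x)" unfolding orb_def by blast
  qed
  \<comment> \<open>The reverse inclusion is the first one applied to \<open>inv H\<close>.\<close>
  have "inv H ` orb (H ` F) (H x) \<subseteq> orb (inv H ` (H ` F)) (inv H (H x))"
    using sub inv_mem[OF assms] .
  then have "inv H ` orb (H ` F) (H x) \<subseteq> orb F x"
    using inv_f(1)[OF assms] by (simp add: image_image)
  then have "H ` (inv H ` orb (H ` F) (H x)) \<subseteq> H ` orb F x" by blast
  then have "orb (H ` F) (H x) \<subseteq> H ` orb F x"
    using inv_f(2)[OF assms] by (simp add: image_image)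
  then show ?thesis using sub[OF assms] by blast
qed

lemma loc_mem: "G \<in> \<G> \<Longrightarrow> loc G"
  unfolding loc_def by blast

lemma loc_comp: assumes "loc e" "loc e'" shows "loc (e \<circ> e')"
  unfolding loc_def
proof (intro allI impI)
  fix F :: "nat set" assume "finite F"
  then obtain G where G: "G \<in> \<G>" "\<forall>f\<in>F. e' f = G f" using assms unfolding loc_def by blast
  have "finite (e' ` F)" using \<open>finite F\<close> by simp
  then obtain H where H: "H \<in> \<G>" "\<forall>f\<in>e' ` F. e f = H f"
    using assms(1) unfolding loc_def by meson
  have "(e \<circ> e') f = (H \<circ> G) f" if "f \<in> F" for f
    using H(2) G(2) that by (metis comp_apply imageI)
  then show "\<exists>G\<in>\<G>. \<forall>f\<in>F. (e \<circ> e') f = G f" using comp_mem[OF H(1) G(1)] by blast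
qed

lemma loc_pair:
  assumes "loc e" obtains G where "G \<in> \<G>" "e x = G x" "e y = G y"
proof -
  have "finite {x, y}" by simp
  then obtain G where "G \<in> \<G>" "\<forall>f\<in>{x, y}. e f = G f" using assms unfolding loc_def by blast
  then show thesis using that by blast
qed

lemma loc_inj:
  assumes "loc e" shows "e x = e y \<longleftrightarrow> x = y"
proof -
  obtain G where "G \<in> \<G>" "e x = G x" "e y = G y" using loc_pair[OF assms] .
  then show ?thesis using mem_inj by simp
qed

lemma loc_orb_empty: "loc e \<Longrightarrow> e x \<in> orb {} y \<longleftrightarrow> x \<in> orb {} y"
proof -
  assume "loc e"
  then obtain G where G: "G \<in> \<G>" "e x = G x" by (rule loc_pair)
  then have "e x \<in> orb {} x" unfolding orb_def by auto
  then show ?thesis using orb_sym orb_subset by blast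
qed

text \<open>The forth half of a back-and-forth construction.\<close>

lemma rich_embedding:
  assumes inv: "\<And>G x. G \<in> \<G> \<Longrightarrow> x \<in> \<Gamma> \<Longrightarrow> G x \<in> \<Gamma>"
    and rich: "\<And>F x. finite F \<Longrightarrow> x \<in> \<Gamma> \<Longrightarrow> x \<notin> F \<Longrightarrow> orb F x \<inter> R \<noteq> {}"
  shows "\<exists>e. loc e \<and> e ` \<Gamma> \<subseteq> R"
proof -
  \<comment> \<open>One-point correction: since \<open>G n\<close> avoids the earlier values, some
    \<open>H\<close> fixing those values carries it into \<open>R\<close>, and composing with
    \<open>H\<close> leaves \<open>G\<close> unchanged below \<open>n\<close>.\<close>
  have step: "\<exists>H. (H \<in> \<G> \<and> (H n \<in> R \<or> n \<notin> \<Gamma>)) \<and> (\<forall>i<n. H i = G i)" if G: "G \<in> \<G>" for G n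
  proof (cases "n \<in> \<Gamma>")
    case True
    have "G n \<notin> G ` {..<n}" using mem_inj[OF G] by auto
    then have "orb (G ` {..<n}) (G n) \<inter> R \<noteq> {}"
      using rich[of "G ` {..<n}" "G n"] inv[OF G True] by simp
    then obtain H where H: "H \<in> \<G>" "\<forall>f\<in>G ` {..<n}. H f = f" "H (G n) \<in> R"
      unfolding orb_def by auto
    show ?thesis by (rule exI[of _ "H \<circ> G"]) (use H G comp_mem in auto)
  qed (use G in blast)
  define P where "P n G \<longleftrightarrow> G \<in> \<G> \<and> (\<forall>i<n. G i \<in> R \<or> i \<notin> \<Gamma>)" for n G
  have "P 0 id" unfolding P_def using id_mem by simp
  moreover have "\<exists>H. P (Suc n) H \<and> (\<forall>i<n. H i = G i)" if "P n G" for n G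
    using step[of G n] that unfolding P_def by (metis less_Suc_eq)
  ultimately obtain \<Phi> where \<Phi>: "\<And>n. P n (\<Phi> n)" "\<And>n i. i < n \<Longrightarrow> \<Phi> (Suc n) i = \<Phi> n i"
    using dependent_nat_choice[of P "\<lambda>n G H. \<forall>i<n. H i = G i"] by metis
  have stable: "\<Phi> m i = \<Phi> (Suc i) i" if "i < m" for m i
    using that by (induction m) (auto simp: less_Suc_eq \<Phi>(2))
  \<comment> \<open>The value at \<open>i\<close> is final from stage \<open>Suc i\<close> on, so
    \<open>e\<close> agrees with the \<open>m\<close>-th stage on all arguments below
    \<open>m\<close>.\<close>
  define e where "e i = \<Phi> (Suc i) i" for i
  have "loc e" unfolding loc_def
  proof (intro allI impI)
    fix F :: "nat set" assume "finite F"
    then obtain m where m: "\<forall>f\<in>F. f < m" using finite_nat_set_iff_bounded by blast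
    show "\<exists>G\<in>\<G>. \<forall>f\<in>F. e f = G f"
    proof (intro bexI ballI)
      show "e f = \<Phi> m f" if "f \<in> F" for f using stable[of f m] m that e_def by metis
      show "\<Phi> m \<in> \<G>" using \<Phi>(1) P_def by blast
    qed
  qed
  moreover have "e ` \<Gamma> \<subseteq> R" using \<Phi>(1) unfolding e_def P_def by blast
  ultimately show ?thesis by blast
qed

end

section \<open>The two sides of a sort\<close>

text \<open>This abstracts what the trees supply. The sides \<open>A\<close> and \<open>B\<close>
  split the sort, and \<open>B\<close> may be empty. \<open>J\<close>, \<open>JA\<close> and
  \<open>JB\<close> come from the Extension Property; the last two are stated separately because
  \<open>J\<close> also asks for an orbit that is infinite on the opposite side.
  \<open>homogeneous_copy\<close> comes from the Diagonal Coding Tree Property.\<close>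

locale sided = perm_group +
  fixes x0 :: nat and A B :: "nat set"
  assumes orb_infinite: "finite F \<Longrightarrow> x \<notin> F \<Longrightarrow> infinite (orb F x)"
    and cover: "orb {} x0 = A \<union> B" and disj: "A \<inter> B = {}"
    and homogeneous_copy: "\<exists>f\<in>orb {} x0. \<exists>e. loc e \<and> (\<forall>y\<in>orb {} x0. \<forall>z\<in>orb {} x0.
          e y \<noteq> f \<longrightarrow> e z \<noteq> f \<longrightarrow> e z \<in> orb {f} (e y))"
    and J: "finite F \<Longrightarrow> finite F' \<Longrightarrow> x \<notin> F \<Longrightarrow> x' \<notin> F' \<Longrightarrow> infinite (orb F x \<inter> A) \<Longrightarrow>
        infinite (orb F' x' \<inter> B) \<Longrightarrow> \<exists>e. loc e \<and> e ` A \<subseteq> orb F x \<and> e ` B \<subseteq> orb F' x'"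
    and JA: "finite F \<Longrightarrow> x \<notin> F \<Longrightarrow> infinite (orb F x \<inter> A) \<Longrightarrow> \<exists>e. loc e \<and> e ` A \<subseteq> orb F x"
    and JB: "finite F \<Longrightarrow> x \<notin> F \<Longrightarrow> infinite (orb F x \<inter> B) \<Longrightarrow> \<exists>e. loc e \<and> e ` B \<subseteq> orb F x"
begin

abbreviation \<Gamma> :: "nat set" where "\<Gamma> \<equiv> orb {} x0"

text \<open>The assumptions are symmetric in the two sides, so what is proved for \<open>A\<close>
  also holds for \<open>B\<close>.\<close>

lemma swap_sides: "sided \<G> x0 B A"
proof
  show "\<exists>e. loc e \<and> e ` B \<subseteq> orb F x \<and> e ` A \<subseteq> orb F' x'"
    if "finite F" "finite F'" "x \<notin> F" "x' \<notin> F'" "infinite (orb F x \<inter> B)"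
      "infinite (orb F' x' \<inter> A)" for F F' x x'
    using J[OF that(2,1,4,3,6,5)] by blast
qed (use orb_infinite cover disj homogeneous_copy JA JB in auto)

definition large :: "nat set \<Rightarrow> bool" where
  "large P \<longleftrightarrow> (\<exists>e. loc e \<and> e ` \<Gamma> \<subseteq> P)"

text \<open>In the homogeneous copy all vertices of the sort other than \<open>f\<close> are
  conjugate over \<open>f\<close>, so either all or none of them are equivalent to \<open>f\<close>.
  With two classes only, they all lie in one class. But \<open>e\<close> acts on pairs like group
  elements and so must keep a point of \<open>A\<close> inequivalent to a point of
  \<open>B\<close>.\<close>

lemma no_two_classes:
  assumes inf: "infinite A" "infinite B"
    and E: "\<And>y z. y \<in> \<Gamma> \<Longrightarrow> z \<in> \<Gamma> \<Longrightarrow> E y z \<longleftrightarrow> (y \<in> A \<longleftrightarrow> z \<in> A)"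
    and inv: "\<And>G y z. G \<in> \<G> \<Longrightarrow> E y z \<Longrightarrow> E (G y) (G z)"
  shows False
proof -
  obtain f e where f: "f \<in> \<Gamma>" and e: "loc e"
    and one: "\<And>y z. y \<in> \<Gamma> \<Longrightarrow> z \<in> \<Gamma> \<Longrightarrow> e y \<noteq> f \<Longrightarrow> e z \<noteq> f \<Longrightarrow> e z \<in> orb {f} (e y)"
    using homogeneous_copy by blast
  \<comment> \<open>By injectivity at most one point is sent to \<open>f\<close>; dropping it leaves
    points on both sides.\<close>
  have fin: "finite {y. e y = f}"
  proof (cases "\<exists>y. e y = f")
    case True
    then obtain y where "e y = f" by blast
    then have "{z. e z = f} = {y}" using loc_inj[OF e] by auto
    then show ?thesis by simp
  qed simp
  obtain y where y: "y \<in> A" "e y \<noteq> f"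
    using infinite_imp_nonempty[OF Diff_infinite_finite[OF fin inf(1)]] by blast
  obtain z where z: "z \<in> B" "e z \<noteq> f"
    using infinite_imp_nonempty[OF Diff_infinite_finite[OF fin inf(2)]] by blast
  have yz: "y \<in> \<Gamma>" "z \<in> \<Gamma>" using y z cover by auto
  have eyz: "e y \<in> \<Gamma>" "e z \<in> \<Gamma>" using yz loc_orb_empty[OF e] by auto
  obtain G where G: "G \<in> \<G>" "G f = f" "e z = G (e y)"
    using one[OF yz y(2) z(2)] unfolding orb_def by auto
  have inv': "E (G y) (G z) \<longleftrightarrow> E y z" if "G \<in> \<G>" for G y z
    using inv[OF that, of y z] inv[OF inv_mem[OF that], of "G y" "G z"] inv_f(1)[OF that] by auto
  have "E f (e y) \<longleftrightarrow> E f (e z)" using inv'[OF G(1), of f "e y"] G by simp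
  \<comment> \<open>Whether both are equivalent to \<open>f\<close> or neither is, the presence of
    only two classes makes them equivalent to each other.\<close>
  then have "E (e y) (e z)" unfolding E[OF f eyz(1)] E[OF f eyz(2)] E[OF eyz] by blast
  moreover obtain H where "H \<in> \<G>" "e y = H y" "e z = H z" using loc_pair[OF e] by blast
  ultimately have "E y z" using inv'[of H y z] by simp
  then show False unfolding E[OF yz] using y z disj by blast
qed

lemma infinite_on_side: "finite F \<Longrightarrow> x \<in> \<Gamma> \<Longrightarrow> x \<notin> F \<Longrightarrow>
  infinite (orb F x \<inter> A) \<or> infinite (orb F x \<inter> B)"
proof -
  assume a: "finite F" "x \<in> \<Gamma>" "x \<notin> F"
  have "orb F x \<subseteq> \<Gamma>" using orb_antimono[of "{}" F x] orb_eq[OF a(2)] by auto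
  then have "orb F x = (orb F x \<inter> A) \<union> (orb F x \<inter> B)" using cover by auto
  then show ?thesis using orb_infinite[OF a(1,3)] by (metis finite_Un)
qed

text \<open>A common point brings along its whole orbit over \<open>F \<union> F'\<close>, which is
  infinite and contained in both orbits.\<close>

lemma meeting_orbits:
  assumes "finite F" "finite F'" "x \<in> \<Gamma>" "x \<notin> F" "x' \<notin> F'" "z \<in> orb F x" "z \<in> orb F' x'"
  shows "infinite (orb F x \<inter> orb F' x' \<inter> A) \<or> infinite (orb F x \<inter> orb F' x' \<inter> B)"
proof -
  have "z \<notin> F \<union> F'" using orb_notin assms by blast
  moreover have "z \<in> \<Gamma>" using assms orb_antimono[of "{}" F x] orb_eq[OF assms(3)] by auto
  ultimately have *: "infinite (orb (F \<union> F') z \<inter> A) \<or> infinite (orb (F \<union> F') z \<inter> B)"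
    using infinite_on_side assms by blast
  have "orb (F \<union> F') z \<subseteq> orb F x" "orb (F \<union> F') z \<subseteq> orb F' x'"
    using orb_antimono[of F "F \<union> F'" z] orb_antimono[of F' "F \<union> F'" z] orb_eq assms by auto
  then have "orb (F \<union> F') z \<inter> C \<subseteq> orb F x \<inter> orb F' x' \<inter> C" for C by blast
  then show ?thesis using * by (meson infinite_super)
qed

lemma large_orb:
  assumes "large (orb F x)" "G \<in> \<G>" shows "large (orb (G ` F) (G x))"
proof -
  obtain e where "loc e" "e ` \<Gamma> \<subseteq> orb F x" using assms(1) unfolding large_def by blast
  then have "G ` (e ` \<Gamma>) \<subseteq> orb (G ` F) (G x)"
    using orb_image[OF assms(2), of F x] by blast
  then have "(G \<circ> e) ` \<Gamma> \<subseteq> orb (G ` F) (G x)" by (simp add: image_comp)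
  moreover have "loc (G \<circ> e)" using \<open>loc e\<close> loc_comp loc_mem assms(2) by blast
  ultimately show ?thesis unfolding large_def by blast
qed

lemma large_orb_iff:
  assumes "G \<in> \<G>" shows "large (orb (G ` F) (G x)) \<longleftrightarrow> large (orb F x)"
  using large_orb[OF _ assms, of F x] large_orb[OF _ inv_mem[OF assms], of "G ` F" "G x"] inv_f(1)[OF assms]
  by (auto simp: image_image)

text \<open>\<open>J\<close> can be used with the same orbit as target for both sides.\<close>

lemma two_sided_large:
  assumes "finite F" "x \<notin> F" "infinite (orb F x \<inter> A)" "infinite (orb F x \<inter> B)"
  shows "large (orb F x)"
  using J[OF assms(1,1,2,2,3,4)] cover unfolding large_def by (metis image_Un le_sup_iff)

text \<open>If translates of a small orbit \<open>P\<close> lie on different sides, then lying in a common translate of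
  \<open>P\<close> would be an invariant equivalence relation with exactly two classes.\<close>

lemma small_same_side:
  assumes F: "finite F" "x \<in> \<Gamma>" "x \<notin> F" and small: "\<not> large (orb F x)"
    and G: "G \<in> \<G>" "infinite (orb (G ` F) (G x) \<inter> A)"
    and H: "H \<in> \<G>" "infinite (orb (H ` F) (H x) \<inter> B)"
  shows False
proof -
  let ?P = "\<lambda>G. orb (G ` F) (G x)"
  have fin: "finite (G ` F)" for G :: "nat \<Rightarrow> nat" using F by simp
  have notin: "G x \<notin> G ` F" if "G \<in> \<G>" for G using F mem_inj[OF that] by auto
  have in\<Gamma>: "G x \<in> \<Gamma>" if "G \<in> \<G>" for G using orb_step[OF F(2) that] by simp
  \<comment> \<open>A translate infinite on both sides is large, and largeness is invariant under
    translation.\<close>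
  have one: "\<not> (infinite (?P G \<inter> A) \<and> infinite (?P G \<inter> B))" if "G \<in> \<G>" for G
    using two_sided_large[OF fin notin[OF that]] small large_orb_iff[OF that] by blast
  \<comment> \<open>A common point would give infinitely many common points on one side, and then
    one of the two translates would be infinite on both sides.\<close>
  have apart: "?P G \<inter> ?P H = {}"
    if gh: "G \<in> \<G>" "H \<in> \<G>" and i: "infinite (?P G \<inter> A)" "infinite (?P H \<inter> B)" for G H
  proof (rule ccontr)
    assume "?P G \<inter> ?P H \<noteq> {}"
    then obtain z where "z \<in> ?P G" "z \<in> ?P H" by blast
    then have "infinite (?P G \<inter> ?P H \<inter> A) \<or> infinite (?P G \<inter> ?P H \<inter> B)"
      using meeting_orbits[OF fin fin in\<Gamma>[OF gh(1)] notin[OF gh(1)] notin[OF gh(2)]] by blast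
    moreover have "?P G \<inter> ?P H \<inter> A \<subseteq> ?P H \<inter> A" "?P G \<inter> ?P H \<inter> B \<subseteq> ?P G \<inter> B" by auto
    ultimately have "infinite (?P H \<inter> A) \<or> infinite (?P G \<inter> B)"
      by (meson infinite_super)
    then show False using one i gh by blast
  qed
  define E where "E u v \<longleftrightarrow> (\<exists>G\<in>\<G>. u \<in> ?P G \<and> v \<in> ?P G)" for u v
  \<comment> \<open>This \<open>e\<close> sends \<open>A\<close> into a translate living on side
    \<open>A\<close> and \<open>B\<close> into one living on side \<open>B\<close>. Pulling
    \<open>E\<close> back along \<open>e\<close> does not change it, which identifies its classes as
    \<open>A\<close> and \<open>B\<close>.\<close>
  obtain e where e: "loc e" "e ` A \<subseteq> ?P G" "e ` B \<subseteq> ?P H"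
    using J[OF fin fin notin[OF G(1)] notin[OF H(1)] G(2) H(2)] by blast
  have inv: "E (K u) (K v)" if K: "K \<in> \<G>" and uv: "E u v" for K u v
  proof -
    obtain G where G: "G \<in> \<G>" "u \<in> ?P G" "v \<in> ?P G" using uv unfolding E_def by blast
    have "K ` ?P G = ?P (K \<circ> G)" using orb_image[OF K] by (simp add: image_image)
    then show ?thesis unfolding E_def using comp_mem[OF K G(1)] G by (metis imageI)
  qed
  have eE: "E (e y) (e z) \<longleftrightarrow> E y z" for y z
  proof -
    obtain K where K: "K \<in> \<G>" "e y = K y" "e z = K z" using loc_pair[OF e(1)] by blast
    then show ?thesis using inv[OF K(1), of y z] inv[OF inv_mem[OF K(1)], of "e y" "e z"] inv_f(1)[OF K(1)]
      by auto
  qed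
  \<comment> \<open>A translate through both points would be infinite on some side, hence disjoint
    from whichever of the two given translates lives on the other side.\<close>
  have cross: "\<not> E u v" if uv: "u \<in> ?P G" "v \<in> ?P H" for u v
  proof
    assume "E u v"
    then obtain K where K: "K \<in> \<G>" "u \<in> ?P K" "v \<in> ?P K" unfolding E_def by blast
    have "infinite (?P K \<inter> A) \<or> infinite (?P K \<inter> B)"
      using infinite_on_side[OF fin in\<Gamma>[OF K(1)] notin[OF K(1)]] .
    then show False using apart[OF K(1) H(1) _ H(2)] apart[OF G(1) K(1) G(2)] uv K by blast
  qed
  have sym: "E u v \<Longrightarrow> E v u" for u v unfolding E_def by blast
  have "E y z \<longleftrightarrow> (y \<in> A \<longleftrightarrow> z \<in> A)" if "y \<in> \<Gamma>" "z \<in> \<Gamma>" for y z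
  proof -
    have AA: "E y z" if "y \<in> A" "z \<in> A" for y z
      using that e(2) G(1) eE[of y z] unfolding E_def by blast
    have BB: "E y z" if "y \<in> B" "z \<in> B" for y z
      using that e(3) H(1) eE[of y z] unfolding E_def by blast
    have AB: "\<not> E y z" if "y \<in> A" "z \<in> B" for y z
      using that e cross[of "e y" "e z"] eE[of y z] by blast
    show ?thesis using AA BB AB sym that cover disj by blast
  qed
  moreover have "infinite A" "infinite B"
    using G(2) H(2) by (meson finite_Int)+
  ultimately show False using no_two_classes[of E] inv by blast
qed

lemma large_if_on_A:
  assumes F: "finite F" "x \<in> \<Gamma>" "x \<notin> F" and inf: "infinite (orb F x \<inter> A)"
  shows "large (orb F x)"
proof (rule ccontr)
  assume small: "\<not> large (orb F x)"
  have onA: "finite (orb (G ` F) (G x) \<inter> B)" if "G \<in> \<G>" for G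
    using small_same_side[OF F small id_mem _ that] inf by auto
  show False
  proof (cases "\<forall>F x. finite F \<longrightarrow> x \<in> \<Gamma> \<longrightarrow> x \<notin> F \<longrightarrow> infinite (orb F x \<inter> A)")
    case True
    have "\<exists>e. loc e \<and> e ` \<Gamma> \<subseteq> A"
    proof (rule rich_embedding)
      show "G x \<in> \<Gamma>" if "G \<in> \<G>" "x \<in> \<Gamma>" for G x using orb_empty_inv that .
      show "orb F x \<inter> A \<noteq> {}" if "finite F" "x \<in> \<Gamma>" "x \<notin> F" for F x
        using True that by (metis finite.emptyI)
    qed
    then obtain e where e: "loc e" "e ` \<Gamma> \<subseteq> A" by blast
    obtain e' where e': "loc e'" "e' ` A \<subseteq> orb F x" using JA[OF F(1,3) inf] by blast
    have "loc (e' \<circ> e)" "(e' \<circ> e) ` \<Gamma> \<subseteq> orb F x"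
      using loc_comp[OF e'(1) e(1)] e e' by auto
    then show False using small unfolding large_def by blast
  next
    case False
    then obtain F1 x1 where F1: "finite F1" "x1 \<in> \<Gamma>" "x1 \<notin> F1" and fin: "finite (orb F1 x1 \<inter> A)"
      by blast
    have inf1: "infinite (orb F1 x1 \<inter> B)" using infinite_on_side[OF F1] fin by blast
    \<comment> \<open>A copy inside this orbit would place the image of \<open>orb F x\<close> both
      there, where only finitely many points belong to \<open>A\<close>, and in a translate of
      \<open>orb F x\<close>, where only finitely many belong to \<open>B\<close>. The image would
      be finite.\<close>
    have small1: "\<not> large (orb F1 x1)"
    proof
      assume "large (orb F1 x1)"
      then obtain e where e: "loc e" "e ` \<Gamma> \<subseteq> orb F1 x1" unfolding large_def by blast
      obtain G where G: "G \<in> \<G>" "\<forall>f\<in>insert x F. e f = G f"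
        using e(1) F(1) unfolding loc_def by (meson finite_insert)
      have sub: "e ` orb F x \<subseteq> orb (G ` F) (G x)"
      proof
        fix w assume "w \<in> e ` orb F x"
        then obtain z where z: "z \<in> orb F x" "w = e z" by blast
        \<comment> \<open>\<open>H\<close> imitates \<open>e\<close> on \<open>F\<close> and at
          \<open>z\<close>, while \<open>G\<close> does so on \<open>F\<close> and at
          \<open>x\<close>. Since \<open>G \<circ> inv H\<close> fixes the common image of
          \<open>F\<close>, both lead to the same orbit.\<close>
        obtain H where H: "H \<in> \<G>" "\<forall>f\<in>insert z F. e f = H f"
          using e(1) F(1) unfolding loc_def by (meson finite_insert)
        have "H z \<in> orb (H ` F) (H x)" using orb_image[OF H(1), of F x] z by blast
        moreover have HG: "H ` F = G ` F" using G H by force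
        ultimately have *: "w \<in> orb (G ` F) (H x)" using z H by simp
        have "(G \<circ> inv H) (H x) \<in> orb (G ` F) (H x)"
        proof (rule orb_step[OF orb_self])
          show "G \<circ> inv H \<in> \<G>" using G H comp_mem inv_mem by blast
          show "(G \<circ> inv H) f = f" if f: "f \<in> G ` F" for f
          proof -
            obtain g where g: "g \<in> F" "f = G g" using f by blast
            then have "f = H g" using G H by auto
            then show ?thesis using g inv_f(1)[OF H(1)] by simp
          qed
        qed
        then have "G x \<in> orb (G ` F) (H x)" using inv_f(1)[OF H(1)] by simp
        then show "w \<in> orb (G ` F) (G x)" using * orb_eq by blast
      qed
      have "orb F x \<subseteq> \<Gamma>" using orb_antimono[of "{}" F x] orb_eq[OF F(2)] by auto
      then have "e ` orb F x \<subseteq> orb F1 x1" using e by blast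
      moreover have "orb F1 x1 \<subseteq> \<Gamma>" using orb_antimono[of "{}" F1 x1] orb_eq[OF F1(2)] by auto
      ultimately have "e ` orb F x \<subseteq> (orb F1 x1 \<inter> A) \<union> (orb (G ` F) (G x) \<inter> B)"
        using sub cover by blast
      then have "finite (e ` orb F x)" using fin onA[OF G(1)] by (meson finite_UnI finite_subset)
      moreover have "inj_on e (orb F x)" using loc_inj[OF e(1)] by (simp add: inj_on_def)
      ultimately show False using orb_infinite[OF F(1,3)] finite_imageD by blast
    qed
    have onB: "finite (orb (G ` F1) (G x1) \<inter> A)" if "G \<in> \<G>" for G
      using small_same_side[OF F1 small1 that _ id_mem] inf1 by auto
    have "x1 \<in> orb {} x" using orb_eq[OF F(2)] F1(2) by simp
    \<comment> \<open>By transitivity some translate of \<open>orb F x\<close> passes through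
      \<open>x1\<close>. Its intersection with \<open>orb F1 x1\<close> is infinite on one side, but
      \<open>A\<close> is excluded by the second orbit and \<open>B\<close> by the
      translate.\<close>
    then obtain G where G: "G \<in> \<G>" "G x = x1" unfolding orb_def by auto
    have n: "G x \<notin> G ` F" using F mem_inj[OF G(1)] by auto
    have "infinite (orb (G ` F) (G x) \<inter> orb F1 x1 \<inter> A) \<or> infinite (orb (G ` F) (G x) \<inter> orb F1 x1 \<inter> B)"
      by (rule meeting_orbits[of _ _ _ _ x1]) (use F F1 G n orb_self in auto)
    moreover have "orb (G ` F) (G x) \<inter> orb F1 x1 \<inter> A \<subseteq> orb F1 x1 \<inter> A"
      "orb (G ` F) (G x) \<inter> orb F1 x1 \<inter> B \<subseteq> orb (G ` F) (G x) \<inter> B" by auto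
    ultimately show False using fin onA[OF G(1)] by (meson infinite_super)
  qed
qed

lemma all_large:
  assumes "finite F" "x \<in> \<Gamma>" "x \<notin> F"
  shows "large (orb F x)"
proof -
  interpret sw: sided \<G> x0 B A by (rule swap_sides)
  show ?thesis
    using infinite_on_side[OF assms] large_if_on_A[OF assms] sw.large_if_on_A[OF assms]
    unfolding large_def sw.large_def by blast
qed

lemma two_colours: "\<exists>e. loc e \<and> (e ` \<Gamma> \<subseteq> R \<or> e ` \<Gamma> \<inter> R = {})"
proof (cases "\<forall>F x. finite F \<longrightarrow> x \<in> \<Gamma> \<longrightarrow> x \<notin> F \<longrightarrow> orb F x \<inter> R \<noteq> {}")
  case True
  then have "\<exists>e. loc e \<and> e ` \<Gamma> \<subseteq> R"
    using rich_embedding[of \<Gamma> R] orb_empty_inv by blast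
  then show ?thesis by blast
next
  case False
  then obtain F x where F: "finite F" "x \<in> \<Gamma>" "x \<notin> F" "orb F x \<inter> R = {}" by blast
  then obtain e where "loc e" "e ` \<Gamma> \<subseteq> orb F x" using all_large unfolding large_def by blast
  then show ?thesis using F by blast
qed

text \<open>Induction removing the top colour: a copy either has only that colour or omits it, and
  in the latter case the colouring pulled back along \<open>e\<close> uses fewer colours.\<close>

lemma finitely_many_colours:
  fixes c :: "nat \<Rightarrow> nat"
  assumes "c ` \<Gamma> \<subseteq> {..<n}"
  shows "\<exists>e. loc e \<and> (\<forall>y\<in>\<Gamma>. \<forall>z\<in>\<Gamma>. c (e y) = c (e z))"
  using assms
proof (induction n arbitrary: c)
  case 0
  then show ?case using loc_mem[OF id_mem] orb_self by auto
next
  case (Suc n)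
  obtain e where e: "loc e" "e ` \<Gamma> \<subseteq> {x. c x = n} \<or> e ` \<Gamma> \<inter> {x. c x = n} = {}"
    using two_colours by blast
  show ?case
  proof (cases "e ` \<Gamma> \<subseteq> {x. c x = n}")
    case True
    then have "c (e y) = n" if "y \<in> \<Gamma>" for y using that by auto
    then show ?thesis using e(1) by (intro exI[of _ e]) simp
  next
    case False
    have "e y \<in> \<Gamma>" if "y \<in> \<Gamma>" for y using that loc_orb_empty[OF e(1)] by blast
    then have "c (e y) < Suc n" if "y \<in> \<Gamma>" for y using that Suc.prems by blast
    moreover have "c (e y) \<noteq> n" if "y \<in> \<Gamma>" for y using that e(2) False by auto
    ultimately have "(c \<circ> e) ` \<Gamma> \<subseteq> {..<n}" by (force simp: less_Suc_eq)
    from Suc.IH[OF this] obtain e' where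
      e': "loc e'" "\<forall>y\<in>\<Gamma>. \<forall>z\<in>\<Gamma>. (c \<circ> e) (e' y) = (c \<circ> e) (e' z)" by blast
    then have "c ((e \<circ> e') y) = c ((e \<circ> e') z)" if "y \<in> \<Gamma>" "z \<in> \<Gamma>" for y z
      using bspec[OF bspec[OF e'(2) that(1)] that(2)] by simp
    then show ?thesis using loc_comp[OF e(1) e'(1)] by blast
  qed
qed

end

section \<open>Nodes of the coding tree\<close>

text \<open>The facts common to both kinds of coding tree. A symbol missing from \<open>L\<close> is
  unary, so types in the tree lose only unary information, which \<open>unary_label\<close>
  restores.\<close>

locale limit_coding_tree = coding_tree ar K L ord
  for ar :: "'r::finite \<Rightarrow> nat" and K :: "(nat, 'r) rstruct" and L :: "'r set" and ord :: "'r lit rel" +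
  assumes L_big: "\<exists>R\<in>L. 2 \<le> ar R"
    and L_non_unary: "ar R \<noteq> 1 \<Longrightarrow> R \<in> L"
    and ar_pos: "1 \<le> ar R"
    and order: "formula_order ord"
    and struct: "is_struct ar K"
    and univ_K: "univ K = UNIV"
    and distinct_K: "xs \<in> interp K R \<Longrightarrow> distinct xs"
begin

lemma interp_length: "xs \<in> interp K R \<Longrightarrow> length xs = ar R"
  using struct unfolding is_struct_def by blast

lemma Pos_tp: "Pos R ts \<in> tp i n \<longleftrightarrow>
    R \<in> L \<and> length ts = ar R \<and> set ts \<subseteq> insert X (V ` {..<n}) \<and> map (tm_val i) ts \<in> interp K R"
  unfolding tp_def qftp_def by auto

lemma Neg_tp: "Neg R ts \<in> tp i n \<longleftrightarrow>
    R \<in> L \<and> length ts = ar R \<and> set ts \<subseteq> insert X (V ` {..<n}) \<and> map (tm_val i) ts \<notin> interp K R"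
  unfolding tp_def qftp_def by auto

lemma tm_set_iff: "set ts \<subseteq> insert X (V ` B) \<longleftrightarrow> {i. V i \<in> set ts} \<subseteq> B"
proof
  assume "{i. V i \<in> set ts} \<subseteq> B"
  then show "set ts \<subseteq> insert X (V ` B)"
    by (auto) (metis image_eqI mem_Collect_eq subsetD tm.exhaust)
qed auto

lemma params_tp: "\<phi> \<in> tp i n \<Longrightarrow> params \<phi> \<subseteq> {..<n}"
  by (cases \<phi>) (auto simp: Pos_tp Neg_tp)

lemma tp_nonempty: "tp i n \<noteq> {}"
proof -
  obtain R where R: "R \<in> L" using L_big by blast
  let ?ts = "replicate (ar R) X"
  have "Pos R ?ts \<in> tp i n \<or> Neg R ?ts \<in> tp i n"
    using R by (auto simp: Pos_tp Neg_tp)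
  then show ?thesis by auto
qed

lemma len_tp [simp]: "len (tp i n) = Suc n"
proof -
  have "(LEAST m. \<forall>\<phi>\<in>tp i n. params \<phi> \<subseteq> {..<m}) = n"
  proof (rule Least_equality)
    show "\<forall>\<phi>\<in>tp i n. params \<phi> \<subseteq> {..<n}" using params_tp by blast
    fix m assume m: "\<forall>\<phi>\<in>tp i n. params \<phi> \<subseteq> {..<m}"
    show "n \<le> m"
    proof (cases n)
      case (Suc k)
      obtain R where R: "R \<in> L" "2 \<le> ar R" using L_big by blast
      \<comment> \<open>A complete type contains this literal or its negation, and both mention the
        last parameter \<open>k\<close>, so no smaller bound on the parameters works.\<close>
      let ?ts = "V k # replicate (ar R - 1) X"
      have "Pos R ?ts \<in> tp i n \<or> Neg R ?ts \<in> tp i n"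
        using R Suc by (auto simp: Pos_tp Neg_tp)
      then have "k < m" using m by fastforce
      then show ?thesis using Suc by simp
    qed simp
  qed
  then show ?thesis unfolding len_def using tp_nonempty by simp
qed

lemma len_empty [simp]: "len {} = 0"
  by (simp add: len_def)

lemma restr_tp: "0 < l \<Longrightarrow> l \<le> Suc n \<Longrightarrow> restr (tp i n) l = tp i (l - 1)"
proof -
  assume l: "0 < l" "l \<le> Suc n"
  have "\<phi> \<in> type_restr (tp i n) {..<l - 1} \<longleftrightarrow> \<phi> \<in> tp i (l - 1)" for \<phi>
  proof (cases \<phi>)
    case (Pos R ts)
    have "{..<l - 1} \<subseteq> {..<n}" using l by auto
    then show ?thesis unfolding type_restr_def Pos using l by (auto simp: Pos_tp tm_set_iff)
  next
    case (Neg R ts)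
    have "{..<l - 1} \<subseteq> {..<n}" using l by auto
    then show ?thesis unfolding type_restr_def Neg using l by (auto simp: Neg_tp tm_set_iff)
  qed
  then show ?thesis unfolding restr_def using l by auto
qed

lemma restr_zero [simp]: "restr s 0 = {}"
  by (simp add: restr_def)

text \<open>A complete type decides every literal over its parameters. A type containing it must
  therefore have all these parameters and decide the literals in the same way.\<close>

lemma tp_subset_imp: assumes "tp i n \<subseteq> tp j m" shows "n \<le> m" "tp j n = tp i n"
proof -
  show nm: "n \<le> m"
  proof (rule ccontr)
    assume "\<not> n \<le> m"
    then obtain k where k: "n = Suc k" "m \<le> k" using less_imp_Suc_add[of m n] by auto
    obtain R where R: "R \<in> L" "2 \<le> ar R" using L_big by blast
    let ?ts = "V k # replicate (ar R - 1) X"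
    have "Pos R ?ts \<in> tp i n \<or> Neg R ?ts \<in> tp i n"
      using R k by (auto simp: Pos_tp Neg_tp)
    then have "Pos R ?ts \<in> tp j m \<or> Neg R ?ts \<in> tp j m" using assms by blast
    then show False using k by (auto simp: Pos_tp Neg_tp)
  qed
  have eq: "map (tm_val j) ts \<in> interp K R \<longleftrightarrow> map (tm_val i) ts \<in> interp K R"
    if "R \<in> L" "length ts = ar R" "set ts \<subseteq> insert X (V ` {..<n})" for R ts
  proof -
    have "Pos R ts \<in> tp i n \<or> Neg R ts \<in> tp i n" using that by (auto simp: Pos_tp Neg_tp)
    then show ?thesis
    proof
      assume "Pos R ts \<in> tp i n"
      then have "Pos R ts \<in> tp j m" "Pos R ts \<in> tp i n" using assms by auto
      then show ?thesis by (simp add: Pos_tp)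
    next
      assume "Neg R ts \<in> tp i n"
      then have "Neg R ts \<in> tp j m" "Neg R ts \<in> tp i n" using assms by auto
      then show ?thesis by (simp add: Neg_tp)
    qed
  qed
  show "tp j n = tp i n"
  proof (rule set_eqI)
    fix \<phi> show "\<phi> \<in> tp j n \<longleftrightarrow> \<phi> \<in> tp i n"
      using eq by (cases \<phi>) (auto simp: Pos_tp Neg_tp)
  qed
qed

lemma tp_mono: "n \<le> m \<Longrightarrow> tp i n \<subseteq> tp i m"
proof
  fix \<phi> assume "n \<le> m" "\<phi> \<in> tp i n"
  then show "\<phi> \<in> tp i m" by (cases \<phi>) (auto simp: Pos_tp Neg_tp)
qed

section \<open>Nodes, restrictions and meets\<close>

lemma tree_iff: "t \<in> tree \<longleftrightarrow> (\<exists>i n. n \<le> i \<and> t = tp i n)"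
  unfolding tree_def tree_level_def by auto

lemma treeE: assumes "t \<in> tree" obtains i n where "n \<le> i" "t = tp i n" "len t = Suc n"
  using assms len_tp unfolding tree_iff by auto

lemma tree_nonempty: "t \<in> tree \<Longrightarrow> t \<noteq> {}"
  using tp_nonempty by (auto simp: tree_iff)

lemma tree_len_pos: "t \<in> tree \<Longrightarrow> 0 < len t"
  by (auto simp: tree_iff)

lemma restr_in_tree:
  assumes "t \<in> tree" "0 < l" "l \<le> len t"
  shows "restr t l \<in> tree" "len (restr t l) = l" "restr t l \<subseteq> t"
proof -
  obtain i n where t: "n \<le> i" "t = tp i n" "len t = Suc n" using treeE assms(1) by blast
  have r: "restr t l = tp i (l - 1)" using restr_tp t assms by simp
  show "restr t l \<in> tree" unfolding r tree_iff using t assms by (intro exI[of _ i] exI[of _ "l - 1"]) simp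
  show "len (restr t l) = l" using r assms by simp
  show "restr t l \<subseteq> t" using r t assms tp_mono by simp
qed

lemma restr_restr:
  assumes "t \<in> tree" "m \<le> l" "l \<le> len t" shows "restr (restr t l) m = restr t m"
proof (cases "m = 0")
  case False
  obtain i n where t: "n \<le> i" "t = tp i n" "len t = Suc n" using treeE assms(1) by blast
  have "restr t l = tp i (l - 1)" "restr t m = tp i (m - 1)" using restr_tp t assms False by auto
  then show ?thesis using restr_tp[of m "l - 1" i] assms False by simp
qed simp

lemma restr_len: "t \<in> tree \<Longrightarrow> restr t (len t) = t"
  by (auto elim!: treeE simp: restr_tp)

lemma node_subset_iff:
  assumes "s \<in> tree" "t \<in> tree"
  shows "s \<subseteq> t \<longleftrightarrow> len s \<le> len t \<and> restr t (len s) = s"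
proof -
  obtain i n where s: "n \<le> i" "s = tp i n" using treeE assms(1) by blast
  obtain j m where t: "m \<le> j" "t = tp j m" using treeE assms(2) by blast
  show ?thesis
    unfolding s(2) t(2) using tp_subset_imp[of i n j m] tp_mono[of n m j]
    by (auto simp: restr_tp)
qed

lemma node_subset_len: "s \<in> tree \<Longrightarrow> t \<in> tree \<Longrightarrow> s \<subseteq> t \<Longrightarrow> len s \<le> len t"
  using node_subset_iff by blast

lemma node_subset_restr: "s \<in> tree \<Longrightarrow> t \<in> tree \<Longrightarrow> s \<subseteq> t \<Longrightarrow> m \<le> len s \<Longrightarrow> restr t m = restr s m"
  using node_subset_iff restr_restr by metis

lemma node_psubset_len: "s \<in> tree \<Longrightarrow> t \<in> tree \<Longrightarrow> s \<subset> t \<Longrightarrow> len s < len t"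
  using node_subset_iff restr_len by (metis le_neq_implies_less psubset_imp_subset psubset_eq)

lemma chain_comparable:
  assumes "r \<in> tree" "s \<in> tree" "t \<in> tree" "r \<subseteq> t" "s \<subseteq> t" "len r \<le> len s"
  shows "r \<subseteq> s"
  using assms node_subset_restr[of s t "len r"] node_subset_iff[of r t] node_subset_iff[of r s] by simp

lemma same_len_subset: "s \<in> tree \<Longrightarrow> t \<in> tree \<Longrightarrow> s \<subseteq> t \<Longrightarrow> len s = len t \<Longrightarrow> s = t"
  using node_subset_iff restr_len by metis

text \<open>The lengths at which two nodes agree form an initial segment, which always contains 0
  because restrictions to length 0 are empty. The meet is taken at the largest such length and is
  empty if the roots differ.\<close>

lemma meetE:
  assumes "s \<in> tree" "t \<in> tree"
  obtains g where "meet s t = restr s g" "meet s t = restr t g" "g \<le> len s" "g \<le> len t"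
    "len (meet s t) = g"
    "\<forall>m. m \<le> len s \<longrightarrow> m \<le> len t \<longrightarrow> (restr s m = restr t m \<longleftrightarrow> m \<le> g)"
proof -
  let ?P = "\<lambda>m. m \<le> len s \<and> m \<le> len t \<and> restr s m = restr t m"
  define g where "g = (GREATEST m. ?P m)"
  have P0: "?P 0" by simp
  have bd: "\<And>y. ?P y \<Longrightarrow> y \<le> len s" by simp
  have g: "?P g" unfolding g_def using GreatestI_nat[of ?P, OF P0 bd] .
  have max: "m \<le> g" if "?P m" for m unfolding g_def using Greatest_le_nat[of ?P, OF that bd] .
  have low: "restr s m = restr t m" if "m \<le> g" for m
    using g restr_restr[OF assms(1) that] restr_restr[OF assms(2) that] by metis
  have eq: "meet s t = restr s g" unfolding meet_def g_def ..
  have "len (restr s g) = g"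
    using restr_in_tree(2)[OF assms(1), of g] g by (cases "g = 0") auto
  then show thesis using eq g low max by (intro that[of g]) auto
qed

lemma meet_subset:
  assumes "s \<in> tree" "t \<in> tree" "s \<subseteq> t" shows "meet s t = s" "meet t s = s"
proof -
  have st: "len s \<le> len t" "restr t (len s) = s" using node_subset_iff assms by auto
  obtain g where g: "meet s t = restr s g" "meet s t = restr t g" "g \<le> len s" "g \<le> len t"
    "len (meet s t) = g"
    "\<forall>m. m \<le> len s \<longrightarrow> m \<le> len t \<longrightarrow> (restr s m = restr t m \<longleftrightarrow> m \<le> g)"
    using meetE[OF assms(1,2)] .
  have "len s \<le> g" using g(6)[rule_format, of "len s"] st restr_len[OF assms(1)] by simp
  then have "g = len s" using g(3) by simp
  then show "meet s t = s" using g(1) restr_len[OF assms(1)] by simp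
  obtain h where h: "meet t s = restr t h" "meet t s = restr s h" "h \<le> len t" "h \<le> len s"
    "len (meet t s) = h"
    "\<forall>m. m \<le> len t \<longrightarrow> m \<le> len s \<longrightarrow> (restr t m = restr s m \<longleftrightarrow> m \<le> h)"
    using meetE[OF assms(2,1)] .
  have "len s \<le> h" using h(6)[rule_format, of "len s"] st restr_len[OF assms(1)] by simp
  then have "h = len s" using h(4) by simp
  then show "meet t s = s" using h(2) restr_len[OF assms(1)] by simp
qed

lemma incomparable_meetE:
  assumes "s \<in> tree" "t \<in> tree" "\<not> comparable s t"
  obtains g where "meet s t = restr s g" "meet s t = restr t g" "g < len s" "g < len t"
    "len (meet s t) = g" "restr s (Suc g) \<noteq> restr t (Suc g)"
    "\<forall>m. m \<le> len s \<longrightarrow> m \<le> len t \<longrightarrow> (restr s m = restr t m \<longleftrightarrow> m \<le> g)"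
proof -
  obtain g where g: "meet s t = restr s g" "meet s t = restr t g" "g \<le> len s" "g \<le> len t"
    "len (meet s t) = g"
    "\<forall>m. m \<le> len s \<longrightarrow> m \<le> len t \<longrightarrow> (restr s m = restr t m \<longleftrightarrow> m \<le> g)"
    using meetE[OF assms(1,2)] .
  have "g \<noteq> len s"
    using g(1,2,4) assms node_subset_iff[OF assms(1,2)] restr_len[OF assms(1)]
    unfolding comparable_def by auto
  moreover have "g \<noteq> len t"
    using g(1,2,3) assms node_subset_iff[OF assms(2,1)] restr_len[OF assms(2)]
    unfolding comparable_def by auto
  ultimately have "g < len s" "g < len t" using g by auto
  then show thesis using that[of g] g(1,2,5) g(6)[rule_format, of "Suc g"] g(6) by simp
qed

lemma comparable_sym: "comparable s t \<longleftrightarrow> comparable t s"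
  unfolding comparable_def by blast

lemma differing_incomparable:
  assumes "s \<in> tree" "t \<in> tree" "m \<le> len s" "m \<le> len t" "restr s m \<noteq> restr t m"
  shows "\<not> comparable s t"
proof
  assume "comparable s t"
  then show False unfolding comparable_def
  proof
    assume "s \<subseteq> t"
    then show False using node_subset_restr[of s t m] assms by simp
  next
    assume "t \<subseteq> s"
    then show False using node_subset_restr[of t s m] assms by simp
  qed
qed

lemma same_len_incomparable:
  "s \<in> tree \<Longrightarrow> t \<in> tree \<Longrightarrow> len s = len t \<Longrightarrow> s \<noteq> t \<Longrightarrow> \<not> comparable s t"
  unfolding comparable_def using same_len_subset by metis

text \<open>The meet and the order of incomparable nodes are decided at the first length where they
  differ, and extending the nodes does not touch that length.\<close>

lemma extend_incomparable:
  assumes "s \<in> tree" "t \<in> tree" "s' \<in> tree" "t' \<in> tree" "s \<subseteq> s'" "t \<subseteq> t'" "\<not> comparable s t"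
  shows "\<not> comparable s' t'" "meet s' t' = meet s t" "prec s' t' \<longleftrightarrow> prec s t"
proof -
  obtain g where g: "meet s t = restr s g" "meet s t = restr t g" "g < len s" "g < len t"
    "len (meet s t) = g" "restr s (Suc g) \<noteq> restr t (Suc g)"
    "\<forall>m. m \<le> len s \<longrightarrow> m \<le> len t \<longrightarrow> (restr s m = restr t m \<longleftrightarrow> m \<le> g)"
    using incomparable_meetE[OF assms(1,2,7)] .
  have ls: "len s \<le> len s'" "len t \<le> len t'" using node_subset_len assms by auto
  have rs: "restr s' m = restr s m" if "m \<le> len s" for m using node_subset_restr assms that by blast
  have rt: "restr t' m = restr t m" if "m \<le> len t" for m using node_subset_restr assms that by blast
  show inc: "\<not> comparable s' t'"
    by (rule differing_incomparable[of _ _ "Suc g"]) (use g ls rs rt assms in auto)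
  obtain h where h: "meet s' t' = restr s' h" "meet s' t' = restr t' h" "h < len s'" "h < len t'"
    "len (meet s' t') = h" "restr s' (Suc h) \<noteq> restr t' (Suc h)"
    "\<forall>m. m \<le> len s' \<longrightarrow> m \<le> len t' \<longrightarrow> (restr s' m = restr t' m \<longleftrightarrow> m \<le> h)"
    using incomparable_meetE[OF assms(3,4) inc] .
  have "\<not> Suc g \<le> h" using h(7)[rule_format, of "Suc g"] g(6) rs[of "Suc g"] rt[of "Suc g"] ls g(3,4) by auto
  moreover have "g \<le> h" using h(7)[rule_format, of g] g(7)[rule_format, of g] rs[of g] rt[of g] ls g(3,4) by auto
  ultimately have hg: "h = g" by simp
  then show m: "meet s' t' = meet s t" using h(1) g(1,3) rs[of g] by simp
  have sub: "\<not> s' \<subset> t'" "\<not> s \<subset> t" using inc assms(7) unfolding comparable_def by auto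
  show "prec s' t' \<longleftrightarrow> prec s t"
    unfolding prec_def m using sub inc assms(7) g(3,4,5) rs[of "Suc g"] rt[of "Suc g"] by simp
qed

lemma meet_ge:
  assumes "r \<in> tree" "s \<in> tree" "t \<in> tree" "r \<subseteq> s" "r \<subseteq> t"
  shows "len r \<le> len (meet s t)" "r \<subseteq> meet s t" "meet s t \<in> tree"
proof -
  obtain g where g: "meet s t = restr s g" "meet s t = restr t g" "g \<le> len s" "g \<le> len t"
    "len (meet s t) = g"
    "\<forall>m. m \<le> len s \<longrightarrow> m \<le> len t \<longrightarrow> (restr s m = restr t m \<longleftrightarrow> m \<le> g)"
    using meetE[OF assms(2,3)] .
  have "restr s (len r) = r" "restr t (len r) = r" "len r \<le> len s" "len r \<le> len t"
    using node_subset_iff assms by auto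
  then show rg: "len r \<le> len (meet s t)" using g(6)[rule_format, of "len r"] g(5) by simp
  have g0: "0 < g" using rg g tree_len_pos[OF assms(1)] by simp
  show mt: "meet s t \<in> tree" using restr_in_tree[OF assms(2) g0 g(3)] g by simp
  show "r \<subseteq> meet s t"
    using chain_comparable[OF assms(1) mt assms(2,4) _ rg] restr_in_tree[OF assms(2) g0 g(3)] g by simp
qed

lemma cn_in_tree: "cn i \<in> tree"
  unfolding cn_def tree_iff by blast

lemma len_cn [simp]: "len (cn i) = Suc i"
  unfolding cn_def by simp

lemma cn_subset_cn: "cn i \<subseteq> cn j \<Longrightarrow> i \<le> j \<and> tp j i = tp i i"
  unfolding cn_def using tp_subset_imp by blast

text \<open>Since the language is finite, nodes of bounded length are sets of literals from a finite
  supply.\<close>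

lemma finite_level: "finite {t \<in> tree. len t = l}"
proof -
  let ?X = "insert X (V ` {..<l})"
  let ?ls = "\<lambda>R. {ts. set ts \<subseteq> ?X \<and> length ts = ar R}"
  let ?Lit = "(\<Union>R\<in>UNIV. Pos R ` ?ls R) \<union> (\<Union>R\<in>UNIV. Neg R ` ?ls R)"
  have "finite (?ls R)" for R by (rule finite_lists_length_eq) simp
  then have "finite ?Lit" by simp
  moreover have "{t \<in> tree. len t = l} \<subseteq> Pow ?Lit"
  proof
    fix t assume "t \<in> {t \<in> tree. len t = l}"
    then obtain i n where t: "t = tp i n" "n < l" by (auto elim: treeE)
    have "\<phi> \<in> ?Lit" if \<phi>: "\<phi> \<in> t" for \<phi>
    proof (cases \<phi>)
      case (Pos R ts)
      then have "ts \<in> ?ls R" using \<phi> t by (auto simp: Pos_tp)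
      then show ?thesis using Pos by blast
    next
      case (Neg R ts)
      then have "ts \<in> ?ls R" using \<phi> t by (auto simp: Neg_tp)
      then show ?thesis using Neg by blast
    qed
    then show "t \<in> Pow ?Lit" by (intro PowI subsetI)
  qed
  ultimately show ?thesis by (meson finite_Pow_iff finite_subset)
qed

text \<open>The node of length 1 below a vertex is its type over no parameters, which is the part of
  its label in the symbols of \<open>L\<close>. Vertices of one sort thus lie over one root.\<close>

lemma unary_label_root: "unary_label i = unary_label j \<Longrightarrow> tp i 0 = tp j 0"
proof -
  assume eq: "unary_label i = unary_label j"
  have P: "Pos R ts \<in> tp i 0 \<longleftrightarrow> R \<in> L \<and> Pos R ts \<in> unary_label i" for R ts i
    unfolding unary_label_def qftp_def by (auto simp: Pos_tp)
  have N: "Neg R ts \<in> tp i 0 \<longleftrightarrow> R \<in> L \<and> Neg R ts \<in> unary_label i" for R ts i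
    unfolding unary_label_def qftp_def by (auto simp: Neg_tp)
  show ?thesis
  proof (rule set_eqI)
    fix \<phi> show "\<phi> \<in> tp i 0 \<longleftrightarrow> \<phi> \<in> tp j 0" using P N eq by (cases \<phi>) auto
  qed
qed

text \<open>The type decides the relations with symbols in \<open>L\<close>; the remaining symbols
  are unary and are decided by the label. Together with ultrahomogeneity this makes vertices of
  equal type and label conjugate over finite parameter sets.\<close>

lemma same_type_embedding:
  assumes tp: "qftp ar L K i B = qftp ar L K j B" and lab: "unary_label i = unary_label j"
    and notin: "i \<notin> B" "j \<notin> B"
  shows "embedding (id(i := j)) (restr_struct K (insert i B)) K"
  unfolding embedding_def
proof (intro conjI allI impI)
  show "inj_on (id(i := j)) (univ (restr_struct K (insert i B)))"
    using notin unfolding restr_struct_def by (auto simp: inj_on_def)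
  show "id(i := j) ` univ (restr_struct K (insert i B)) \<subseteq> univ K"
    using univ_K by simp
  fix R xs assume "set xs \<subseteq> univ (restr_struct K (insert i B))"
  then have xs: "set xs \<subseteq> insert i B" unfolding restr_struct_def by simp
  show "xs \<in> interp (restr_struct K (insert i B)) R \<longleftrightarrow> map (id(i := j)) xs \<in> interp K R"
  proof (cases "length xs = ar R")
    case len: True
    \<comment> \<open>Replacing \<open>i\<close> by the variable turns the tuple into terms over
      \<open>B\<close>, whose values at \<open>i\<close> and at \<open>j\<close> are the tuple and
      its image.\<close>
    define zs where "zs = map (\<lambda>v. if v = i then X else V v) xs"
    have zs: "map (tm_val i) zs = xs" "map (tm_val j) zs = map (id(i := j)) xs" "length zs = ar R"
      "set zs \<subseteq> insert X (V ` B)"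
      using xs len by (auto simp: zs_def comp_def intro!: map_idI)
    have "xs \<in> interp K R \<longleftrightarrow> map (id(i := j)) xs \<in> interp K R"
    proof (cases "R \<in> L")
      case True
      have "Pos R zs \<in> qftp ar L K i B \<longleftrightarrow> xs \<in> interp K R"
        "Pos R zs \<in> qftp ar L K j B \<longleftrightarrow> map (id(i := j)) xs \<in> interp K R"
        unfolding qftp_def using zs True by auto
      then show ?thesis using tp by simp
    next
      case False
      then have "ar R = 1" using L_non_unary by blast
      then obtain x where x: "xs = [x]" using len by (metis One_nat_def length_0_conv length_Suc_conv)
      have "Pos R [X] \<in> unary_label k \<longleftrightarrow> [k] \<in> interp K R" for k
        unfolding unary_label_def qftp_def using \<open>ar R = 1\<close> by auto
      then show ?thesis using lab x by auto
    qed
    then show ?thesis unfolding restr_struct_def using xs by simp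
  next
    case False
    then have "xs \<notin> interp K R" "map (id(i := j)) xs \<notin> interp K R"
      using interp_length by (metis length_map)+
    then show ?thesis unfolding restr_struct_def by simp
  qed
qed

end

section \<open>Perfect diagonal subtrees\<close>

lemma enumerate_card:
  fixes S :: "nat set"
  assumes "infinite S" "i \<in> S" shows "enumerate S (card (S \<inter> {..<i})) = i"
proof -
  obtain n where n: "enumerate S n = i" using enumerate_Ex[OF assms] by blast
  have "S \<inter> {..<i} = enumerate S ` {..<n}"
  proof (intro equalityI subsetI)
    fix j assume "j \<in> S \<inter> {..<i}"
    then obtain m where m: "enumerate S m = j" "j < i" using enumerate_Ex[OF assms(1), of j] by auto
    then have "m < n" using n enumerate_mono_iff[OF assms(1), of m n] by simp
    then show "j \<in> enumerate S ` {..<n}" using m by blast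
  next
    fix j assume "j \<in> enumerate S ` {..<n}"
    then show "j \<in> S \<inter> {..<i}"
      using n enumerate_in_set[OF assms(1)] enumerate_mono[OF _ assms(1)] by auto
  qed
  moreover have "inj_on (enumerate S) {..<n}"
    using strict_mono_enumerate[OF assms(1)] strict_mono_imp_inj_on inj_on_subset by blast
  ultimately have "card (S \<inter> {..<i}) = n" by (simp add: card_image)
  then show ?thesis using n by simp
qed

locale perfect_subtree = limit_coding_tree ar K L ord
  for ar :: "'r::finite \<Rightarrow> nat" and K :: "(nat, 'r) rstruct" and L :: "'r set" and ord :: "'r lit rel" +
  fixes T :: "'r lit set set"
  assumes subtree_T: "subtree T"
    and diagonal_T: "diagonal T"
    and perfect_T: "perfect T"
    and infinite_NA: "infinite (NA T)"
begin

lemma T_tree: "t \<in> T \<Longrightarrow> t \<in> tree"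
  using subtree_T unfolding subtree_def by blast

lemma meet_closed_T: "meet_closed T"
  using subtree_T unfolding subtree_def by blast

lemma hatI: "t \<in> T \<Longrightarrow> 0 < n \<Longrightarrow> n \<le> len t \<Longrightarrow> restr t n \<in> hat T"
  unfolding hat_def by blast

lemma hat_tree: "v \<in> hat T \<Longrightarrow> v \<in> tree"
  unfolding hat_def using restr_in_tree(1) T_tree by blast

lemma succs_tree: "v \<in> succs T t \<Longrightarrow> v \<in> tree"
  unfolding succs_def using hat_tree by blast

lemma restr_succs:
  assumes "d \<in> T" "v \<in> T" "d \<subset> v" shows "restr v (Suc (len d)) \<in> succs T d"
proof -
  have l: "len d < len v" using node_psubset_len T_tree assms by blast
  have t: "restr v (Suc (len d)) \<in> tree" "len (restr v (Suc (len d))) = Suc (len d)"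
    "restr v (Suc (len d)) \<subseteq> v"
    using restr_in_tree[OF T_tree[OF assms(2)], of "Suc (len d)"] l by auto
  have "d \<subseteq> restr v (Suc (len d))"
    by (rule chain_comparable[of _ _ v]) (use t T_tree assms in auto)
  moreover have "d \<noteq> restr v (Suc (len d))" using t(2) by auto
  ultimately show ?thesis unfolding succs_def using hatI[OF assms(2), of "Suc (len d)"] t l by auto
qed

text \<open>Just above their meet the two nodes differ, and their restrictions there are two
  immediate successors of it.\<close>

lemma splitting_meet:
  assumes "s \<in> T" "t \<in> T" "\<not> comparable s t" "meet s t \<noteq> {}"
  shows "splitting T (meet s t)"
proof -
  obtain g where g: "meet s t = restr s g" "meet s t = restr t g" "g < len s" "g < len t"
    "len (meet s t) = g" "restr s (Suc g) \<noteq> restr t (Suc g)"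
    "\<forall>m. m \<le> len s \<longrightarrow> m \<le> len t \<longrightarrow> (restr s m = restr t m \<longleftrightarrow> m \<le> g)"
    using incomparable_meetE[OF T_tree[OF assms(1)] T_tree[OF assms(2)] assms(3)] .
  have m: "meet s t \<in> T" using meet_closed_T assms unfolding meet_closed_def by blast
  have g0: "0 < g" using tree_len_pos[OF T_tree[OF m]] g by simp
  have sub: "meet s t \<subseteq> s" "meet s t \<subseteq> t"
    using restr_in_tree(3)[OF T_tree[OF assms(1)] g0] restr_in_tree(3)[OF T_tree[OF assms(2)] g0] g by auto
  have "meet s t \<noteq> s" "meet s t \<noteq> t" using g(3,4,5) by auto
  then have "restr s (Suc g) \<in> succs T (meet s t)" "restr t (Suc g) \<in> succs T (meet s t)"
    using restr_succs[OF m assms(1)] restr_succs[OF m assms(2)] sub g(5) by auto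
  then show ?thesis unfolding splitting_def using m g(6) by blast
qed

text \<open>Immediate successors are only known to lie in \<open>hat T\<close>, so nodes of
  \<open>T\<close> above two different ones are taken.\<close>

lemma splittingE:
  assumes "splitting T r"
  obtains s t where "s \<in> T" "t \<in> T" "\<not> comparable s t" "meet s t = r"
proof -
  obtain v w where vw: "r \<in> T" "v \<in> succs T r" "w \<in> succs T r" "v \<noteq> w"
    using assms unfolding splitting_def by blast
  obtain s n where s: "s \<in> T" "v = restr s n" "0 < n" "n \<le> len s"
    using vw(2) unfolding succs_def hat_def by auto
  obtain t m where t: "t \<in> T" "w = restr t m" "0 < m" "m \<le> len t"
    using vw(3) unfolding succs_def hat_def by auto
  have l: "len v = Suc (len r)" "len w = Suc (len r)" "r \<subseteq> v" "r \<subseteq> w"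
    using vw unfolding succs_def by auto
  have nm: "n = Suc (len r)" "m = Suc (len r)"
    using restr_in_tree(2)[OF T_tree[OF s(1)] s(3,4)] restr_in_tree(2)[OF T_tree[OF t(1)] t(3,4)] l s t
    by auto
  have tr: "s \<in> tree" "t \<in> tree" "r \<in> tree" using T_tree s t vw by auto
  have inc: "\<not> comparable s t"
    by (rule differing_incomparable[of _ _ n]) (use tr s t nm vw in auto)
  have rs: "r \<subseteq> s" "r \<subseteq> t" 
    using restr_in_tree(3)[OF tr(1) s(3,4)] restr_in_tree(3)[OF tr(2) t(3,4)] l s t by auto
  obtain g where g: "meet s t = restr s g" "meet s t = restr t g" "g < len s" "g < len t"
    "len (meet s t) = g" "restr s (Suc g) \<noteq> restr t (Suc g)"
    "\<forall>m. m \<le> len s \<longrightarrow> m \<le> len t \<longrightarrow> (restr s m = restr t m \<longleftrightarrow> m \<le> g)"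
    using incomparable_meetE[OF tr(1,2) inc] .
  have "len r \<le> g" "\<not> Suc (len r) \<le> g"
    using g(7)[rule_format, of "len r"] g(7)[rule_format, of "Suc (len r)"] s t nm vw(4) node_subset_iff[of r s] node_subset_iff[of r t] tr rs
    by auto
  then have "g = len r" by simp
  then have "meet s t = r" using g(1) node_subset_iff[of r s] tr rs by simp
  then show thesis using that s t inc by blast
qed

lemma splitting_T: "splitting T r \<Longrightarrow> r \<in> T"
  unfolding splitting_def by blast

lemma subtree_level:
  assumes "t \<in> T" "0 < l" "l \<le> len t"
    "(\<exists>i\<in>NA T. l = len (cn i)) \<or> (\<exists>s\<in>T. \<exists>v\<in>T. \<not> comparable s v \<and> l = len (meet s v))"
  shows "restr t l \<in> T"
proof -
  have "\<forall>t\<in>T. \<forall>l. 0 < l \<and> l \<le> len t \<and> ((\<exists>i\<in>NA T. l = len (cn i)) \<or>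
      (\<exists>s\<in>T. \<exists>u\<in>T. \<not> comparable s u \<and> l = len (meet s u))) \<longrightarrow> restr t l \<in> T"
    using subtree_T unfolding subtree_def by (elim conjE)
  from spec[OF bspec[OF this assms(1)], of l] show ?thesis
    by (rule mp) (intro conjI assms(2-4))
qed

text \<open>Splitting nodes are meets of incomparable nodes, and a subtree is closed under
  restriction to the lengths of such meets.\<close>

lemma splitting_level:
  assumes "splitting T r" "t \<in> T" "len r \<le> len t" shows "restr t (len r) \<in> T"
proof -
  obtain s v where "s \<in> T" "v \<in> T" "\<not> comparable s v" "meet s v = r" using splittingE[OF assms(1)] .
  moreover have "0 < len r" using tree_len_pos T_tree splitting_T[OF assms(1)] by blast
  ultimately show ?thesis using subtree_level[OF assms(2) _ assms(3)] by metis
qed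

lemma coding_level: "i \<in> NA T \<Longrightarrow> t \<in> T \<Longrightarrow> len (cn i) \<le> len t \<Longrightarrow> restr t (len (cn i)) \<in> T"
  using subtree_level[of t "len (cn i)"] by auto

lemma splitting_unique: "splitting T r \<Longrightarrow> splitting T s \<Longrightarrow> len r = len s \<Longrightarrow> r = s"
  using diagonal_T unfolding diagonal_def by blast

lemma splitting_not_coding: "splitting T r \<Longrightarrow> i \<in> NA T \<Longrightarrow> len r \<noteq> len (cn i)"
  using diagonal_T unfolding diagonal_def by blast

lemma splitting_card: "splitting T r \<Longrightarrow> card (succs T r) = 2"
  using diagonal_T unfolding diagonal_def by blast

lemma perfectD:
  assumes "t \<in> T"
  shows "\<exists>v\<in>T. t \<subset> v" "\<exists>v\<in>T. \<exists>w\<in>T. t \<subseteq> v \<and> t \<subseteq> w \<and> \<not> comparable v w"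
  using bspec[OF perfect_T[unfolded perfect_def] assms] by (rule conjunct1, rule conjunct2)

lemma unbounded: "t \<in> T \<Longrightarrow> \<exists>v\<in>T. t \<subseteq> v \<and> n \<le> len v"
proof (induction n)
  case (Suc n)
  then obtain v where v: "v \<in> T" "t \<subseteq> v" "n \<le> len v" by blast
  then obtain w where w: "w \<in> T" "v \<subset> w" using perfectD(1)[OF v(1)] by blast
  then have "len v < len w" using node_psubset_len T_tree v by blast
  then show ?case using v w by (intro bexI[of _ w]) auto
qed auto

lemma split_above: assumes "t \<in> T" shows "\<exists>r. splitting T r \<and> t \<subseteq> r \<and> n \<le> len r"
proof -
  obtain v where v: "v \<in> T" "t \<subseteq> v" "n \<le> len v" using unbounded[OF assms] by blast
  obtain s w where sw: "s \<in> T" "w \<in> T" "v \<subseteq> s" "v \<subseteq> w" "\<not> comparable s w"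
    using perfectD(2)[OF v(1)] by blast
  have m: "len v \<le> len (meet s w)" "v \<subseteq> meet s w" "meet s w \<in> tree"
    using meet_ge[of v s w] T_tree v sw by auto
  then show ?thesis using splitting_meet[OF sw(1,2,5)] tree_nonempty v by (intro exI[of _ "meet s w"]) auto
qed

lemma NA_nonempty: "\<exists>t. t \<in> T"
  using infinite_imp_nonempty[OF infinite_NA] unfolding NA_def by blast

text \<open>Perfectness provides splitting nodes beyond any length, and diagonality allows only one
  of each length, so a shortest one is unique.\<close>

lemma next_split:
  obtains r where "splitting T r" "n < len r" "\<And>s. splitting T s \<Longrightarrow> n < len s \<Longrightarrow> s = r \<or> len r < len s"
proof -
  let ?P = "\<lambda>l. n < l \<and> (\<exists>r. splitting T r \<and> len r = l)"
  obtain t where "t \<in> T" using NA_nonempty by blast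
  then obtain r where "splitting T r" "Suc n \<le> len r" using split_above[of t "Suc n"] by blast
  then have "\<exists>l. ?P l" by (intro exI[of _ "len r"]) auto
  moreover define m where "m = (LEAST l. ?P l)"
  ultimately have "?P m" using LeastI_ex[of ?P] by simp
  then obtain r where r: "splitting T r" "n < len r" "len r = m" by blast
  have "s = r \<or> len r < len s" if "splitting T s" "n < len s" for s
  proof -
    have "len r \<le> len s" using Least_le[of ?P "len s"] that r m_def by auto
    then show ?thesis using splitting_unique[OF that(1) r(1)] by linarith
  qed
  then show thesis using that r by blast
qed

lemma first_splits:
  obtains d0 u1 u2 where "splitting T d0" "splitting T u1" "splitting T u2" "len d0 < len u1" "len u1 < len u2"
    "\<forall>r. splitting T r \<longrightarrow> r = d0 \<or> r = u1 \<or> r = u2 \<or> len u2 < len r"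
proof -
  obtain d0 where d0: "splitting T d0" "0 < len d0" "\<And>s. splitting T s \<Longrightarrow> 0 < len s \<Longrightarrow> s = d0 \<or> len d0 < len s"
    using next_split[of 0] by blast
  obtain u1 where u1: "splitting T u1" "len d0 < len u1"
    "\<And>s. splitting T s \<Longrightarrow> len d0 < len s \<Longrightarrow> s = u1 \<or> len u1 < len s"
    using next_split[of "len d0"] by blast
  obtain u2 where u2: "splitting T u2" "len u1 < len u2"
    "\<And>s. splitting T s \<Longrightarrow> len u1 < len s \<Longrightarrow> s = u2 \<or> len u2 < len s"
    using next_split[of "len u1"] by blast
  have "r = d0 \<or> r = u1 \<or> r = u2 \<or> len u2 < len r" if "splitting T r" for r
    using d0(3)[OF that] u1(3)[OF that] u2(3)[OF that] tree_len_pos[OF T_tree[OF splitting_T[OF that]]] by blast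
  then show thesis using that d0 u1 u2 by blast
qed

lemma index_map_self:
  "infinite (NA S) \<Longrightarrow> i \<in> NA S \<Longrightarrow> index_map m S m S i = i"
  unfolding index_map_def idx_def using enumerate_card by auto

lemma pass_sim_refl:
  assumes "infinite (NA S)" "m \<in> NA S" shows "pass_sim s m S s m S"
  unfolding pass_sim_def
proof (intro conjI allI impI, simp)
  fix R zs assume zs: "length zs = ar R \<and> X \<in> set zs \<and> set zs \<subseteq> insert X (V ` (NA S \<inter> {..<m} \<union> {m}))"
  have "tm_map (index_map m S m S) z = z" if "z \<in> set zs" for z
  proof (cases z)
    case (V i)
    then have "i \<in> NA S" using that zs assms(2) by auto
    then show ?thesis using V index_map_self[OF assms(1)] by simp
  qed simp
  then have "map (tm_map (index_map m S m S)) zs = zs" by (simp add: map_idI)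
  then show "Pos R zs \<in> pass s m S \<longleftrightarrow> Pos R (map (tm_map (index_map m S m S)) zs) \<in> pass s m S" by simp
qed

lemma similarity_refl:
  assumes "meet_closed S" "NA S = {} \<or> infinite (NA S)" shows "similarity_map id S S"
  unfolding similarity_map_def
  using assms pass_sim_refl enumerate_in_set[of "NA S"] by (auto simp: has_cn_def idx_def)

lemma T_similar: "T \<in> similar_subtrees T"
  unfolding similar_subtrees_def similar_def
  using subtree_T similarity_refl[OF meet_closed_T] infinite_NA by auto

text \<open>Both alternatives are brought into one form. Under the first one a constant function
  serves as \<open>\<psi>\<close>, and perfectness supplies splitting nodes above any node.\<close>

lemma uniform_extension_property:
  assumes "extension_property_for T"
  obtains \<psi> :: "'r lit set \<Rightarrow> nat" where
    "\<And>A k u f B s s0. ep_situation T A k u f B s \<Longrightarrow>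
        (\<And>t. t \<in> rk k A \<Longrightarrow> splitting T t \<Longrightarrow> splitting T (f t) \<and> \<psi> t = \<psi> (f t)) \<Longrightarrow> s0 \<in> T \<Longrightarrow> s \<subseteq> s0 \<Longrightarrow>
        \<exists>s'. splitting T s' \<and> s0 \<subseteq> s' \<and> \<psi> s' = \<psi> u"
    "\<And>A k u f B s s'. ep_situation T A k u f B s \<Longrightarrow>
        (\<And>t. t \<in> rk k A \<Longrightarrow> splitting T t \<Longrightarrow> splitting T (f t) \<and> \<psi> t = \<psi> (f t)) \<Longrightarrow> splitting T s' \<Longrightarrow>
        s \<subseteq> s' \<Longrightarrow> \<psi> s' = \<psi> u \<Longrightarrow> ep_extends T A k u f s'"
proof -
  from assms consider "EP1 T" | \<psi> where "EP2a T \<psi>"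
    unfolding extension_property_for_def by blast
  then show thesis
  proof cases
    case 1
    show thesis
    proof (rule that[of "\<lambda>_. 0"])
      fix A k u f B s s' assume "ep_situation T A k u f B s" "splitting T s'" "s \<subseteq> s'"
      then show "ep_extends T A k u f s'" using 1 T_similar unfolding EP1_def by blast
    next
      fix s0 assume "s0 \<in> T"
      then show "\<exists>s'. splitting T s' \<and> s0 \<subseteq> s' \<and> (0::nat) = 0" using split_above by blast
    qed
  next
    case 2
    show thesis
    proof (rule that[of \<psi>])
      fix A k u f B s s0
      assume "ep_situation T A k u f B s"
        "\<And>t. t \<in> rk k A \<Longrightarrow> splitting T t \<Longrightarrow> splitting T (f t) \<and> \<psi> t = \<psi> (f t)" "s0 \<in> T" "s \<subseteq> s0"
      then show "\<exists>s'. splitting T s' \<and> s0 \<subseteq> s' \<and> \<psi> s' = \<psi> u"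
        using 2 T_similar unfolding EP2a_def by metis
    next
      fix A k u f B s s'
      assume "ep_situation T A k u f B s"
        "\<And>t. t \<in> rk k A \<Longrightarrow> splitting T t \<Longrightarrow> splitting T (f t) \<and> \<psi> t = \<psi> (f t)" "splitting T s'" "s \<subseteq> s'" "\<psi> s' = \<psi> u"
      then show "ep_extends T A k u f s'"
        using 2 T_similar unfolding EP2a_def by metis
    qed
  qed
qed

end

section \<open>The lexicographic order and similarity maps\<close>

lemma linear_order_finite_least:
  assumes "linear_order r" "finite D" "D \<noteq> {}"
  shows "\<exists>\<phi>\<in>D. \<forall>\<psi>\<in>D. (\<phi>, \<psi>) \<in> r"
proof -
  have "refl r" "total r"
    using assms(1) unfolding linear_order_on_def partial_order_on_def preorder_on_def by auto
  then have tot: "(x, y) \<in> r \<or> (y, x) \<in> r" for x y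
    by (cases "x = y") (auto dest: reflD simp: total_on_def)
  have tr: "trans r" using assms(1) unfolding linear_order_on_def partial_order_on_def preorder_on_def by blast
  show ?thesis using assms(2,3)
  proof (induction D rule: finite_ne_induct)
    case (singleton x)
    then show ?case using tot by blast
  next
    case (insert x F)
    then obtain m where m: "m \<in> F" "\<forall>\<psi>\<in>F. (m, \<psi>) \<in> r" by blast
    show ?case
    proof (cases "(x, m) \<in> r")
      case True
      then have "\<forall>\<psi>\<in>insert x F. (x, \<psi>) \<in> r" using m tot tr by (blast dest: transD)
      then show ?thesis by blast
    next
      case False
      then show ?thesis using m tot by blast
    qed
  qed
qed

context limit_coding_tree
begin

lemma meet_commute: assumes "s \<in> tree" "t \<in> tree" shows "meet s t = meet t s"
proof -
  obtain g where g: "meet s t = restr s g" "meet s t = restr t g" "g \<le> len s" "g \<le> len t"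
    "len (meet s t) = g"
    "\<forall>m. m \<le> len s \<longrightarrow> m \<le> len t \<longrightarrow> (restr s m = restr t m \<longleftrightarrow> m \<le> g)"
    using meetE[OF assms] .
  obtain h where h: "meet t s = restr t h" "meet t s = restr s h" "h \<le> len t" "h \<le> len s"
    "len (meet t s) = h"
    "\<forall>m. m \<le> len t \<longrightarrow> m \<le> len s \<longrightarrow> (restr t m = restr s m \<longleftrightarrow> m \<le> h)"
    using meetE[OF assms(2,1)] .
  have rg: "restr s g = restr t g" using g(1,2) by simp
  have rh: "restr s h = restr t h" using h(1,2) by simp
  have "h \<le> g" using g(6)[rule_format, of h] h(3,4) rh by simp
  moreover have "g \<le> h" using h(6)[rule_format, of g] g(3,4) rg by simp
  ultimately have "g = h" by simp
  then show ?thesis using g(1) h(2) by simp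
qed

lemma prec_comparable: "comparable s t \<Longrightarrow> prec s t \<longleftrightarrow> s \<subset> t"
  unfolding prec_def by blast

lemma prec_irrefl: "\<not> prec s s"
  using prec_comparable[of s s] unfolding comparable_def by blast

lemma finite_node: "t \<in> tree \<Longrightarrow> finite t"
proof -
  assume "t \<in> tree"
  then obtain i n where t: "t = tp i n" by (auto simp: tree_iff)
  let ?ls = "\<lambda>R. {ts. set ts \<subseteq> insert X (V ` {..<n}) \<and> length ts = ar R}"
  have "finite (?ls R)" for R by (rule finite_lists_length_eq) simp
  then have "finite ((\<Union>R\<in>UNIV. Pos R ` ?ls R) \<union> (\<Union>R\<in>UNIV. Neg R ` ?ls R))" by simp
  moreover have "\<phi> \<in> (\<Union>R\<in>UNIV. Pos R ` ?ls R) \<union> (\<Union>R\<in>UNIV. Neg R ` ?ls R)" if \<phi>: "\<phi> \<in> t" for \<phi>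
  proof (cases \<phi>)
    case (Pos R ts)
    then have "ts \<in> ?ls R" using \<phi> t by (auto simp: Pos_tp)
    then show ?thesis using Pos by blast
  next
    case (Neg R ts)
    then have "ts \<in> ?ls R" using \<phi> t by (auto simp: Neg_tp)
    then show ?thesis using Neg by blast
  qed
  ultimately show ?thesis by (meson finite_subset subsetI)
qed

text \<open>At the length just above the meet, the least formula of the finite symmetric difference
  belongs to exactly one of the two nodes.\<close>

lemma prec_total:
  assumes "s \<in> tree" "t \<in> tree" "\<not> comparable s t"
  shows "prec s t \<longleftrightarrow> \<not> prec t s"
proof -
  obtain g where g: "meet s t = restr s g" "meet s t = restr t g" "g < len s" "g < len t"
    "len (meet s t) = g" "restr s (Suc g) \<noteq> restr t (Suc g)"
    "\<forall>m. m \<le> len s \<longrightarrow> m \<le> len t \<longrightarrow> (restr s m = restr t m \<longleftrightarrow> m \<le> g)"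
    using incomparable_meetE[OF assms] .
  let ?s = "restr s (Suc g)" and ?t = "restr t (Suc g)"
  have lin: "linear_order ord" using order unfolding formula_order_def by blast
  have anti: "(x, y) \<in> ord \<Longrightarrow> (y, x) \<in> ord \<Longrightarrow> x = y" for x y
    using lin unfolding linear_order_on_def partial_order_on_def antisym_def by blast
  have p: "prec s t \<longleftrightarrow> lex_less ?s ?t" "prec t s \<longleftrightarrow> lex_less ?t ?s"
    using assms(3) g(5) comparable_sym[of s t] meet_commute[OF assms(1,2)]
    unfolding prec_def by (auto simp: comparable_def)
  let ?D = "(?s - ?t) \<union> (?t - ?s)"
  have "finite ?s" "finite ?t"
    using finite_node restr_in_tree(1) assms(1,2) g(3,4) by (meson Suc_leI zero_less_Suc)+
  then have "finite ?D" "?D \<noteq> {}" using g(6) by auto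
  then obtain \<phi> where \<phi>: "\<phi> \<in> ?D" "\<forall>\<psi>\<in>?D. (\<phi>, \<psi>) \<in> ord"
    using linear_order_finite_least[OF lin] by blast
  have "lex_less ?s ?t \<or> lex_less ?t ?s" using \<phi> unfolding lex_less_def by blast
  moreover have "\<not> (lex_less ?s ?t \<and> lex_less ?t ?s)"
  proof
    assume a: "lex_less ?s ?t \<and> lex_less ?t ?s"
    obtain x where x: "x \<in> ?s - ?t" "\<forall>\<psi>\<in>?D. (x, \<psi>) \<in> ord" using a unfolding lex_less_def by blast
    obtain y where y: "y \<in> ?t - ?s" "\<forall>\<psi>\<in>(?t - ?s) \<union> (?s - ?t). (y, \<psi>) \<in> ord"
      using a unfolding lex_less_def by blast
    have "x = y" by (rule anti) (use x y in blast)+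
    then show False using x y by blast
  qed
  ultimately show ?thesis using p by blast
qed

section \<open>Embeddings induced by similarity maps\<close>

text \<open>When \<open>x\<close> and \<open>y\<close> are the two largest entries of a tuple,
  replacing \<open>x\<close> by the variable leaves \<open>y\<close> as the last parameter. The
  relation on the tuple is thus recorded in the passing type of the coding node of \<open>x\<close>
  at that of \<open>y\<close>.\<close>

lemma pass_iff:
  assumes "R \<in> L" "length xs = ar R" "y \<in> set xs" "y < x"
    and "\<And>v. v \<in> set xs \<Longrightarrow> v = x \<or> v = y \<or> (v \<in> NA S \<and> v < y)"
  shows "Pos R (map (\<lambda>v. if v = x then X else V v) xs) \<in> pass (cn x) y S \<longleftrightarrow> xs \<in> interp K R"
proof -
  let ?zs = "map (\<lambda>v. if v = x then X else V v) xs"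
  have val: "map (tm_val x) ?zs = xs" by (auto intro!: map_idI)
  have par: "params (Pos R ?zs) = set xs - {x}" by auto
  have sub: "set xs - {x} \<subseteq> (NA S \<inter> {..<y}) \<union> {y}" using assms(5) by auto
  have "set ?zs \<subseteq> insert X (V ` {..<x})"
  proof
    fix z assume "z \<in> set ?zs"
    then obtain v where v: "v \<in> set xs" "z = (if v = x then X else V v)" by auto
    then show "z \<in> insert X (V ` {..<x})" using assms(4) assms(5)[of v] by auto
  qed
  then have "Pos R ?zs \<in> cn x \<longleftrightarrow> xs \<in> interp K R"
    unfolding cn_def Pos_tp using assms(1,2) val by simp
  \<comment> \<open>The entry at length \<open>Suc y\<close> consists of the formulas with
    parameters below \<open>Suc y\<close> among which \<open>y\<close> occurs; this and the next
    fact check both conditions.\<close>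
  moreover have "params (Pos R ?zs) \<subseteq> {..<Suc y}" unfolding par using sub by auto
  moreover have "y \<in> params (Pos R ?zs)" unfolding par using assms(3,4) by simp
  moreover have "params (Pos R ?zs) \<subseteq> (NA S \<inter> {..<y}) \<union> {y}" unfolding par using sub .
  ultimately show ?thesis unfolding pass_def entry_def type_restr_def len_cn
    by (simp del: params.simps set_map)
qed

lemma similarity_mapD:
  assumes "similarity_map f S T"
  shows "s \<in> S \<Longrightarrow> t \<in> S \<Longrightarrow> len s < len t \<longleftrightarrow> len (f s) < len (f t)"
    and "s \<in> S \<Longrightarrow> t \<in> S \<Longrightarrow> s \<subseteq> t \<longleftrightarrow> f s \<subseteq> f t"
    and "has_cn S n \<longleftrightarrow> has_cn T n"
    and "has_cn S n \<Longrightarrow> f (cn (idx S n)) = cn (idx T n)"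
    and "has_cn S n \<Longrightarrow> unary_label (idx S n) = unary_label (idx T n)"
    and "has_cn S n \<Longrightarrow> s \<in> S \<Longrightarrow> len (cn (idx S n)) < len s \<Longrightarrow>
      pass_sim s (idx S n) S (f s) (idx T n) T"
proof -
  note sm = assms[unfolded similarity_map_def, THEN conjunct2, THEN conjunct2, THEN conjunct2]
  note D = sm[THEN conjunct1, rule_format]
  show "s \<in> S \<Longrightarrow> t \<in> S \<Longrightarrow> len s < len t \<longleftrightarrow> len (f s) < len (f t)"
    by (rule D[THEN conjunct2, THEN conjunct2, THEN conjunct1])
  show "s \<in> S \<Longrightarrow> t \<in> S \<Longrightarrow> s \<subseteq> t \<longleftrightarrow> f s \<subseteq> f t"
    by (rule D[THEN conjunct2, THEN conjunct2, THEN conjunct2])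
  show "has_cn S n \<longleftrightarrow> has_cn T n"
    by (rule sm[THEN conjunct2, THEN conjunct1, THEN spec])
  note F = sm[THEN conjunct2, THEN conjunct2, THEN spec, THEN mp]
  show "has_cn S n \<Longrightarrow> f (cn (idx S n)) = cn (idx T n)" by (rule F[THEN conjunct1])
  show "has_cn S n \<Longrightarrow> unary_label (idx S n) = unary_label (idx T n)"
    by (rule F[THEN conjunct2, THEN conjunct1])
  show "has_cn S n \<Longrightarrow> s \<in> S \<Longrightarrow> len (cn (idx S n)) < len s \<Longrightarrow>
      pass_sim s (idx S n) S (f s) (idx T n) T"
    by (rule F[THEN conjunct2, THEN conjunct2, THEN bspec, THEN mp])
qed

text \<open>A similarity preserves the order of coding nodes, the labels and the passing types.
  Unary relations can be read off the labels and all others, by \<open>pass_iff\<close>, off the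
  passing types, so the induced map on the represented vertices is an embedding.\<close>

lemma similarity_embedding:
  assumes sim: "similarity_map h S D" and inf: "infinite (NA S)"
  shows "\<exists>\<eta>. embedding \<eta> (restr_struct K (NA S)) K \<and> (\<forall>x\<in>NA S. \<eta> x \<in> NA D \<and> h (cn x) = cn (\<eta> x))"
proof -
  define \<eta> where "\<eta> x = idx D (card (NA S \<inter> {..<x}))" for x
  note sm = similarity_mapD[OF sim]
  have hcS: "has_cn S n" for n unfolding has_cn_def using inf by simp
  have hcD: "has_cn D n" for n using sm(3) hcS by simp
  \<comment> \<open>Were \<open>NA D\<close> finite, its cardinality would be an index without a
    coding node.\<close>
  have infD: "infinite (NA D)"
    using hcD[of "card (NA D)"] unfolding has_cn_def by simp
  note cod = sm(4-6)[OF hcS]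
  have idxS: "idx S (card (NA S \<inter> {..<x})) = x" if "x \<in> NA S" for x
    unfolding idx_def using enumerate_card[OF inf that] .
  have \<eta>D: "\<eta> x \<in> NA D" for x unfolding \<eta>_def idx_def using enumerate_in_set[OF infD] .
  have h\<eta>: "h (cn x) = cn (\<eta> x)" if "x \<in> NA S" for x
    using cod(1)[of "card (NA S \<inter> {..<x})"] idxS[OF that] unfolding \<eta>_def by simp
  have lab: "unary_label x = unary_label (\<eta> x)" if "x \<in> NA S" for x
    using cod(2)[of "card (NA S \<inter> {..<x})"] idxS[OF that] unfolding \<eta>_def by simp
  have ps: "pass_sim s x S (h s) (\<eta> x) D" if "s \<in> S" "len (cn x) < len s" "x \<in> NA S" for s x
    using cod(3)[of s "card (NA S \<inter> {..<x})"] that idxS[OF that(3)] unfolding \<eta>_def by simp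
  have inS: "cn x \<in> S" if "x \<in> NA S" for x using that unfolding NA_def by simp
  have mono: "\<eta> x < \<eta> y" if "x \<in> NA S" "y \<in> NA S" "x < y" for x y
  proof -
    have "len (cn x) < len (cn y) \<longleftrightarrow> len (h (cn x)) < len (h (cn y))"
      using sm(1)[OF inS[OF that(1)] inS[OF that(2)]] .
    then show ?thesis using h\<eta> that by simp
  qed
  have inj: "\<eta> x = \<eta> y \<longleftrightarrow> x = y" if "x \<in> NA S" "y \<in> NA S" for x y
    using mono[OF that] mono[OF that(2,1)] by (metis less_irrefl linorder_neqE_nat)
  have "embedding \<eta> (restr_struct K (NA S)) K"
    unfolding embedding_def
  proof (intro conjI allI impI)
    show "inj_on \<eta> (univ (restr_struct K (NA S)))"
      unfolding restr_struct_def using inj by (auto simp: inj_on_def)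
    show "\<eta> ` univ (restr_struct K (NA S)) \<subseteq> univ K" using univ_K by simp
    fix R xs assume "set xs \<subseteq> univ (restr_struct K (NA S))"
    then have xs: "set xs \<subseteq> NA S" unfolding restr_struct_def by simp
    have "xs \<in> interp K R \<longleftrightarrow> map \<eta> xs \<in> interp K R"
    proof (cases "length xs = ar R \<and> distinct xs")
      case False
      have "inj_on \<eta> (set xs)" using inj xs by (auto simp: inj_on_def)
      then have "distinct (map \<eta> xs) \<longleftrightarrow> distinct xs" by (simp add: distinct_map)
      then show ?thesis using False interp_length distinct_K by (metis length_map)
    next
      case True
      show ?thesis
      proof (cases "ar R = 1")
        case ar1: True
        then obtain x where x: "xs = [x]" using True by (metis One_nat_def length_0_conv length_Suc_conv)
        have "Pos R [X] \<in> unary_label k \<longleftrightarrow> [k] \<in> interp K R" for k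
          unfolding unary_label_def qftp_def using ar1 by auto
        then show ?thesis using x lab[of x] xs by auto
      next
        case False
        then have RL: "R \<in> L" and ar2: "2 \<le> ar R"
          using L_non_unary ar_pos[of R] by auto
        \<comment> \<open>The two largest entries of the tuple; both exist because the entries are
          distinct and there are at least two.\<close>
        define x where "x = Max (set xs)"
        define y where "y = Max (set xs - {x})"
        have c2: "card (set xs) \<ge> 2" using True ar2 distinct_card by metis
        have ne: "set xs \<noteq> {}" using c2 by auto
        have xin: "x \<in> set xs" unfolding x_def using ne by simp
        have "card (set xs - {x}) \<ge> 1" using c2 xin by simp
        then have ne': "set xs - {x} \<noteq> {}" by (metis card.empty not_one_le_zero)
        have yin: "y \<in> set xs - {x}" unfolding y_def using Max_in[of "set xs - {x}"] ne' by blast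
        have yx: "y < x" using yin Max_ge[of "set xs" y] unfolding x_def[symmetric] by auto
        have vy: "v = x \<or> v = y \<or> v < y" if "v \<in> set xs" for v
          using Max_ge[of "set xs - {x}" v] that unfolding y_def[symmetric] by auto
        have NS: "x \<in> NA S" "y \<in> NA S" using xin yin xs by auto
        let ?zs = "map (\<lambda>v. if v = x then X else V v) xs"
        let ?i = "index_map y S (\<eta> y) D"
        \<comment> \<open>\<open>index_map\<close> renames by rank among the coding nodes, as
          \<open>\<eta>\<close> does, so the literal of the tuple becomes that of the image
          tuple.\<close>
        have zs: "map (tm_map ?i) ?zs = map (\<lambda>v. if v = \<eta> x then X else V v) (map \<eta> xs)"
          using inj xs xin by (auto simp: index_map_def \<eta>_def)
        have 1: "Pos R ?zs \<in> pass (cn x) y S \<longleftrightarrow> xs \<in> interp K R"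
          by (rule pass_iff) (use RL True yin yx vy xs in auto)
        have 2: "Pos R (map (\<lambda>v. if v = \<eta> x then X else V v) (map \<eta> xs)) \<in> pass (cn (\<eta> x)) (\<eta> y) D
          \<longleftrightarrow> map \<eta> xs \<in> interp K R"
        proof (rule pass_iff)
          fix w assume "w \<in> set (map \<eta> xs)"
          then obtain v where v: "v \<in> set xs" "w = \<eta> v" by auto
          then show "w = \<eta> x \<or> w = \<eta> y \<or> (w \<in> NA D \<and> w < \<eta> y)"
            using vy[OF v(1)] mono[of v y] \<eta>D NS xs by auto
        qed (use RL True yin mono[OF NS(2,1) yx] in auto)
        have p: "pass_sim (cn x) y S (h (cn x)) (\<eta> y) D"
          by (rule ps) (use NS inS yx in auto)
        have sub: "z \<in> insert X (V ` ((NA S \<inter> {..<y}) \<union> {y}))" if z: "z \<in> set ?zs" for z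
        proof -
          obtain v where v: "v \<in> set xs" "z = (if v = x then X else V v)" using z by auto
          then show ?thesis using vy[OF v(1)] xs by auto
        qed
        have "X \<in> set ?zs" using xin by force
        moreover have "set ?zs \<subseteq> insert X (V ` ((NA S \<inter> {..<y}) \<union> {y}))" by (intro subsetI sub)
        moreover have "length ?zs = ar R" using True by simp
        ultimately have "length ?zs = ar R \<and> X \<in> set ?zs \<and>
            set ?zs \<subseteq> insert X (V ` ((NA S \<inter> {..<y}) \<union> {y}))"
          by (intro conjI)
        then have "Pos R ?zs \<in> pass (cn x) y S \<longleftrightarrow> Pos R (map (tm_map ?i) ?zs) \<in> pass (h (cn x)) (\<eta> y) D"
          using p unfolding pass_sim_def by blast
        then show ?thesis unfolding 1 zs h\<eta>[OF NS(1)] 2 .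
      qed
    qed
    then show "xs \<in> interp (restr_struct K (NA S)) R \<longleftrightarrow> map \<eta> xs \<in> interp K R"
      unfolding restr_struct_def using xs by simp
  qed
  then show ?thesis using \<eta>D h\<eta> by blast
qed

end

section \<open>Thinning out a perfect diagonal subtree\<close>

locale split_tree = perfect_subtree ar K L ord T
  for ar :: "'r::finite \<Rightarrow> nat" and K :: "(nat, 'r) rstruct" and L :: "'r set" and ord :: "'r lit rel"
    and T :: "'r lit set set" +
  fixes d0 u1 u2 :: "'r lit set"
  assumes split_d0: "splitting T d0" and split_u1: "splitting T u1" and split_u2: "splitting T u2"
    and len_01: "len d0 < len u1" and len_12: "len u1 < len u2"
    and first_three: "splitting T r \<Longrightarrow> r = d0 \<or> r = u1 \<or> r = u2 \<or> len u2 < len r"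
begin

text \<open>Coding levels are kept only beyond \<open>u2\<close>, so that the first three levels are
  splitting levels and contain no coding nodes. Only finitely many coding nodes are lost.\<close>

definition thin :: "'r lit set set" where
  "thin = {t \<in> T. (\<exists>r. splitting T r \<and> len t = len r) \<or>
     (\<exists>i\<in>NA T. len u2 < len (cn i) \<and> len t = len (cn i))}"

abbreviation "W0 \<equiv> {t \<in> T. len t = len d0}"
abbreviation "W1 \<equiv> {t \<in> T. len t = len u1}"
abbreviation "W2 \<equiv> {t \<in> T. len t = len u2}"

lemma thin_T: "t \<in> thin \<Longrightarrow> t \<in> T"
  unfolding thin_def by blast

lemma splitting_thin: "splitting T r \<Longrightarrow> t \<in> T \<Longrightarrow> len t = len r \<Longrightarrow> t \<in> thin"
  unfolding thin_def by blast

lemma thin_level: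
  assumes "t \<in> thin" "x \<in> T" "len t \<le> len x" shows "restr x (len t) \<in> thin" "len (restr x (len t)) = len t"
proof -
  have "0 < len t" using tree_len_pos T_tree thin_T assms by blast
  then show l: "len (restr x (len t)) = len t" using restr_in_tree(2) T_tree assms by blast
  from assms(1) consider r where "splitting T r" "len t = len r"
    | i where "i \<in> NA T" "len u2 < len (cn i)" "len t = len (cn i)"
    unfolding thin_def by blast
  then show "restr x (len t) \<in> thin"
  proof cases
    case 1
    then show ?thesis using splitting_level[OF 1(1) assms(2)] assms(3) l unfolding thin_def by auto
  next
    case 2
    then show ?thesis using coding_level[OF 2(1) assms(2)] assms(3) l unfolding thin_def by auto
  qed
qed

text \<open>A coding node cannot survive through a splitting level, since diagonality keeps the two
  kinds of lengths apart.\<close>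

lemma NA_thin: "NA thin = {i \<in> NA T. len u2 < len (cn i)}"
proof -
  have "cn i \<in> thin \<longleftrightarrow> cn i \<in> T \<and> len u2 < len (cn i)" for i
  proof
    assume a: "cn i \<in> thin"
    then have iT: "cn i \<in> T" by (rule thin_T)
    then have "i \<in> NA T" unfolding NA_def by simp
    then have "\<not> (splitting T r \<and> len (cn i) = len r)" for r using splitting_not_coding[of r i] by auto
    then show "cn i \<in> T \<and> len u2 < len (cn i)" using a iT unfolding thin_def by auto
  next
    assume "cn i \<in> T \<and> len u2 < len (cn i)"
    then show "cn i \<in> thin" unfolding thin_def NA_def by blast
  qed
  then show ?thesis unfolding NA_def by simp
qed

lemma infinite_NA_thin: "infinite (NA thin)" and finite_NA_diff: "finite (NA T - NA thin)"
proof -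
  have "NA T - NA thin \<subseteq> {..<len u2}" unfolding NA_thin by auto
  then show "finite (NA T - NA thin)" using finite_subset by blast
  then show "infinite (NA thin)" using infinite_NA by (metis Diff_infinite_finite finite_Diff2)
qed

lemma meet_cases:
  assumes "s \<in> T" "t \<in> T"
  shows "meet s t = {} \<or> meet s t = s \<or> meet s t = t \<or>
    (splitting T (meet s t) \<and> len (meet s t) < len s \<and> len (meet s t) < len t \<and> \<not> comparable s t)"
proof (cases "comparable s t")
  case True
  then show ?thesis unfolding comparable_def using meet_subset T_tree assms by metis
next
  case False
  obtain g where g: "meet s t = restr s g" "meet s t = restr t g" "g < len s" "g < len t"
    "len (meet s t) = g" "restr s (Suc g) \<noteq> restr t (Suc g)"
    "\<forall>m. m \<le> len s \<longrightarrow> m \<le> len t \<longrightarrow> (restr s m = restr t m \<longleftrightarrow> m \<le> g)"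
    using incomparable_meetE[OF T_tree[OF assms(1)] T_tree[OF assms(2)] False] .
  then show ?thesis using splitting_meet[OF assms False] False by auto
qed

lemma meet_closed_thin: "meet_closed thin"
  unfolding meet_closed_def
proof (intro ballI impI)
  fix s t assume st: "s \<in> thin" "t \<in> thin" and "meet s t \<noteq> {}"
  then have "meet s t = s \<or> meet s t = t \<or> splitting T (meet s t)"
    using meet_cases[of s t] thin_T by blast
  then show "meet s t \<in> thin" using st splitting_thin splitting_T by metis
qed

lemma subtree_thin: "subtree thin"
  unfolding subtree_def
proof (intro conjI ballI allI impI)
  show "thin \<subseteq> tree" using thin_T T_tree by blast
  show "meet_closed thin" by (rule meet_closed_thin)
  fix t l assume t: "t \<in> thin"
    and l: "0 < l \<and> l \<le> len t \<and> ((\<exists>i\<in>NA thin. l = len (cn i)) \<or>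
      (\<exists>s\<in>thin. \<exists>u\<in>thin. \<not> comparable s u \<and> l = len (meet s u)))"
  have "\<exists>v\<in>thin. l = len v"
  proof -
    from l consider i where "i \<in> NA thin" "l = len (cn i)"
      | s v where "s \<in> thin" "v \<in> thin" "l = len (meet s v)" by blast
    then show ?thesis
    proof cases
      case 1
      then show ?thesis unfolding NA_def by blast
    next
      case 2
      then have "meet s v \<noteq> {}" using l by auto
      then have "meet s v \<in> thin" using meet_closed_thin 2 unfolding meet_closed_def by blast
      then show ?thesis using 2 by blast
    qed
  qed
  then show "restr t l \<in> thin" using thin_level(1)[OF _ thin_T[OF t]] l by blast
qed

lemma meet_closure_thin: "meet_closure thin = thin"
proof -
  have "{} \<notin> thin" using thin_T T_tree tree_nonempty by blast
  moreover have "meet s t \<in> thin" if "s \<in> thin" "t \<in> thin" "meet s t \<noteq> {}" for s t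
    using meet_closed_thin that unfolding meet_closed_def by blast
  ultimately show ?thesis unfolding meet_closure_def by auto
qed

text \<open>\<open>thin\<close> is closed under restriction to all lengths occurring in it, so
  forming the induced tree adds nothing.\<close>

lemma induced_tree_thin: "induced_tree thin = thin"
proof -
  have "t = restr t (len t)" if "t \<in> thin" for t using restr_len thin_T T_tree that by metis
  then have "thin \<subseteq> induced_tree thin" unfolding induced_tree_def meet_closure_thin by blast
  moreover have "induced_tree thin \<subseteq> thin"
    unfolding induced_tree_def meet_closure_thin using thin_level(1) thin_T by blast
  ultimately show ?thesis by blast
qed

lemma thin_len: "t \<in> thin \<Longrightarrow> len t = len d0 \<or> len t = len u1 \<or> len t = len u2 \<or> len u2 < len t"
proof -
  assume "t \<in> thin"
  then consider r where "splitting T r" "len t = len r" | "len u2 < len t" unfolding thin_def by auto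
  then show ?thesis
  proof cases
    case 1
    then show ?thesis using first_three[OF 1(1)] by metis
  qed simp
qed

lemma levels_thin: "W0 \<subseteq> thin" "W1 \<subseteq> thin" "W2 \<subseteq> thin" "d0 \<in> W0" "u1 \<in> W1" "u2 \<in> W2"
  using splitting_thin splitting_T split_d0 split_u1 split_u2 by auto

text \<open>The lengths of \<open>d0\<close>, \<open>u1\<close> and \<open>u2\<close> are the three
  smallest in \<open>thin\<close>, and the level of a node is found by counting the lengths below
  its own.\<close>

lemma rk_thin: "rk 1 thin = W0" "rk 2 thin = W0 \<union> W1" "rk 3 thin = W0 \<union> W1 \<union> W2"
proof -
  let ?c = "\<lambda>t. card {l \<in> len ` thin. l < len t}"
  have rk: "rk k thin = {t \<in> thin. ?c t < k}" for k
    unfolding rk_def induced_tree_thin meet_closure_thin ..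
  have L: "l = len d0 \<or> l = len u1 \<or> l = len u2 \<or> len u2 < l" if "l \<in> len ` thin" for l
    using that thin_len by blast
  have mem: "len d0 \<in> len ` thin" "len u1 \<in> len ` thin" "len u2 \<in> len ` thin"
    using levels_thin by blast+
  have c0: "?c t = 0" if "len t = len d0" for t
  proof -
    have "{l \<in> len ` thin. l < len t} = {}" using L len_01 len_12 that by fastforce
    then show ?thesis by simp
  qed
  have c1: "?c t = 1" if "len t = len u1" for t
  proof -
    have "{l \<in> len ` thin. l < len t} = {len d0}" using L len_01 len_12 that mem by fastforce
    then show ?thesis by simp
  qed
  have c2: "?c t = 2" if "len t = len u2" for t
  proof -
    have "{l \<in> len ` thin. l < len t} = {len d0, len u1}" using L len_01 len_12 that mem by fastforce
    then show ?thesis using len_01 by simp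
  qed
  have c3: "3 \<le> ?c t" if "len u2 < len t" for t
  proof -
    have "finite {l \<in> len ` thin. l < len t}" by (rule finite_subset[of _ "{..<len t}"]) auto
    moreover have "{len d0, len u1, len u2} \<subseteq> {l \<in> len ` thin. l < len t}"
      using mem len_01 len_12 that by auto
    ultimately have "card {len d0, len u1, len u2} \<le> ?c t" by (rule card_mono)
    then show ?thesis using len_01 len_12 by simp
  qed
  define cc where "cc t = ?c t" for t
  have rk': "t \<in> rk k thin \<longleftrightarrow> t \<in> thin \<and> cc t < k" for t k unfolding rk cc_def by simp
  note cs = c0[folded cc_def] c1[folded cc_def] c2[folded cc_def] c3[folded cc_def]
  have lt: "t \<in> thin" if "t \<in> W0 \<union> W1 \<union> W2" for t
    using that levels_thin by blast
  have r1: "cc t < 1 \<longleftrightarrow> len t = len d0" and r2: "cc t < 2 \<longleftrightarrow> len t = len d0 \<or> len t = len u1"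
    and r3: "cc t < 3 \<longleftrightarrow> len t = len d0 \<or> len t = len u1 \<or> len t = len u2" if "t \<in> thin" for t
    using thin_len[OF that] cs(1)[of t] cs(2)[of t] cs(3)[of t] cs(4)[of t] by linarith+
  show "rk 1 thin = W0"
    using rk'[of _ 1] r1 lt thin_T by blast
  show "rk 2 thin = W0 \<union> W1"
    using rk'[of _ 2] r2 lt thin_T by blast
  show "rk 3 thin = W0 \<union> W1 \<union> W2"
    using rk'[of _ 3] r3 lt thin_T by blast
qed

lemma finite_T_level: "finite {t \<in> T. len t = n}"
  by (rule finite_subset[OF _ finite_level[of n]]) (use T_tree in auto)

lemma no_coding_at_split: "splitting T r \<Longrightarrow> i \<in> NA {t \<in> T. len t = len r} \<Longrightarrow> False"
  using splitting_not_coding[of r i] unfolding NA_def by auto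

section \<open>Moving the level of the second splitting node\<close>

text \<open>A nonempty meet of incomparable nodes splits, and \<open>d0\<close> is the only
  splitting node shorter than \<open>u1\<close>.\<close>

lemma meet_below_u1:
  assumes "s \<in> W0 \<union> W1" "t \<in> W0 \<union> W1" "\<not> comparable s t"
  shows "meet s t = {} \<or> (meet s t = d0 \<and> len d0 < len s \<and> len d0 < len t)"
proof -
  have T: "s \<in> T" "t \<in> T" using assms by auto
  have sub: "\<not> s \<subseteq> t" "\<not> t \<subseteq> s" using assms(3) unfolding comparable_def by auto
  show ?thesis
  proof (cases "meet s t = {}")
    case False
    obtain g where g: "meet s t = restr s g" "meet s t = restr t g" "g < len s" "g < len t"
      "len (meet s t) = g" "restr s (Suc g) \<noteq> restr t (Suc g)"
      "\<forall>m. m \<le> len s \<longrightarrow> m \<le> len t \<longrightarrow> (restr s m = restr t m \<longleftrightarrow> m \<le> g)"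
      using incomparable_meetE[OF T_tree[OF T(1)] T_tree[OF T(2)] assms(3)] .
    have "splitting T (meet s t)" using splitting_meet[OF T assms(3) False] .
    then have "meet s t = d0"
      using first_three[of "meet s t"] g(3,5) assms(1) len_01 len_12 by auto
    then show ?thesis using g(3,4,5) by auto
  qed simp
qed

text \<open>Two different nodes of this level have an empty meet, since no splitting node is shorter
  than \<open>d0\<close>.\<close>

lemma meet_closed_W0: "meet_closed W0"
  unfolding meet_closed_def
proof (intro ballI impI)
  fix s t assume st: "s \<in> W0" "t \<in> W0" "meet s t \<noteq> {}"
  have tr: "s \<in> tree" "t \<in> tree" using st T_tree by auto
  have "s = t"
  proof (rule ccontr)
    assume "s \<noteq> t"
    then have "\<not> comparable s t" using same_len_incomparable[OF tr] st by auto
    then show False using meet_below_u1[of s t] st by auto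
  qed
  then show "meet s t \<in> W0" using meet_subset(1)[OF tr] st by auto
qed

lemma max_nodes_levels: "max_nodes W0 = W0" "max_nodes (W0 \<union> W1) = W1" "max_nodes (W0 \<union> W1 \<union> W2) = W2"
proof -
  show "max_nodes W0 = W0" unfolding max_nodes_def by auto
  have "t \<in> W1" if "t \<in> max_nodes (W0 \<union> W1)" for t
  proof -
    have "t \<in> W0 \<union> W1" "len u1 \<le> len t" using that levels_thin(5) unfolding max_nodes_def by blast+
    then show ?thesis using len_01 by auto
  qed
  moreover have "t \<in> max_nodes (W0 \<union> W1)" if "t \<in> W1" for t
    using that len_01 unfolding max_nodes_def by auto
  ultimately show "max_nodes (W0 \<union> W1) = W1" by blast
  have "t \<in> W2" if "t \<in> max_nodes (W0 \<union> W1 \<union> W2)" for t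
  proof -
    have "t \<in> W0 \<union> W1 \<union> W2" "len u2 \<le> len t" using that levels_thin(6) unfolding max_nodes_def by blast+
    then show ?thesis using len_01 len_12 by auto
  qed
  moreover have "t \<in> max_nodes (W0 \<union> W1 \<union> W2)" if "t \<in> W2" for t
    using that len_01 len_12 unfolding max_nodes_def by auto
  ultimately show "max_nodes (W0 \<union> W1 \<union> W2) = W2" by blast
qed

lemma restr_level:
  assumes "splitting T r" "x \<in> T" "len r < len x"
  shows "restr x (len r) \<in> {t \<in> T. len t = len r}" "restr x (len r) \<subset> x"
proof -
  have "0 < len r" using tree_len_pos T_tree splitting_T[OF assms(1)] by blast
  then have r: "len (restr x (len r)) = len r" "restr x (len r) \<subseteq> x"
    using restr_in_tree[OF T_tree[OF assms(2)]] assms(3) by auto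
  then show "restr x (len r) \<subset> x" using assms(3) by auto
  show "restr x (len r) \<in> {t \<in> T. len t = len r}" using splitting_level[OF assms(1,2)] assms(3) r by simp
qed

text \<open>The first level is copied identically. Through this situation the Extension Property
  provides, above any extension of \<open>u1\<close>, a splitting node with the same value of
  \<open>\<psi>\<close>.\<close>

lemma situation1: "ep_situation T thin 1 u1 id W0 (restr u1 (Suc (len d0)))"
proof -
  have u1T: "u1 \<in> T" using splitting_T split_u1 by blast
  let ?d = "restr u1 (len d0)"
  have d: "?d \<in> W0" "?d \<subset> u1" using restr_level[OF split_d0 u1T len_01] by auto
  have "NA W0 = {}" using no_coding_at_split[OF split_d0] by blast
  then have "similarity_map id W0 W0" using similarity_refl[OF meet_closed_W0] by simp
  then have ps: "plus_similarity T id W0 W0"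
    unfolding plus_similarity_def using finite_T_level[of "len d0"] split_d0 levels_thin(4) max_nodes_levels(1) by auto
  have "restr u1 (Suc (len d0)) \<in> succs T ?d" using restr_succs[of ?d u1] d u1T by auto
  then have "to_be_split T id W0 u1 (restr u1 (Suc (len d0)))"
    unfolding to_be_split_def max_nodes_levels(1) using d by (intro bexI[of _ ?d]) auto
  moreover have "rk (Suc 1) thin = W0 \<union> W1" using rk_thin(2) by (simp add: numeral_2_eq_2)
  ultimately show ?thesis
    unfolding ep_situation_def rk_thin(1)
    using subtree_thin thin_T split_u1 ps levels_thin(5) max_nodes_levels(2) len_01 by auto
qed

text \<open>Sending the nodes of \<open>W1\<close> to arbitrary nodes above them, all of the length of a splitting node \<open>s1\<close>,
  is a similarity: only the meets in \<open>W0\<close>, which are not moved, matter.\<close>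

lemma moved_similarity:
  assumes c: "\<And>w. w \<in> W1 \<Longrightarrow> c w \<in> T \<and> w \<subseteq> c w \<and> len (c w) = len s1"
    and s1: "splitting T s1" "len u1 \<le> len s1"
  defines "f \<equiv> \<lambda>t. if t \<in> W1 then c t else t"
  shows "similarity_map f (W0 \<union> W1) (f ` (W0 \<union> W1))"
    and "\<And>s t. s \<in> W0 \<union> W1 \<Longrightarrow> t \<in> W0 \<union> W1 \<Longrightarrow> f s = f t \<Longrightarrow> s = t"
    and "NA (f ` (W0 \<union> W1)) = {}"
proof -
  let ?A = "W0 \<union> W1"
  have W01: "t \<notin> W1" if "t \<in> W0" for t using that len_01 by auto
  have f0: "f t = t" if "t \<in> W0" for t unfolding f_def by (rule if_not_P[OF W01[OF that]])
  have f1: "f t \<in> T" "t \<subseteq> f t" "len (f t) = len s1" if "t \<in> W1" for t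
    unfolding f_def using c[OF that] that by auto
  have fT: "f t \<in> T" "t \<subseteq> f t" if "t \<in> ?A" for t using that f0 f1 by auto
  have tr: "t \<in> tree" "f t \<in> tree" if "t \<in> ?A" for t using that fT T_tree by auto
  have up: "f s \<subset> f t" if "s \<in> ?A" "t \<in> ?A" "s \<subset> t" for s t
  proof -
    have "len s < len t" using node_psubset_len tr that by blast
    then have "s \<in> W0" "t \<in> W1" using that len_01 by auto
    then have "f s = s" "t \<subseteq> f t" using f0 f1(2) by auto
    then show ?thesis using that(3) by (simp add: psubset_subset_trans)
  qed
  have inc: "\<not> comparable (f s) (f t)" "meet (f s) (f t) = meet s t" "prec (f s) (f t) \<longleftrightarrow> prec s t"
    if "s \<in> ?A" "t \<in> ?A" "\<not> comparable s t" for s t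
    using extend_incomparable[OF tr(1)[OF that(1)] tr(1)[OF that(2)] tr(2)[OF that(1)] tr(2)[OF that(2)]
        fT(2)[OF that(1)] fT(2)[OF that(2)] that(3)] by auto
  have cmp: "comparable s t \<longleftrightarrow> s = t \<or> s \<subset> t \<or> t \<subset> s" for s t :: "'r lit set"
    unfolding comparable_def by auto
  show inj: "s = t" if "s \<in> ?A" "t \<in> ?A" "f s = f t" for s t
    using inc(1)[OF that(1,2)] up[OF that(1,2)] up[OF that(2,1)] that(3) cmp[of s t] cmp[of "f s" "f t"] by auto
  have sub: "s \<subseteq> t \<longleftrightarrow> f s \<subseteq> f t" if "s \<in> ?A" "t \<in> ?A" for s t
    using inc(1)[OF that] up[OF that] up[OF that(2,1)] cmp[of s t] unfolding comparable_def by auto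
  have pr: "prec s t \<longleftrightarrow> prec (f s) (f t)" if "s \<in> ?A" "t \<in> ?A" for s t
  proof (cases "comparable s t")
    case True
    then have "comparable (f s) (f t)" using sub that unfolding comparable_def by blast
    then have "prec (f s) (f t) \<longleftrightarrow> f s \<subset> f t" "prec s t \<longleftrightarrow> s \<subset> t" using prec_comparable True by auto
    moreover have "f s \<subset> f t \<longleftrightarrow> s \<subset> t" using sub[OF that] sub[OF that(2,1)] by auto
    ultimately show ?thesis by simp
  next
    case False
    then show ?thesis using inc(3)[OF that] by simp
  qed
  have mt: "meet (f s) (f t) = (if meet s t = {} then {} else f (meet s t)) \<and> (meet s t \<noteq> {} \<longrightarrow> meet s t \<in> ?A)"
    if "s \<in> ?A" "t \<in> ?A" for s t
  proof (cases "comparable s t")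
    case True
    have *: "meet (f s) (f t) = f s \<and> meet s t = s" if "s \<subseteq> t" "s \<in> ?A" "t \<in> ?A" for s t
      using meet_subset(1) tr sub that by meson
    have **: "meet (f s) (f t) = f t \<and> meet s t = t" if "t \<subseteq> s" "s \<in> ?A" "t \<in> ?A" for s t
      using meet_subset(2) tr sub that by meson
    from True show ?thesis unfolding comparable_def
    proof
      assume "s \<subseteq> t"
      then show ?thesis using * that tree_nonempty tr by auto
    next
      assume "t \<subseteq> s"
      then show ?thesis using ** that tree_nonempty tr by auto
    qed
  next
    case False
    \<comment> \<open>A nonempty meet of incomparable nodes is \<open>d0\<close>, which
      \<open>f\<close> fixes.\<close>
    have "meet s t = {} \<or> meet s t = d0" using meet_below_u1[OF that False] by blast
    then show ?thesis using inc(2)[OF that False] f0[OF levels_thin(4)] levels_thin(4) by auto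
  qed
  have ln: "len s < len t \<longleftrightarrow> len (f s) < len (f t)" if "s \<in> ?A" "t \<in> ?A" for s t
  proof -
    have *: "(len x = len d0 \<and> len (f x) = len d0) \<or> (len x = len u1 \<and> len (f x) = len s1)"
      if "x \<in> ?A" for x using that f0[of x] f1(3)[of x] by auto
    show ?thesis using *[OF that(1)] *[OF that(2)] s1(2) len_01 by linarith
  qed
  \<comment> \<open>Lengths of splitting nodes are never lengths of coding nodes, so neither side
    has coding nodes and the clauses on passing types are vacuous.\<close>
  have NA0: "NA ?A = {}"
    using no_coding_at_split[OF split_d0] no_coding_at_split[OF split_u1] unfolding NA_def by blast
  show NA1: "NA (f ` ?A) = {}"
  proof (rule equals0I)
    fix i assume "i \<in> NA (f ` ?A)"
    then obtain t where t: "t \<in> ?A" "cn i = f t" unfolding NA_def by blast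
    then have i: "i \<in> NA T" using fT(1) unfolding NA_def by simp
    have "len (f t) = len d0 \<or> len (f t) = len s1" using t(1) f0[of t] f1(3)[of t] by auto
    then show False using splitting_not_coding[OF split_d0 i] splitting_not_coding[OF s1(1) i] t(2) by auto
  qed
  have hc: "\<not> has_cn ?A n" "\<not> has_cn (f ` ?A) n" for n
    unfolding has_cn_def NA0 NA1 by auto
  have mcA: "meet_closed ?A" unfolding meet_closed_def
    by (intro ballI impI) (rule mt[THEN conjunct2, THEN mp])
  have mcB: "meet_closed (f ` ?A)" unfolding meet_closed_def
  proof (intro ballI impI)
    fix x y assume "x \<in> f ` ?A" "y \<in> f ` ?A" and ne: "meet x y \<noteq> {}"
    then obtain s t where st: "s \<in> ?A" "t \<in> ?A" "x = f s" "y = f t" by blast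
    note m = mt[OF st(1,2)]
    have ne': "meet s t \<noteq> {}" using conjunct1[OF m] ne st(3,4) by (cases "meet s t = {}") simp_all
    have "meet x y = f (meet s t)" using conjunct1[OF m] ne' st(3,4) by (simp only: if_False)
    moreover have "meet s t \<in> ?A" using conjunct2[OF m] ne' by (rule mp)
    ultimately show "meet x y \<in> f ` ?A" by (rule image_eqI)
  qed
  have "bij_betw f ?A (f ` ?A)" by (rule inj_on_imp_bij_betw, rule inj_onI, rule inj)
  then show "similarity_map f ?A (f ` ?A)"
    unfolding similarity_map_def
    by (intro conjI ballI allI impI mcA mcB pr ln sub mt[THEN conjunct1]) (use hc in \<open>simp_all only: simp_thms\<close>)
qed

text \<open>Let \<open>?d\<close> be the node of \<open>W1\<close> below \<open>u2\<close>. If it is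
  \<open>u1\<close>, then it and its image both split in two, and the successor on the matching side
  is taken. Otherwise neither splits and the successor is unique. The node of \<open>T\<close> above
  it is the starting point for finding a splitting node there.\<close>

lemma to_be_split_exists:
  assumes f: "f u1 = s1" "splitting T s1"
    and fT: "\<And>t. t \<in> W1 \<Longrightarrow> f t \<in> T \<and> len (f t) = len s1"
    and inj: "\<And>t. t \<in> W1 \<Longrightarrow> f t = s1 \<Longrightarrow> t = u1"
  shows "\<exists>s. to_be_split T f (W0 \<union> W1) u2 s \<and> (\<exists>s0\<in>T. s \<subseteq> s0)"
proof -
  have u2T: "u2 \<in> T" using splitting_T split_u2 by blast
  let ?d = "restr u2 (len u1)"
  let ?p = "restr u2 (Suc (len ?d))"
  have d: "?d \<in> W1" "?d \<subset> u2" using restr_level[OF split_u1 u2T len_12] by auto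
  have p: "?p \<in> succs T ?d" using restr_succs[of ?d u2] d u2T by auto
  have above: "\<exists>s0\<in>T. s \<subseteq> s0" if "s \<in> succs T x" for s x
    using that restr_in_tree(3)[OF T_tree] unfolding succs_def hat_def by blast
  have lenp: "len x = Suc (len t)" if "x \<in> succs T t" for x t using that unfolding succs_def by blast
  have asym: "prec x y \<longleftrightarrow> \<not> prec y x" if "x \<in> succs T t" "y \<in> succs T t" "x \<noteq> y" for x y t
    using prec_total[OF succs_tree[OF that(1)] succs_tree[OF that(2)]]
      same_len_incomparable[OF succs_tree[OF that(1)] succs_tree[OF that(2)]] lenp[OF that(1)] lenp[OF that(2)] that(3)
    by simp
  let ?lhs = "\<exists>d'\<in>succs T ?d. prec d' ?p"
  have "\<exists>s\<in>succs T (f ?d). ?lhs \<longleftrightarrow> (\<exists>s'\<in>succs T (f ?d). prec s' s)"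
  proof (cases "?d = u1")
    case True
    obtain x y where xy: "x \<in> succs T s1" "y \<in> succs T s1" "x \<noteq> y"
      using f(2) unfolding splitting_def by blast
    have card2: "card (succs T s1) = 2" using splitting_card[OF f(2)] .
    then have "finite (succs T s1)" by (metis card.infinite zero_neq_numeral)
    then have eq: "succs T s1 = {x, y}"
      using card_subset_eq[of "succs T s1" "{x, y}"] xy card2 by auto
    have fd: "f ?d = s1" using True f(1) by simp
    \<comment> \<open>\<open>hi\<close> has a \<open>prec\<close>-smaller sibling and
      \<open>lo\<close> has none, so one of them matches either truth value of
      \<open>?lhs\<close>.\<close>
    obtain lo hi where lh: "succs T s1 = {lo, hi}" "prec lo hi" "\<not> prec hi lo"
      using asym[OF xy] eq by (metis insert_commute)
    show ?thesis
    proof (cases ?lhs)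
      case True
      then show ?thesis unfolding fd lh(1) using lh(2) by blast
    next
      case False
      then show ?thesis unfolding fd lh(1) using lh(3) prec_irrefl[of lo] by blast
    qed
  next
    case False
    have nd: "\<not> splitting T ?d" using splitting_unique[OF _ split_u1, of ?d] d False by auto
    have "x = ?p" if "x \<in> succs T ?d" for x using nd d p that unfolding splitting_def by blast
    then have nlhs: "\<not> ?lhs" using prec_irrefl by metis
    have fdT: "f ?d \<in> T" "len (f ?d) = len s1" using fT[OF d(1)] by auto
    have nf: "\<not> splitting T (f ?d)" using splitting_unique[OF _ f(2), of "f ?d"] fdT inj[OF d(1)] False by auto
    obtain v where "v \<in> T" "f ?d \<subset> v" using perfectD(1)[OF fdT(1)] by blast
    then have q: "restr v (Suc (len (f ?d))) \<in> succs T (f ?d)" using restr_succs[OF fdT(1)] by blast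
    have "x = restr v (Suc (len (f ?d)))" if "x \<in> succs T (f ?d)" for x
      using nf fdT(1) q that unfolding splitting_def by blast
    then have "\<not> (\<exists>s'\<in>succs T (f ?d). prec s' (restr v (Suc (len (f ?d)))))" using prec_irrefl by metis
    then show ?thesis using q nlhs by blast
  qed
  then obtain s where s: "s \<in> succs T (f ?d)" "?lhs \<longleftrightarrow> (\<exists>s'\<in>succs T (f ?d). prec s' s)" by blast
  have "to_be_split T f (W0 \<union> W1) u2 s"
    unfolding to_be_split_def max_nodes_levels(2) using d s by (intro bexI[of _ ?d]) auto
  then show ?thesis using above[OF s(1)] by blast
qed

text \<open>The Extension Property does not say where the nodes that are not split go, so control is
  put into the copy to be extended. The nodes of \<open>W1\<close> are moved above their targets,
  with \<open>u1\<close> going to a splitting node of the right value of \<open>\<psi>\<close>. This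
  is a similarity copy of the first two levels, and the Extension Property at \<open>u2\<close>
  continues it to a copy of \<open>thin\<close>.\<close>

lemma thin_copy:
  assumes ep: "extension_property_for T"
    and c: "\<And>w. w \<in> W1 \<Longrightarrow> c w \<in> T \<and> w \<subseteq> c w"
  shows "\<exists>\<eta>. embedding \<eta> (restr_struct K (NA thin)) K \<and>
    (\<forall>x\<in>NA thin. \<eta> x \<in> NA T \<and> (\<forall>w\<in>W1. w \<subseteq> cn x \<longrightarrow> c w \<subseteq> cn (\<eta> x)))"
proof -
  obtain \<psi> :: "'r lit set \<Rightarrow> nat" where
    dense: "\<And>A k u f B s s0. ep_situation T A k u f B s \<Longrightarrow>
        (\<And>t. t \<in> rk k A \<Longrightarrow> splitting T t \<Longrightarrow> splitting T (f t) \<and> \<psi> t = \<psi> (f t)) \<Longrightarrow> s0 \<in> T \<Longrightarrow> s \<subseteq> s0 \<Longrightarrow>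
        \<exists>s'. splitting T s' \<and> s0 \<subseteq> s' \<and> \<psi> s' = \<psi> u"
    and ext: "\<And>A k u f B s s'. ep_situation T A k u f B s \<Longrightarrow>
        (\<And>t. t \<in> rk k A \<Longrightarrow> splitting T t \<Longrightarrow> splitting T (f t) \<and> \<psi> t = \<psi> (f t)) \<Longrightarrow> splitting T s' \<Longrightarrow>
        s \<subseteq> s' \<Longrightarrow> \<psi> s' = \<psi> u \<Longrightarrow> ep_extends T A k u f s'"
    using uniform_extension_property[OF ep] by blast
  have u1T: "u1 \<in> T" using splitting_T split_u1 by blast
  \<comment> \<open>\<open>M\<close> bounds the lengths of all targets, so a splitting node
    \<open>s1\<close> beyond it can set a common length for the moved nodes.\<close>
  have "finite ((\<lambda>w. len (c w)) ` W1)" using finite_T_level[of "len u1"] by blast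
  then obtain M where M: "\<forall>x\<in>(\<lambda>w. len (c w)) ` W1. x \<le> M" using finite_nat_set_iff_bounded_le by blast
  obtain s0 where s0: "s0 \<in> T" "c u1 \<subseteq> s0" "M \<le> len s0"
    using unbounded[of "c u1" M] c[OF levels_thin(5)] by blast
  have "restr u1 (Suc (len d0)) \<subseteq> s0"
    using restr_in_tree(3)[OF T_tree[OF u1T], of "Suc (len d0)"] len_01 c[OF levels_thin(5)] s0 by auto
  then obtain s1 where s1: "splitting T s1" "s0 \<subseteq> s1" "\<psi> s1 = \<psi> u1"
    using dense[OF situation1 _ s0(1)] by auto
  have s1T: "s1 \<in> T" using splitting_T s1 by blast
  have Ms: "M \<le> len s1" using s0 s1 node_subset_len[OF T_tree T_tree, of s0 s1] s1T by auto
  \<comment> \<open>Each target is continued upwards in \<open>T\<close> and cut back to the length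
    of \<open>s1\<close>.\<close>
  have "\<exists>t\<in>T. c w \<subseteq> t \<and> len t = len s1" if w: "w \<in> W1" for w
  proof -
    obtain v where v: "v \<in> T" "c w \<subseteq> v" "len s1 \<le> len v" using unbounded c[OF w] by blast
    have r: "restr v (len s1) \<in> T" using splitting_level[OF s1(1) v(1,3)] .
    have pos: "0 < len s1" using tree_len_pos T_tree s1T by blast
    have l: "len (restr v (len s1)) = len s1" "restr v (len s1) \<subseteq> v"
      using restr_in_tree[OF T_tree[OF v(1)] pos v(3)] by auto
    have "len (c w) \<le> len s1" using M w Ms by fastforce
    then have "c w \<subseteq> restr v (len s1)"
      using chain_comparable[OF T_tree T_tree T_tree, of "c w" "restr v (len s1)" v] c[OF w] r v l by auto
    then show ?thesis using r l by blast
  qed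
  then obtain c0 where c0: "\<And>w. w \<in> W1 \<Longrightarrow> c0 w \<in> T \<and> c w \<subseteq> c0 w \<and> len (c0 w) = len s1" by metis
  \<comment> \<open>For the copy to be a +-similarity copy, the splitting node \<open>u1\<close> has
    to go to a splitting node.\<close>
  define c1 where "c1 = c0(u1 := s1)"
  have c1: "c1 w \<in> T \<and> w \<subseteq> c1 w \<and> len (c1 w) = len s1" and cc: "c w \<subseteq> c1 w" if "w \<in> W1" for w
    using c0[OF that] c[OF that] s1 s1T s0 by (auto simp: c1_def)
  define f where "f = (\<lambda>t. if t \<in> W1 then c1 t else t)"
  have lus: "len u1 \<le> len s1"
    using node_subset_len[OF T_tree T_tree, of u1 s1] c1[OF levels_thin(5)] u1T s1T by (simp add: c1_def)
  note ms = moved_similarity(1)[of c1 s1, OF c1 s1(1) lus, folded f_def]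
  have fu1: "f u1 = s1" using levels_thin(5) by (simp add: f_def c1_def)
  have f1: "f t = c1 t" if "t \<in> W1" for t unfolding f_def using that by (rule if_P)
  have f0: "f t = t" if "t \<in> W0" for t
  proof -
    have "t \<notin> W1" using that len_01 by auto
    then show ?thesis unfolding f_def by (rule if_not_P)
  qed
  have "\<exists>s. to_be_split T f (W0 \<union> W1) u2 s \<and> (\<exists>s0\<in>T. s \<subseteq> s0)"
  proof (rule to_be_split_exists[of f s1, OF fu1 s1(1)])
    show "f t \<in> T \<and> len (f t) = len s1" if "t \<in> W1" for t using f1[OF that] c1[OF that] by simp
    show "t = u1" if "t \<in> W1" "f t = s1" for t
    proof (rule moved_similarity(2)[of c1 s1, OF c1 s1(1) lus])
      show "t \<in> W0 \<union> W1" "u1 \<in> W0 \<union> W1" using that levels_thin(5) by auto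
      show "(if t \<in> W1 then c1 t else t) = (if u1 \<in> W1 then c1 u1 else u1)"
        using that(2) fu1 unfolding f_def by simp
    qed
  qed
  then obtain s z where s: "to_be_split T f (W0 \<union> W1) u2 s" and z: "z \<in> T" "s \<subseteq> z" by blast
  let ?B = "f ` (W0 \<union> W1)"
  have fT: "f t \<in> T" if "t \<in> W0 \<union> W1" for t using that f0 f1 c1 by fastforce
  have maxB: "s1 \<in> max_nodes ?B"
  proof -
    have "len (f t) \<le> len s1" if "t \<in> W0 \<union> W1" for t using that f0 f1 c1 lus len_01 by fastforce
    moreover have "s1 \<in> ?B" using fu1 levels_thin(5) by blast
    ultimately show ?thesis unfolding max_nodes_def by blast
  qed
  have ps: "plus_similarity T f (W0 \<union> W1) ?B"
    unfolding plus_similarity_def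
  proof (intro conjI disjI1)
    show "finite (W0 \<union> W1)" "finite ?B" using finite_T_level by auto
    show "similarity_map f (W0 \<union> W1) ?B" by (rule ms)
    show "\<exists>u\<in>max_nodes (W0 \<union> W1). splitting T u \<and> f u \<in> max_nodes ?B \<and> splitting T (f u)"
      unfolding max_nodes_levels(2) using levels_thin(5) split_u1 fu1 maxB s1(1) by (intro bexI[of _ u1]) auto
  qed
  have rk3: "rk (Suc 2) thin = W0 \<union> W1 \<union> W2" using rk_thin(3) by (simp add: numeral_3_eq_3 numeral_2_eq_2)
  have "u2 \<notin> W0 \<union> W1" using len_01 len_12 by auto
  then have sit: "ep_situation T thin 2 u2 f ?B s"
    unfolding ep_situation_def rk3 rk_thin(2) max_nodes_levels(3)
    using subtree_thin thin_T split_u2 levels_thin(6) fT ps s by auto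
  \<comment> \<open>In the first two levels only \<open>d0\<close> and \<open>u1\<close> split; the
    former is fixed and the latter is sent to \<open>s1\<close>.\<close>
  have psi: "splitting T (f t) \<and> \<psi> t = \<psi> (f t)" if "t \<in> rk 2 thin" "splitting T t" for t
  proof -
    have "t = d0 \<or> t = u1" using that first_three[OF that(2)] len_01 len_12 unfolding rk_thin by auto
    then show ?thesis using f0[OF levels_thin(4)] fu1 s1 split_d0 by auto
  qed
  obtain s2 where s2: "splitting T s2" "z \<subseteq> s2" "\<psi> s2 = \<psi> u2"
    using dense[OF sit psi z] by blast
  have "ep_extends T thin 2 u2 f s2"
    using ext[OF sit psi s2(1) _ s2(3)] z(2) s2(2) by blast
  then obtain g h D where gh: "\<forall>t\<in>rk 2 thin. g t = f t" "D \<subseteq> T" "similarity_map h thin D"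
    "\<forall>t\<in>thin \<inter> rk (Suc 2) thin. h t = g t"
    unfolding ep_extends_def by blast
  \<comment> \<open>\<open>h\<close> continues \<open>g\<close>, which continues \<open>f\<close>,
    so the values chosen on \<open>W1\<close> persist in the whole copy.\<close>
  have h1: "h w = c1 w" if w: "w \<in> W1" for w
  proof -
    have "w \<in> thin" using levels_thin(2) w by blast
    then show ?thesis using gh(1,4) f1[OF w] w unfolding rk3 rk_thin(2) by auto
  qed
  obtain \<eta> where \<eta>: "embedding \<eta> (restr_struct K (NA thin)) K"
    "\<forall>x\<in>NA thin. \<eta> x \<in> NA D \<and> h (cn x) = cn (\<eta> x)"
    using similarity_embedding[OF gh(3) infinite_NA_thin] by blast
  have "\<eta> x \<in> NA T \<and> (\<forall>w\<in>W1. w \<subseteq> cn x \<longrightarrow> c w \<subseteq> cn (\<eta> x))" if x: "x \<in> NA thin" for x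
  proof (intro conjI ballI impI)
    show "\<eta> x \<in> NA T" using \<eta>(2) x gh(2) unfolding NA_def by blast
    fix w assume w: "w \<in> W1" "w \<subseteq> cn x"
    have "w \<in> thin" "cn x \<in> thin" using w levels_thin(2) x unfolding NA_def by auto
    then have "h w \<subseteq> h (cn x)" using similarity_mapD(2)[OF gh(3)] w(2) by blast
    then show "c w \<subseteq> cn (\<eta> x)" using \<eta>(2) x cc[OF w(1)] h1[OF w(1)] by auto
  qed
  then show ?thesis using \<eta>(1) by blast
qed

text \<open>Coding nodes with the same label share a root. If their restrictions to the length of
  \<open>u1\<close> differ, they part at a splitting node shorter than \<open>u1\<close>, which is
  \<open>d0\<close>, and \<open>d0\<close> has only two immediate successors.\<close>

lemma two_sides:
  obtains a b where "a \<in> W1" "b \<in> W1"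
    "\<forall>x\<in>NA thin. unary_label x = l \<longrightarrow> a \<subseteq> cn x \<or> b \<subseteq> cn x"
proof -
  let ?N = "{x \<in> NA thin. unary_label x = l}"
  let ?w = "\<lambda>x. restr (cn x) (len u1)"
  have W: "?w x \<in> W1" "?w x \<subseteq> cn x" if "x \<in> ?N" for x
  proof -
    have "x \<in> NA T" "len u1 < len (cn x)" using that len_12 unfolding NA_thin by auto
    then have "cn x \<in> T" "len u1 < len (cn x)" unfolding NA_def by auto
    then show "?w x \<in> W1" "?w x \<subseteq> cn x" using restr_level[OF split_u1] by blast+
  qed
  have diff: "restr (?w x) (Suc (len d0)) \<in> succs T d0 \<and>
      restr (?w x) (Suc (len d0)) \<noteq> restr (?w y) (Suc (len d0))"
    if xy: "x \<in> ?N" "y \<in> ?N" "?w x \<noteq> ?w y" for x y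
  proof -
    have T: "?w x \<in> T" "?w y \<in> T" and ln: "len (?w x) = len u1" "len (?w y) = len u1"
      using W(1) xy by auto
    have tr: "?w x \<in> tree" "?w y \<in> tree" using T T_tree by auto
    have inc: "\<not> comparable (?w x) (?w y)" using same_len_incomparable[OF tr] ln xy(3) by simp
    obtain g where g: "meet (?w x) (?w y) = restr (?w x) g" "meet (?w x) (?w y) = restr (?w y) g"
      "g < len (?w x)" "g < len (?w y)" "len (meet (?w x) (?w y)) = g"
      "restr (?w x) (Suc g) \<noteq> restr (?w y) (Suc g)"
      "\<forall>m. m \<le> len (?w x) \<longrightarrow> m \<le> len (?w y) \<longrightarrow> (restr (?w x) m = restr (?w y) m \<longleftrightarrow> m \<le> g)"
      using incomparable_meetE[OF tr inc] .
    have pos: "1 \<le> len u1" using len_01 by simp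
    \<comment> \<open>Length 1 is that of a type over no parameters, so equal labels make the meet
      nonempty.\<close>
    have root: "restr (?w v) 1 = tp v 0" if "v \<in> ?N" for v
    proof -
      have "len u1 < len (cn v)" using that len_12 unfolding NA_thin by auto
      then have "restr (?w v) 1 = restr (cn v) 1" using restr_restr[OF cn_in_tree pos] by simp
      then show ?thesis unfolding cn_def by (simp add: restr_tp)
    qed
    have "unary_label x = unary_label y" using xy by simp
    then have "restr (?w x) 1 = restr (?w y) 1" using root xy unary_label_root by auto
    then have "1 \<le> g" using g(7)[rule_format, of 1] ln pos by simp
    then have "meet (?w x) (?w y) \<noteq> {}" using g(5) by auto
    then have m: "meet (?w x) (?w y) = d0"
      using meet_below_u1[OF _ _ inc] W(1) xy by blast
    then have gd: "g = len d0" using g(5) by simp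
    have "d0 \<subseteq> ?w x" using m g(1,3) restr_in_tree(3)[OF tr(1), of g] \<open>1 \<le> g\<close> by simp
    then have "d0 \<subset> ?w x" using ln len_01 by auto
    then show ?thesis using restr_succs[OF splitting_T[OF split_d0] T(1)] g(6) gd by simp
  qed
  show thesis
  proof (cases "\<exists>x\<in>?N. \<exists>y\<in>?N. ?w x \<noteq> ?w y")
    case True
    then obtain x y where xy: "x \<in> ?N" "y \<in> ?N" "?w x \<noteq> ?w y" by blast
    have two: "?w v = ?w x \<or> ?w v = ?w y" if v: "v \<in> ?N" for v
    proof (rule ccontr)
      assume "\<not> (?w v = ?w x \<or> ?w v = ?w y)"
      then have ne: "?w v \<noteq> ?w x" "?w v \<noteq> ?w y" by auto
      let ?s = "\<lambda>x. restr (?w x) (Suc (len d0))"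
      have sub: "{?s v, ?s x, ?s y} \<subseteq> succs T d0"
        using diff[OF v xy(1) ne(1)] diff[OF xy] diff[OF xy(2,1)] xy(3) by auto
      have "?s v \<noteq> ?s x" "?s v \<noteq> ?s y" "?s x \<noteq> ?s y"
        using diff[OF v xy(1) ne(1)] diff[OF v xy(2) ne(2)] diff[OF xy] by blast+
      then have "card {?s v, ?s x, ?s y} = 3" by simp
      moreover have "finite (succs T d0)" using splitting_card[OF split_d0] by (metis card.infinite zero_neq_numeral)
      ultimately have "3 \<le> card (succs T d0)" using card_mono[OF _ sub] by simp
      then show False using splitting_card[OF split_d0] by simp
    qed
    show thesis
    proof (rule that[OF W(1)[OF xy(1)] W(1)[OF xy(2)]], intro ballI impI)
      fix v assume "v \<in> NA thin" "unary_label v = l"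
      then have v: "v \<in> ?N" by simp
      from two[OF v] W(2)[OF v] show "?w x \<subseteq> cn v \<or> ?w y \<subseteq> cn v" by (elim disjE) simp_all
    qed
  next
    \<comment> \<open>One node serves for both sides; if no vertex has the label, \<open>u1\<close>
      is a default.\<close>
    case False
    show thesis
    proof (cases "?N = {}")
      case True
      then show thesis using that[of u1 u1] levels_thin(5) by blast
    next
      case ne: False
      then obtain x where x: "x \<in> ?N" by blast
      show thesis
      proof (rule that[OF W(1)[OF x] W(1)[OF x]], intro ballI impI)
        fix v assume "v \<in> NA thin" "unary_label v = l"
        then have v: "v \<in> ?N" by simp
        then have "?w v = ?w x" using False x by blast
        then show "?w x \<subseteq> cn v \<or> ?w x \<subseteq> cn v" using W(2)[OF v] by simp
      qed
    qed
  qed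
qed

end

section \<open>Limits and their automorphism groups\<close>

lemma univ_restr [simp]: "univ (restr_struct M Y) = univ M \<inter> Y"
  unfolding restr_struct_def by simp

lemma interp_restr: "xs \<in> interp (restr_struct M Y) R \<longleftrightarrow> xs \<in> interp M R \<and> set xs \<subseteq> Y"
  unfolding restr_struct_def by simp

lemma restr_substruct:
  assumes "is_struct ar M" shows "substruct (restr_struct M Y) M"
proof -
  have "{xs \<in> interp M R. set xs \<subseteq> Y} = {xs \<in> interp M R. set xs \<subseteq> univ M \<inter> Y}" for R
    using assms unfolding is_struct_def by blast
  then show ?thesis unfolding substruct_def restr_struct_def by simp
qed

lemma embedding_comp:
  assumes "embedding f A B" "embedding g B C" shows "embedding (g \<circ> f) A C"
  unfolding embedding_def
proof (intro conjI allI impI)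
  have fg: "inj_on f (univ A)" "f ` univ A \<subseteq> univ B" "inj_on g (univ B)" "g ` univ B \<subseteq> univ C"
    using assms unfolding embedding_def by auto
  show "inj_on (g \<circ> f) (univ A)" using fg by (meson comp_inj_on inj_on_subset)
  show "(g \<circ> f) ` univ A \<subseteq> univ C" using fg by auto
  fix R xs assume xs: "set xs \<subseteq> univ A"
  then have "set (map f xs) \<subseteq> univ B" using assms(1) unfolding embedding_def by auto
  then show "xs \<in> interp A R \<longleftrightarrow> map (g \<circ> f) xs \<in> interp C R"
    using assms xs unfolding embedding_def by (metis map_map)
qed

lemma embedding_restr:
  assumes "embedding f A B" shows "embedding f (restr_struct A Y) B"
  using assms unfolding embedding_def by (auto simp: interp_restr intro: inj_on_subset)

lemma embedding_restr_target:
  assumes "embedding f A B" "f ` univ A \<subseteq> Y" shows "embedding f A (restr_struct B Y)"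
  using assms unfolding embedding_def by (auto simp: interp_restr) (metis image_subset_iff subsetD)+

lemma embedding_id_restr: "embedding id (restr_struct M Y) M"
  unfolding embedding_def by (auto simp: interp_restr)

lemma embedding_restr_larger: "Y \<subseteq> Z \<Longrightarrow> embedding id (restr_struct M Y) (restr_struct M Z)"
  unfolding embedding_def by (auto simp: interp_restr)

lemma homogeneous_extension:
  assumes "ultrahomogeneous M" "is_struct ar M" "Y \<subseteq> univ M" "finite Y" "embedding g (restr_struct M Y) M"
  obtains G where "isomorphism G M M" "\<And>y. y \<in> Y \<Longrightarrow> G y = g y"
proof -
  have uY: "univ (restr_struct M Y) = Y" using assms(3) by auto
  have gY: "g ` Y \<subseteq> univ M" using assms(5) uY unfolding embedding_def by auto
  have "embedding g (restr_struct M Y) (restr_struct M (g ` Y))"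
    using embedding_restr_target[OF assms(5), of "g ` Y"] uY by simp
  then have "isomorphism g (restr_struct M Y) (restr_struct M (g ` Y))"
    using uY gY unfolding isomorphism_def by auto
  then have "\<exists>G. isomorphism G M M \<and> (\<forall>a\<in>univ (restr_struct M Y). G a = g a)"
    using assms(1) restr_substruct[OF assms(2)] assms(4) uY unfolding ultrahomogeneous_def by metis
  then show thesis using that uY by auto
qed

lemma isomorphism_inv:
  assumes "isomorphism f A B"
  shows "isomorphism (inv_into (univ A) f) B A"
proof -
  let ?g = "inv_into (univ A) f"
  have f: "inj_on f (univ A)" "f ` univ A = univ B"
    "\<And>R xs. set xs \<subseteq> univ A \<Longrightarrow> xs \<in> interp A R \<longleftrightarrow> map f xs \<in> interp B R"
    using assms unfolding isomorphism_def embedding_def by auto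
  have bij: "bij_betw ?g (univ B) (univ A)" 
    using f(1,2) bij_betw_inv_into[of f "univ A" "univ B"] by (simp add: bij_betw_def)
  have fg: "f (?g b) = b" if "b \<in> univ B" for b using f(2) that f_inv_into_f by metis
  show ?thesis unfolding isomorphism_def embedding_def
  proof (intro conjI allI impI)
    show "inj_on ?g (univ B)" "?g ` univ B = univ A" "?g ` univ B \<subseteq> univ A" using bij by (auto simp: bij_betw_def)
    fix R xs assume xs: "set xs \<subseteq> univ B"
    have "map f (map ?g xs) = xs" using fg xs by (auto intro!: map_idI)
    moreover have "set (map ?g xs) \<subseteq> univ A" using bij xs unfolding bij_betw_def by auto
    ultimately show "xs \<in> interp B R \<longleftrightarrow> map ?g xs \<in> interp A R" using f(3) by metis
  qed
qed

lemma qftp_empty_embedding: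
  assumes "embedding h M N" "x \<in> univ M"
  shows "qftp ar L M x {} = qftp ar L N (h x) {}"
proof -
  have "map (tm_val x) ts \<in> interp M R \<longleftrightarrow> map (tm_val (h x)) ts \<in> interp N R" if ts: "set ts \<subseteq> {X}" for ts R
  proof -
    have "map (tm_val (h x)) ts = map h (map (tm_val x) ts)" using ts by auto
    moreover have "set (map (tm_val x) ts) \<subseteq> univ M" using ts assms(2) by auto
    ultimately show ?thesis using assms(1) unfolding embedding_def by metis
  qed
  then show ?thesis unfolding qftp_def by auto
qed

locale limit =
  fixes ar :: "'r \<Rightarrow> nat" and \<K> :: "(nat, 'r) rstruct set" and K :: "(nat, 'r) rstruct"
  assumes enum: "enumerated_limit ar \<K> K" and dap: "disjoint_amalgamation \<K>"
begin

lemma univ_K: "univ K = UNIV" and struct_K: "is_struct ar K" and age_K: "age ar K = \<K>"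
  and hom_K: "ultrahomogeneous K"
  using enum unfolding enumerated_limit_def fraisse_limit_def by auto

definition Aut :: "(nat \<Rightarrow> nat) set" where
  "Aut = {G. isomorphism G K K}"

lemma Aut_iff: "G \<in> Aut \<longleftrightarrow> bij G \<and> (\<forall>R xs. xs \<in> interp K R \<longleftrightarrow> map G xs \<in> interp K R)"
  unfolding Aut_def isomorphism_def embedding_def using univ_K by (auto simp: bij_def)

lemma embedding_K_iff:
  "embedding e K K \<longleftrightarrow> inj e \<and> (\<forall>R xs. xs \<in> interp K R \<longleftrightarrow> map e xs \<in> interp K R)"
  unfolding embedding_def using univ_K by auto

sublocale perm_group Aut
proof
  show "id \<in> Aut" unfolding Aut_iff by simp
  show "G \<circ> H \<in> Aut" if "G \<in> Aut" "H \<in> Aut" for G H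
    using that unfolding Aut_iff by (metis bij_comp map_map)
  show "bij G" if "G \<in> Aut" for G using that unfolding Aut_iff by blast
  show "inv G \<in> Aut" if "G \<in> Aut" for G
    using isomorphism_inv[of G K K] that unfolding Aut_def univ_K by simp
qed

lemma extend_partial:
  assumes "finite F" "embedding g (restr_struct K F) K"
  obtains G where "G \<in> Aut" "\<And>f. f \<in> F \<Longrightarrow> G f = g f"
proof -
  obtain G where "isomorphism G K K" "\<And>y. y \<in> F \<Longrightarrow> G y = g y"
    using homogeneous_extension[OF hom_K struct_K _ assms] univ_K by auto
  then show thesis using that unfolding Aut_def by auto
qed

text \<open>On a finite set a self-embedding extends to an automorphism by ultrahomogeneity;
  conversely, being an embedding is a condition on finitely many vertices at a time.\<close>

lemma loc_iff: "loc e \<longleftrightarrow> embedding e K K"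
proof
  assume e: "embedding e K K"
  show "loc e" unfolding loc_def
  proof (intro allI impI)
    fix F :: "nat set" assume "finite F"
    then obtain G where "G \<in> Aut" "\<And>f. f \<in> F \<Longrightarrow> G f = e f"
      using extend_partial[of F e] embedding_restr[OF e] by blast
    then show "\<exists>G\<in>Aut. \<forall>f\<in>F. e f = G f" by (intro bexI[of _ G]) auto
  qed
next
  assume e: "loc e"
  show "embedding e K K" unfolding embedding_K_iff
  proof (intro conjI allI)
    show "inj e" using loc_inj[OF e] by (simp add: inj_def)
    fix R xs
    obtain G where G: "G \<in> Aut" "\<forall>f\<in>set xs. e f = G f" using e unfolding loc_def by (metis finite_set)
    then have "map e xs = map G xs" by auto
    then show "xs \<in> interp K R \<longleftrightarrow> map e xs \<in> interp K R" using G(1) unfolding Aut_iff by metis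
  qed
qed

lemma restr_in_class: "finite F \<Longrightarrow> restr_struct K F \<in> \<K>"
proof -
  assume "finite F"
  then have "fin_struct ar (restr_struct K F)"
    using struct_K univ_K unfolding fin_struct_def is_struct_def by (fastforce simp: interp_restr)
  then show ?thesis using embedding_id_restr age_K unfolding age_def by blast
qed

text \<open>The standard argument that disjoint amalgamation excludes algebraicity. Were the orbit
  finite, it could be amalgamated over \<open>F\<close> with a new copy of \<open>x\<close> disjoint
  from it; realized in \<open>K\<close>, this copy would be a conjugate of \<open>x\<close> over
  \<open>F\<close> outside the orbit.\<close>

lemma orb_infinite:
  assumes F: "finite F" "x \<notin> F" shows "infinite (orb F x)"
proof
  assume fin: "finite (orb F x)"
  let ?A = "restr_struct K F" and ?B = "restr_struct K (insert x F)" and ?C = "restr_struct K (F \<union> orb F x)"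
  have AB: "embedding id ?A ?B" "embedding id ?A ?C" by (rule embedding_restr_larger, blast)+
  have cl: "?A \<in> \<K>" "?B \<in> \<K>" "?C \<in> \<K>" using restr_in_class F fin by auto
  obtain D p q where D: "D \<in> \<K>" and pq: "embedding p ?B D" "embedding q ?C D"
    and agree: "\<And>a. a \<in> F \<Longrightarrow> p a = q a"
    and disj: "p ` univ ?B \<inter> q ` univ ?C = (\<lambda>a. p a) ` univ ?A"
  proof -
    have "\<exists>D\<in>\<K>. \<exists>f' g'. embedding f' ?B D \<and> embedding g' ?C D \<and>
        (\<forall>a\<in>univ ?A. f' (id a) = g' (id a)) \<and> f' ` univ ?B \<inter> g' ` univ ?C = (\<lambda>a. f' (id a)) ` univ ?A"
      using dap AB cl unfolding disjoint_amalgamation_def by blast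
    then show thesis using that univ_K by auto
  qed
  obtain k where k: "embedding k D K" using D age_K unfolding age_def by blast
  have kq: "embedding (k \<circ> q) ?C K" "embedding (k \<circ> p) ?B K"
    using embedding_comp[OF pq(2) k] embedding_comp[OF pq(1) k] by auto
  obtain G where G: "G \<in> Aut" "\<And>f. f \<in> F \<union> orb F x \<Longrightarrow> G f = (k \<circ> q) f"
    using extend_partial[OF _ kq(1)] F fin by blast
  \<comment> \<open>\<open>inv G\<close> puts the realized orbit back into its original place and
    takes the new copy of \<open>x\<close> along.\<close>
  let ?m = "inv G \<circ> (k \<circ> p)"
  have "embedding (inv G) K K" using inv_mem[OF G(1)] unfolding Aut_def isomorphism_def by blast
  then have "embedding ?m ?B K" using embedding_comp[OF kq(2)] by blast
  then obtain H where H: "H \<in> Aut" "\<And>f. f \<in> insert x F \<Longrightarrow> H f = ?m f"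
    using extend_partial[of "insert x F" ?m] F by blast
  have "H f = f" if "f \<in> F" for f using H(2)[of f] G(2)[of f] agree[OF that] that inv_f(1)[OF G(1), of f] by simp
  then have Hx: "H x \<in> orb F x" using H(1) orb_step[OF orb_self] by blast
  have "k (p x) = G (H x)" using H(2)[of x] inv_f(2)[OF G(1)] by simp
  then have "k (p x) = k (q (H x))" using G(2)[of "H x"] Hx by simp
  moreover have "p x \<in> univ D" "q (H x) \<in> univ D"
    using pq Hx univ_K unfolding embedding_def by auto
  ultimately have "p x = q (H x)" using k unfolding embedding_def inj_on_def by blast
  \<comment> \<open>The new copy falls into the image of the orbit; by disjointness it then lies in
    the image of \<open>F\<close>, against the injectivity of \<open>p\<close>.\<close>
  then have "p x \<in> p ` univ ?B \<inter> q ` univ ?C" using Hx univ_K by auto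
  then have "p x \<in> (\<lambda>a. p a) ` univ ?A" unfolding disj .
  then have "p x \<in> p ` F" using univ_K by simp
  then obtain a where a: "a \<in> F" "p x = p a" by blast
  then have "x = a" using pq(1) univ_K unfolding embedding_def inj_on_def by auto
  then show False using a F by simp
qed

lemma label_orb:
  assumes "y \<in> orb F x" shows "qftp ar UNIV K y {} = qftp ar UNIV K x {}"
proof -
  obtain G where "G \<in> Aut" "y = G x" using assms unfolding orb_def by auto
  then show ?thesis using qftp_empty_embedding[of G K K x ar UNIV] univ_K unfolding Aut_def isomorphism_def by auto
qed

lemma distinct_interp:
  assumes "distinct_relations \<K>" "xs \<in> interp K R" shows "distinct xs"
proof -
  have "restr_struct K (set xs) \<in> \<K>" using restr_in_class by simp
  moreover have "xs \<in> interp (restr_struct K (set xs)) R" using assms(2) by (simp add: interp_restr)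
  ultimately show ?thesis using assms(1) unfolding distinct_relations_def by blast
qed

end

text \<open>Renaming the vertices by an involution gives another enumeration of the same limit. With
  a transposition, any vertex can be made the first one.\<close>

lemma swapped_limit:
  fixes K :: "(nat, 'r) rstruct"
  assumes enum: "enumerated_limit ar \<K> K" and \<pi>: "\<And>x. \<pi> (\<pi> x) = x"
  defines "K' \<equiv> \<lparr>univ = UNIV, interp = (\<lambda>R. {xs. map \<pi> xs \<in> interp K R})\<rparr>"
  shows "enumerated_limit ar \<K> K'" "isomorphism \<pi> K K'" "isomorphism \<pi> K' K"
proof -
  have K: "univ K = UNIV" "is_struct ar K" "age ar K = \<K>" "ultrahomogeneous K"
    using enum unfolding enumerated_limit_def fraisse_limit_def by auto
  have bij: "bij \<pi>" using \<pi> by (rule involuntory_imp_bij)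
  have mm: "map \<pi> (map \<pi> xs) = xs" for xs using \<pi> by (simp add: map_idI)
  have u: "univ K' = UNIV" and i: "xs \<in> interp K' R \<longleftrightarrow> map \<pi> xs \<in> interp K R" for xs R
    unfolding K'_def by auto
  show iso: "isomorphism \<pi> K K'" "isomorphism \<pi> K' K"
  proof -
    have "embedding \<pi> K K'" unfolding embedding_def i mm using u bij by (auto simp: bij_def intro: inj_on_subset)
    then show "isomorphism \<pi> K K'" unfolding isomorphism_def using K(1) u bij by (simp add: bij_is_surj)
    have "embedding \<pi> K' K" unfolding embedding_def i using K(1) u bij by (auto simp: bij_def intro: inj_on_subset)
    then show "isomorphism \<pi> K' K" unfolding isomorphism_def using K(1) u bij by (simp add: bij_is_surj)
  qed
  then have emb: "embedding \<pi> K K'" "embedding \<pi> K' K" unfolding isomorphism_def by auto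
  have "is_struct ar K'"
    unfolding is_struct_def u
  proof (intro allI subsetI)
    fix R xs assume "xs \<in> interp K' R"
    then have "length (map \<pi> xs) = ar R" using K(2) i unfolding is_struct_def by blast
    then show "xs \<in> {xs. length xs = ar R \<and> set xs \<subseteq> UNIV}" by simp
  qed
  moreover have "age ar K' = \<K>"
    unfolding K(3)[symmetric] age_def using embedding_comp emb by blast
  moreover have "ultrahomogeneous K'"
    unfolding ultrahomogeneous_def
  proof (intro allI impI)
    fix A B g assume a: "substruct A K' \<and> substruct B K' \<and> finite (univ A) \<and> isomorphism g A B"
    let ?F = "\<pi> ` univ A"
    have A: "A = restr_struct K' (univ A)" and B: "B = restr_struct K' (univ B)"
      using a unfolding substruct_def by auto
    have gB: "embedding g A B" "g ` univ A = univ B" using a unfolding isomorphism_def by auto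
    have gK: "embedding g A K'" using embedding_comp[OF gB(1) embedding_id_restr[of K' "univ B", folded B]] by simp
    have pA: "embedding \<pi> (restr_struct K ?F) A"
    proof -
      have "\<pi> ` univ (restr_struct K ?F) \<subseteq> univ A" using \<pi> by auto
      then show ?thesis using embedding_restr_target[OF embedding_restr[OF emb(1)]] A by metis
    qed
    \<comment> \<open>The finite partial map is carried over to \<open>K\<close>, extended there,
      and the extension is carried back.\<close>
    let ?m = "\<pi> \<circ> (g \<circ> \<pi>)"
    have "embedding ?m (restr_struct K ?F) K" using embedding_comp[OF embedding_comp[OF pA gK] emb(2)] .
    then obtain G where G: "isomorphism G K K" "\<And>x. x \<in> ?F \<Longrightarrow> G x = ?m x"
      using homogeneous_extension[OF K(4,2), of ?F ?m] a K(1) by blast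
    let ?h = "\<pi> \<circ> (G \<circ> \<pi>)"
    have "embedding G K K" "bij G" using G(1) K(1) unfolding isomorphism_def embedding_def by (auto simp: bij_def)
    then have "embedding ?h K' K'" "bij ?h"
      using embedding_comp[OF embedding_comp[OF emb(2)] emb(1)] bij by (auto intro!: bij_comp)
    then have "embedding ?h K' K'" "surj ?h" using bij_is_surj by blast+
    then have "isomorphism ?h K' K'" unfolding isomorphism_def u by blast
    moreover have "?h a = g a" if "a \<in> univ A" for a
      using G(2)[of "\<pi> a"] that \<pi> by simp
    ultimately show "\<exists>h. isomorphism h K' K' \<and> (\<forall>a\<in>univ A. h a = g a)" by blast
  qed
  ultimately show "enumerated_limit ar \<K> K'"
    unfolding enumerated_limit_def fraisse_limit_def using u by simp
qed

section \<open>Indivisibility of the limit\<close>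

text \<open>A splitting at the root is impossible: the root would be the coding node of \<open>v\<^sub>0\<close>.\<close>

lemma (in perfect_subtree) root_not_split:
  assumes "i \<in> NA T" "j \<in> NA T" "i \<noteq> 0" "j \<noteq> 0" "unary_label i = unary_label 0" "unary_label j = unary_label 0"
  shows "tp i 1 = tp j 1"
proof (rule ccontr)
  assume ne: "tp i 1 \<noteq> tp j 1"
  have T: "cn i \<in> T" "cn j \<in> T" using assms unfolding NA_def by auto
  \<comment> \<open>Length 2 is that of types over the vertex 0; the coding node of any other vertex
    is at least that long.\<close>
  have r2: "restr (cn k) 2 = tp k 1" if "k \<noteq> 0" for k
    using restr_tp[of 2 k k] that unfolding cn_def by simp
  have r1: "restr (cn k) 1 = tp k 0" for k using restr_tp[of 1 k k] unfolding cn_def by simp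
  have l2: "2 \<le> len (cn i)" "2 \<le> len (cn j)" using assms by auto
  have inc: "\<not> comparable (cn i) (cn j)"
    by (rule differing_incomparable[of _ _ 2]) (use T_tree[OF T(1)] T_tree[OF T(2)] l2 r2 assms ne in auto)
  obtain g where g: "meet (cn i) (cn j) = restr (cn i) g" "meet (cn i) (cn j) = restr (cn j) g"
    "g < len (cn i)" "g < len (cn j)" "len (meet (cn i) (cn j)) = g"
    "restr (cn i) (Suc g) \<noteq> restr (cn j) (Suc g)"
    "\<forall>m. m \<le> len (cn i) \<longrightarrow> m \<le> len (cn j) \<longrightarrow> (restr (cn i) m = restr (cn j) m \<longleftrightarrow> m \<le> g)"
    using incomparable_meetE[OF T_tree[OF T(1)] T_tree[OF T(2)] inc] .
  have "1 \<le> g" using g(7)[rule_format, of 1] r1 l2 unary_label_root[of i j] assms(5,6) by simp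
  moreover have "\<not> 2 \<le> g" using g(7)[rule_format, of 2] l2 r2 assms(3,4) ne by simp
  \<comment> \<open>So the two nodes part at the root, which is the coding node of the vertex 0. It
    would be a splitting node with the length of a coding node.\<close>
  ultimately have "g = 1" by simp
  then have m: "meet (cn i) (cn j) = cn 0"
    using g(1) r1 unary_label_root[OF assms(5)] unfolding cn_def by simp
  have "cn 0 \<noteq> {}" using tree_nonempty[OF cn_in_tree] .
  then have "splitting T (cn 0)" using splitting_meet[OF T inc] m by simp
  moreover have "0 \<in> NA T" using splitting_T[OF \<open>splitting T (cn 0)\<close>] unfolding NA_def by simp
  ultimately show False using splitting_not_coding by blast
qed

lemma (in limit_coding_tree) coding_copy:
  assumes "diagonal_coding_subtree T"
  obtains \<rho> where "embedding \<rho> K K" "range \<rho> = NA T"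
proof -
  obtain f where "isomorphism f (sub_K T) K"
    using assms unfolding diagonal_coding_subtree_def isomorphic_def by blast
  then have "isomorphism (inv_into (univ (sub_K T)) f) K (sub_K T)" by (rule isomorphism_inv)
  then have *: "embedding (inv_into (univ (sub_K T)) f) K (sub_K T)"
    "range (inv_into (univ (sub_K T)) f) = NA T"
    unfolding isomorphism_def sub_K_def using univ_K by auto
  then show thesis using that embedding_comp[OF *(1), of id K] embedding_id_restr[of K "NA T"]
    unfolding sub_K_def by simp
qed

lemma (in limit_coding_tree) perfect_subtreeI:
  assumes "diagonal_coding_subtree T" "perfect T"
  shows "perfect_subtree ar K L ord T"
proof
  show "subtree T" "diagonal T" "perfect T" using assms unfolding diagonal_coding_subtree_def by auto
  obtain \<rho> where \<rho>: "embedding \<rho> K K" "range \<rho> = NA T" using coding_copy[OF assms(1)] .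
  then have "inj \<rho>" unfolding embedding_def using univ_K by simp
  then show "infinite (NA T)" using \<rho>(2) by (metis finite_imageD infinite_UNIV_nat)
qed

locale convention_limit = limit ar \<K> K
  for ar :: "'r::finite \<Rightarrow> nat" and \<K> :: "(nat, 'r) rstruct set" and K :: "(nat, 'r) rstruct" +
  fixes ord :: "'r lit rel"
  assumes lang: "language_convention ar" and dist: "distinct_relations \<K>" and order: "formula_order ord"
begin

lemma limit_coding_treeI:
  assumes "L \<in> tree_symbols ar" shows "limit_coding_tree ar K L ord"
proof
  obtain R where "2 \<le> ar R" using lang unfolding language_convention_def by blast
  then show "\<exists>R\<in>L. 2 \<le> ar R" using assms unfolding tree_symbols_def by auto
  show "R \<in> L" if "ar R \<noteq> 1" for R using assms that unfolding tree_symbols_def by auto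
  show "1 \<le> ar R" for R using lang unfolding language_convention_def by blast
  show "distinct xs" if "xs \<in> interp K R" for xs R using distinct_interp[OF dist that] .
qed (use order struct_K univ_K in auto)

text \<open>The copy consists of the vertices coded in \<open>T\<close>. Those in the sort of 0,
  apart from 0 itself, have one type over 0 because the root does not split, so ultrahomogeneity
  gives automorphisms fixing 0 between them.\<close>

lemma homogeneous_copy_at_zero:
  assumes dctp: "diagonal_coding_tree_property ar \<K>"
  shows "\<exists>e. loc e \<and> (\<forall>y\<in>orb {} 0. \<forall>z\<in>orb {} 0. e y \<noteq> 0 \<longrightarrow> e z \<noteq> 0 \<longrightarrow> e z \<in> orb {0} (e y))"
proof -
  obtain L T where L: "L \<in> tree_symbols ar" and T: "coding_tree.diagonal_coding_subtree ar K L T"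
    "coding_tree.perfect T"
    using dctp enum unfolding diagonal_coding_tree_property_def by blast
  interpret ct: limit_coding_tree ar K L ord by (rule limit_coding_treeI[OF L])
  interpret ps: perfect_subtree ar K L ord T by (rule ct.perfect_subtreeI[OF T])
  obtain \<rho> where \<rho>: "embedding \<rho> K K" "range \<rho> = ct.NA T" using ct.coding_copy[OF T(1)] .
  have loc\<rho>: "loc \<rho>" using \<rho> loc_iff by blast
  have "\<rho> z \<in> orb {0} (\<rho> y)" if yz: "y \<in> orb {} 0" "z \<in> orb {} 0" "\<rho> y \<noteq> 0" "\<rho> z \<noteq> 0" for y z
  proof -
    have N: "\<rho> y \<in> ct.NA T" "\<rho> z \<in> ct.NA T" using \<rho>(2) by auto
    have "\<rho> y \<in> orb {} 0" "\<rho> z \<in> orb {} 0" using loc_orb_empty[OF loc\<rho>] yz by auto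
    then have lab: "ct.unary_label (\<rho> y) = ct.unary_label 0" "ct.unary_label (\<rho> z) = ct.unary_label 0"
      unfolding ct.unary_label_def using label_orb by auto
    have "ct.tp (\<rho> y) 1 = ct.tp (\<rho> z) 1" by (rule ps.root_not_split[OF N yz(3,4) lab])
    then have "qftp ar L K (\<rho> y) {0} = qftp ar L K (\<rho> z) {0}" unfolding ct.tp_def by (simp add: lessThan_Suc)
    then have "embedding (id(\<rho> y := \<rho> z)) (restr_struct K (insert (\<rho> y) {0})) K"
      using ct.same_type_embedding[of "\<rho> y" "{0}" "\<rho> z"] lab yz by simp
    then obtain G where G: "G \<in> Aut" "\<And>f. f \<in> insert (\<rho> y) {0} \<Longrightarrow> G f = (id(\<rho> y := \<rho> z)) f"
      using extend_partial[of "insert (\<rho> y) {0}" "id(\<rho> y := \<rho> z)"] by auto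
    have "G 0 = 0" "G (\<rho> y) = \<rho> z" using G(2)[of 0] G(2)[of "\<rho> y"] yz(3) by auto
    then show ?thesis using orb_step[OF orb_self G(1), of "{0}" "\<rho> y"] by simp
  qed
  then show ?thesis using loc\<rho> by blast
qed

text \<open>The Diagonal Coding Tree Property speaks about every enumeration, so \<open>f\<close>
  may be exchanged with 0 and the result transported back.\<close>

lemma homogeneous_copy:
  assumes dctp: "diagonal_coding_tree_property ar \<K>"
  shows "\<exists>e. loc e \<and> (\<forall>y\<in>orb {} f. \<forall>z\<in>orb {} f. e y \<noteq> f \<longrightarrow> e z \<noteq> f \<longrightarrow> e z \<in> orb {f} (e y))"
proof -
  define \<pi> where "\<pi> x = (if x = 0 then f else if x = f then 0 else x)" for x :: nat
  have \<pi>: "\<pi> (\<pi> x) = x" for x unfolding \<pi>_def by auto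
  have \<pi>f: "\<pi> f = 0" "\<pi> 0 = f" unfolding \<pi>_def by auto
  define K' where "K' = \<lparr>univ = UNIV, interp = (\<lambda>R. {xs. map \<pi> xs \<in> interp K R})\<rparr>"
  note sw = swapped_limit[OF enum, of \<pi>, OF \<pi>, folded K'_def]
  interpret s: convention_limit ar \<K> K' ord
    by unfold_locales (use sw(1) dap lang dist order in auto)
  have emb: "embedding \<pi> K K'" "embedding \<pi> K' K" using sw(2,3) unfolding isomorphism_def by auto
  \<comment> \<open>Conjugation by \<open>\<pi>\<close> identifies the automorphism groups of
    \<open>K\<close> and \<open>K'\<close>.\<close>
  have conj: "\<pi> \<circ> (G \<circ> \<pi>) \<in> s.Aut" if "G \<in> Aut" for G
  proof -
    have "embedding G K K" "bij G" using that bij_mem unfolding Aut_def isomorphism_def by auto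
    then have "embedding (\<pi> \<circ> (G \<circ> \<pi>)) K' K'" using embedding_comp[OF embedding_comp[OF emb(2)] emb(1)] by blast
    moreover have "bij (\<pi> \<circ> (G \<circ> \<pi>))"
      using involuntory_imp_bij[of \<pi>] \<pi> \<open>bij G\<close> by (intro bij_comp) auto
    ultimately show ?thesis unfolding s.Aut_def isomorphism_def s.univ_K using bij_is_surj by blast
  qed
  have conj': "\<pi> \<circ> (G \<circ> \<pi>) \<in> Aut" if "G \<in> s.Aut" for G
  proof -
    have "embedding G K' K'" "bij G" using that s.bij_mem unfolding s.Aut_def isomorphism_def by auto
    then have "embedding (\<pi> \<circ> (G \<circ> \<pi>)) K K" using embedding_comp[OF embedding_comp[OF emb(1)] emb(2)] by blast
    moreover have "bij (\<pi> \<circ> (G \<circ> \<pi>))"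
      using involuntory_imp_bij[of \<pi>] \<pi> \<open>bij G\<close> by (intro bij_comp) auto
    ultimately show ?thesis unfolding Aut_def isomorphism_def univ_K using bij_is_surj by blast
  qed
  obtain e where e: "s.loc e" "\<And>y z. y \<in> s.orb {} 0 \<Longrightarrow> z \<in> s.orb {} 0 \<Longrightarrow> e y \<noteq> 0 \<Longrightarrow> e z \<noteq> 0 \<Longrightarrow>
      e z \<in> s.orb {0} (e y)"
    using s.homogeneous_copy_at_zero[OF dctp] by blast
  let ?e = "\<pi> \<circ> (e \<circ> \<pi>)"
  have "embedding e K' K'" using e(1) s.loc_iff by blast
  then have "embedding ?e K K" using embedding_comp[OF embedding_comp[OF emb(1)] emb(2)] by blast
  then have "loc ?e" using loc_iff by blast
  moreover have "?e z \<in> orb {f} (?e y)" if yz: "y \<in> orb {} f" "z \<in> orb {} f" "?e y \<noteq> f" "?e z \<noteq> f" for y z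
  proof -
    have "\<pi> x \<in> s.orb {} 0" if x: "x \<in> orb {} f" for x
    proof -
      obtain G where G: "G \<in> Aut" "x = G f" using x unfolding orb_def by auto
      then have "\<pi> x = (\<pi> \<circ> (G \<circ> \<pi>)) 0" using \<pi>f by simp
      then show ?thesis unfolding s.orb_def using conj[OF G(1)] by blast
    qed
    moreover have "e (\<pi> x) \<noteq> 0" if "?e x \<noteq> f" for x using that \<pi>f(2) by (metis comp_apply)
    ultimately have "e (\<pi> z) \<in> s.orb {0} (e (\<pi> y))" using e(2) yz by blast
    then obtain G where G: "G \<in> s.Aut" "G 0 = 0" "e (\<pi> z) = G (e (\<pi> y))" unfolding s.orb_def by auto
    let ?G = "\<pi> \<circ> (G \<circ> \<pi>)"
    have "?G \<in> Aut" "?G f = f" "?e z = ?G (?e y)" using conj'[OF G(1)] G \<pi>f \<pi> by auto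
    then show ?thesis unfolding orb_def by blast
  qed
  ultimately show ?thesis by blast
qed

text \<open>An orbit over \<open>F\<close> that is infinite on a side has a point \<open>x\<close>
  there whose image under \<open>\<iota>\<close> comes after the image of \<open>F\<close>. Vertices
  of the sort coded above that image lie in its orbit over the image of \<open>F\<close>. By
  \<open>thin_copy\<close> the side can be moved into this cone, and an automorphism brings it back
  into the given orbit.\<close>

lemma sided_exists:
  assumes dctp: "diagonal_coding_tree_property ar \<K>" and ep: "extension_property ar ord K"
  shows "\<exists>A B. sided Aut x0 A B"
proof -
  obtain L T where L: "L \<in> tree_symbols ar" and T: "coding_tree.diagonal_coding_subtree ar K L T"
    "coding_tree.perfect T" and ext: "coding_tree.extension_property_for ar K L ord T"
    using ep unfolding extension_property_def by blast
  interpret ct: limit_coding_tree ar K L ord by (rule limit_coding_treeI[OF L])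
  interpret ps: perfect_subtree ar K L ord T by (rule ct.perfect_subtreeI[OF T])
  obtain d0 u1 u2 where "ct.splitting T d0" "ct.splitting T u1" "ct.splitting T u2"
    "ct.len d0 < ct.len u1" "ct.len u1 < ct.len u2"
    "\<forall>r. ct.splitting T r \<longrightarrow> r = d0 \<or> r = u1 \<or> r = u2 \<or> ct.len u2 < ct.len r"
    using ps.first_splits .
  then interpret st: split_tree ar K L ord T d0 u1 u2 by unfold_locales auto
  obtain \<rho> where \<rho>: "embedding \<rho> K K" "range \<rho> = ct.NA T" using ct.coding_copy[OF T(1)] .
  have loc\<rho>: "loc \<rho>" using \<rho> loc_iff by blast
  let ?N = "ct.NA st.thin"
  have "finite {x. \<rho> x \<notin> ?N}"
  proof -
    have "\<rho> ` {x. \<rho> x \<notin> ?N} \<subseteq> ct.NA T - ?N" using \<rho>(2) by auto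
    then have "finite (\<rho> ` {x. \<rho> x \<notin> ?N})" using st.finite_NA_diff finite_subset by blast
    moreover have "inj_on \<rho> {x. \<rho> x \<notin> ?N}" using loc_inj[OF loc\<rho>] by (simp add: inj_on_def)
    ultimately show ?thesis using finite_imageD by blast
  qed
  then have "orb F x \<inter> {x. \<rho> x \<in> ?N} \<noteq> {}" if "finite F" "x \<notin> F" for F x
  proof -
    have "orb F x \<inter> {x. \<rho> x \<in> ?N} = orb F x - {x. \<rho> x \<notin> ?N}" by blast
    then show ?thesis using Diff_infinite_finite[OF \<open>finite {x. \<rho> x \<notin> ?N}\<close> orb_infinite[OF that]]
      infinite_imp_nonempty by metis
  qed
  \<comment> \<open>Only finitely many vertices are mapped outside \<open>?N\<close>, and the orbits
    are infinite, so \<open>K\<close> embeds into the set of the others.\<close>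
  then obtain j where j: "loc j" "j ` UNIV \<subseteq> {x. \<rho> x \<in> ?N}"
    using rich_embedding[of UNIV "{x. \<rho> x \<in> ?N}"] by auto
  define \<iota> where "\<iota> = \<rho> \<circ> j"
  have loc\<iota>: "loc \<iota>" unfolding \<iota>_def using loc_comp[OF loc\<rho> j(1)] .
  have \<iota>N: "\<iota> x \<in> ?N" for x unfolding \<iota>_def using j(2) by auto
  have \<iota>T: "ct.cn (\<iota> x) \<in> T" for x using \<iota>N[of x] unfolding st.NA_thin by (simp add: ct.NA_def)
  let ?\<Gamma> = "orb {} x0"
  obtain a b where ab': "a \<in> {t \<in> T. ct.len t = ct.len u1}" "b \<in> {t \<in> T. ct.len t = ct.len u1}"
    and sides': "\<forall>x\<in>?N. ct.unary_label x = ct.unary_label x0 \<longrightarrow> a \<subseteq> ct.cn x \<or> b \<subseteq> ct.cn x"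
    using st.two_sides[of "ct.unary_label x0"] .
  have ab: "a \<in> T" "ct.len a = ct.len u1" "b \<in> T" "ct.len b = ct.len u1" using ab' by auto
  note sides = sides'[rule_format]
  have lab: "ct.unary_label (e x) = ct.unary_label x0" if "loc e" "x \<in> ?\<Gamma>" for e x
    using label_orb[of "e x" "{}" x0] loc_orb_empty[OF that(1)] that(2) unfolding ct.unary_label_def by blast
  \<comment> \<open>The sides record which of \<open>a\<close> and \<open>b\<close> lies below the
    coding node of the image; if \<open>a = b\<close>, then \<open>B\<close> is empty.\<close>
  define A where "A = {x \<in> ?\<Gamma>. a \<subseteq> ct.cn (\<iota> x)}"
  define B where "B = ?\<Gamma> - A"
  have Bb: "b \<subseteq> ct.cn (\<iota> x)" "a \<noteq> b" if "x \<in> B" for x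
    using sides[OF \<iota>N lab[OF loc\<iota>]] that unfolding A_def B_def by auto
  have move: "\<exists>e. loc e \<and> (\<forall>z\<in>A. ta \<subseteq> ct.cn (e z)) \<and> (\<forall>z\<in>B. tb \<subseteq> ct.cn (e z))"
    if t: "ta \<in> T" "tb \<in> T" "a \<subseteq> ta" "b \<subseteq> tb" for ta tb
  proof -
    \<comment> \<open>\<open>thin_copy\<close> asks for a target for every node of the level; only
      \<open>a\<close> and \<open>b\<close> are moved.\<close>
    define c where "c w = (if w = a then ta else if w = b then tb else w)" for w
    have c: "c w \<in> T \<and> w \<subseteq> c w" if "w \<in> {t \<in> T. ct.len t = ct.len u1}" for w
      using t that unfolding c_def by auto
    obtain \<eta> where \<eta>: "embedding \<eta> (restr_struct K ?N) K"
      "\<forall>x\<in>?N. \<eta> x \<in> ct.NA T \<and> (\<forall>w\<in>{t \<in> T. ct.len t = ct.len u1}. w \<subseteq> ct.cn x \<longrightarrow> c w \<subseteq> ct.cn (\<eta> x))"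
      using st.thin_copy[OF ext c] by blast
    have "embedding \<iota> K (restr_struct K ?N)"
      using embedding_restr_target[of \<iota> K K ?N] loc\<iota> loc_iff \<iota>N by auto
    then have "loc (\<eta> \<circ> \<iota>)" using embedding_comp[OF _ \<eta>(1)] loc_iff by blast
    moreover have "ta \<subseteq> ct.cn ((\<eta> \<circ> \<iota>) z)" if "z \<in> A" for z
    proof -
      have "a \<subseteq> ct.cn (\<iota> z)" using that unfolding A_def by blast
      then have "c a \<subseteq> ct.cn (\<eta> (\<iota> z))" using \<eta>(2) \<iota>N[of z] ab by blast
      then show ?thesis unfolding c_def by simp
    qed
    moreover have "tb \<subseteq> ct.cn ((\<eta> \<circ> \<iota>) z)" if "z \<in> B" for z
    proof -
      have "c b \<subseteq> ct.cn (\<eta> (\<iota> z))" using \<eta>(2) \<iota>N[of z] ab Bb(1)[OF that] by blast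
      then show ?thesis using Bb(2)[OF that] unfolding c_def by simp
    qed
    ultimately show ?thesis by blast
  qed
  \<comment> \<open>The injective map \<open>\<iota>\<close> is unbounded on an infinite
    set.\<close>
  have late: "\<exists>x\<in>S. \<forall>f\<in>F. \<iota> f < \<iota> x" if fs: "finite F" "infinite S" for F S
  proof -
    obtain m where m: "\<forall>x\<in>\<iota> ` F. x < m" using fs finite_nat_set_iff_bounded by (metis finite_imageI)
    have "inj_on \<iota> S" using loc_inj[OF loc\<iota>] by (simp add: inj_on_def)
    then have "infinite (\<iota> ` S)" using fs(2) finite_imageD by blast
    then obtain x where x: "x \<in> S" "m < \<iota> x" unfolding infinite_nat_iff_unbounded by blast
    have "\<iota> f < \<iota> x" if "f \<in> F" for f using m that x(2) by (meson imageI less_trans)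
    then show ?thesis using x(1) by blast
  qed
  \<comment> \<open>Extending the coding node of \<open>\<iota> x\<close> means having its type over
    all earlier vertices, hence over the image of \<open>F\<close>; as the labels agree too, the
    vertices are conjugate.\<close>
  have cone: "v \<in> orb (\<iota> ` F) (\<iota> x)"
    if v: "\<forall>f\<in>F. \<iota> f < \<iota> x" "ct.cn (\<iota> x) \<subseteq> ct.cn v" "ct.unary_label v = ct.unary_label (\<iota> x)" for v x F
  proof -
    let ?i = "\<iota> x"
    have tp: "?i \<le> v" "ct.tp v ?i = ct.tp ?i ?i" using ct.cn_subset_cn[OF v(2)] by auto
    have "embedding (id(?i := v)) (restr_struct K (insert ?i {..<?i})) K"
      by (rule ct.same_type_embedding) (use tp v(3) in \<open>auto simp: ct.tp_def\<close>)
    then obtain G where G: "G \<in> Aut" "\<And>f. f \<in> insert ?i {..<?i} \<Longrightarrow> G f = (id(?i := v)) f"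
      using extend_partial[of "insert ?i {..<?i}" "id(?i := v)"] by auto
    have Gi: "G ?i = v" using G(2)[of ?i] by simp
    have Gf: "G f = f" if "f \<in> \<iota> ` F" for f
    proof -
      have "f < ?i" using that v(1) by auto
      then show ?thesis using G(2)[of f] by simp
    qed
    show ?thesis using orb_step[OF orb_self G(1), of "\<iota> ` F" ?i] Gf Gi by simp
  qed
  \<comment> \<open>On a finite set \<open>\<iota>\<close> acts like an automorphism
    \<open>G\<close>, so an orbit over the image of \<open>F\<close> is brought back by
    \<open>inv G\<close>.\<close>
  have pull: "inv G w \<in> orb F x" if w: "w \<in> orb (\<iota> ` F) (\<iota> x)" and G: "G \<in> Aut" "\<forall>f\<in>insert x F. \<iota> f = G f" for G F x w
  proof -
    have "\<iota> ` F = G ` F" "\<iota> x = G x" using G(2) by auto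
    then have "w \<in> G ` orb F x" using orb_image[OF G(1), of F x] w by simp
    then show ?thesis using inv_f(1)[OF G(1)] by auto
  qed
  have place: "inv G (e z) \<in> orb F y" if "loc e" "z \<in> ?\<Gamma>" "x \<in> ?\<Gamma>" "\<forall>f\<in>F. \<iota> f < \<iota> x"
      "ct.cn (\<iota> x) \<subseteq> ct.cn (e z)" "G \<in> Aut" "\<forall>f\<in>insert x F. \<iota> f = G f" "x \<in> orb F y" for e z x F G y
  proof -
    have "e z \<in> orb (\<iota> ` F) (\<iota> x)"
      using cone[OF that(4,5)] lab[OF that(1,2)] lab[OF loc\<iota> that(3)] by simp
    then show ?thesis using pull[OF _ that(6,7)] orb_eq[OF that(8)] by blast
  qed
  have A\<Gamma>: "A \<subseteq> ?\<Gamma>" and B\<Gamma>: "B \<subseteq> ?\<Gamma>" unfolding A_def B_def by auto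
  have locinv: "loc (inv G \<circ> e)" if "loc e" "G \<in> Aut" for e G
    using loc_comp[OF loc_mem[OF inv_mem[OF that(2)]] that(1)] .
  have J: "\<exists>e. loc e \<and> e ` A \<subseteq> orb F y \<and> e ` B \<subseteq> orb F' y'"
    if F: "finite F" "finite F'" and i: "infinite (orb F y \<inter> A)" "infinite (orb F' y' \<inter> B)" for F F' y y'
  proof -
    obtain x where x: "x \<in> orb F y \<inter> A" "\<forall>f\<in>F. \<iota> f < \<iota> x" using late[OF F(1) i(1)] by blast
    obtain x' where x': "x' \<in> orb F' y' \<inter> B" "\<forall>f\<in>F'. \<iota> f < \<iota> x'" using late[OF F(2) i(2)] by blast
    have "a \<subseteq> ct.cn (\<iota> x)" using x unfolding A_def by blast
    moreover have "b \<subseteq> ct.cn (\<iota> x')" using x' Bb by blast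
    ultimately obtain e where e: "loc e" "\<forall>z\<in>A. ct.cn (\<iota> x) \<subseteq> ct.cn (e z)"
      "\<forall>z\<in>B. ct.cn (\<iota> x') \<subseteq> ct.cn (e z)"
      using move[OF \<iota>T \<iota>T] by blast
    \<comment> \<open>One automorphism imitating \<open>\<iota>\<close> on both finite sets brings
      the two sides back at once.\<close>
    have "finite (insert x F \<union> insert x' F')" using F by simp
    then obtain G where G: "G \<in> Aut" "\<forall>f\<in>insert x F \<union> insert x' F'. \<iota> f = G f"
      using loc\<iota> unfolding loc_def by meson
    have "inv G (e z) \<in> orb F y" if "z \<in> A" for z
      by (rule place[OF e(1), of z x]) (use e x G A\<Gamma> that in auto)
    moreover have "inv G (e z) \<in> orb F' y'" if "z \<in> B" for z
      by (rule place[OF e(1), of z x']) (use e x' G B\<Gamma> that in auto)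
    ultimately show ?thesis using locinv[OF e(1) G(1)] by (intro exI[of _ "inv G \<circ> e"]) auto
  qed
  have JA: "\<exists>e. loc e \<and> e ` A \<subseteq> orb F y" if F: "finite F" and i: "infinite (orb F y \<inter> A)" for F y
  proof -
    obtain x where x: "x \<in> orb F y \<inter> A" "\<forall>f\<in>F. \<iota> f < \<iota> x" using late[OF F(1) i(1)] by blast
    have "a \<subseteq> ct.cn (\<iota> x)" using x unfolding A_def by blast
    \<comment> \<open>The other side is only required to stay above its own node
      \<open>b\<close>.\<close>
    then obtain e where e: "loc e" "\<forall>z\<in>A. ct.cn (\<iota> x) \<subseteq> ct.cn (e z)"
      using move[OF \<iota>T ab(3)] by blast
    have "finite (insert x F)" using F by simp
    then obtain G where G: "G \<in> Aut" "\<forall>f\<in>insert x F. \<iota> f = G f"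
      using loc\<iota> unfolding loc_def by meson
    have "inv G (e z) \<in> orb F y" if "z \<in> A" for z
      by (rule place[OF e(1), of z x]) (use e x G A\<Gamma> that in auto)
    then show ?thesis using locinv[OF e(1) G(1)] by (intro exI[of _ "inv G \<circ> e"]) auto
  qed
  have JB: "\<exists>e. loc e \<and> e ` B \<subseteq> orb F y" if F: "finite F" and i: "infinite (orb F y \<inter> B)" for F y
  proof -
    obtain x where x: "x \<in> orb F y \<inter> B" "\<forall>f\<in>F. \<iota> f < \<iota> x" using late[OF F(1) i(1)] by blast
    have "b \<subseteq> ct.cn (\<iota> x)" using x Bb by blast
    then obtain e where e: "loc e" "\<forall>z\<in>B. ct.cn (\<iota> x) \<subseteq> ct.cn (e z)"
      using move[OF ab(1) \<iota>T] by blast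
    have "finite (insert x F)" using F by simp
    then obtain G where G: "G \<in> Aut" "\<forall>f\<in>insert x F. \<iota> f = G f"
      using loc\<iota> unfolding loc_def by meson
    have "inv G (e z) \<in> orb F y" if "z \<in> B" for z
      by (rule place[OF e(1), of z x]) (use e x G B\<Gamma> that in auto)
    then show ?thesis using locinv[OF e(1) G(1)] by (intro exI[of _ "inv G \<circ> e"]) auto
  qed
  have "sided Aut x0 A B"
  proof
    show "infinite (orb F x)" if "finite F" "x \<notin> F" for F x using orb_infinite[OF that] .
    show "?\<Gamma> = A \<union> B" "A \<inter> B = {}" unfolding A_def B_def by auto
    show "\<exists>f\<in>?\<Gamma>. \<exists>e. loc e \<and> (\<forall>y\<in>?\<Gamma>. \<forall>z\<in>?\<Gamma>. e y \<noteq> f \<longrightarrow> e z \<noteq> f \<longrightarrow> e z \<in> orb {f} (e y))"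
      using homogeneous_copy[OF dctp, of x0] orb_self[of x0 "{}"] by blast
    show "\<exists>e. loc e \<and> e ` A \<subseteq> orb F x \<and> e ` B \<subseteq> orb F' x'"
      if "finite F" "finite F'" "x \<notin> F" "x' \<notin> F'" "infinite (orb F x \<inter> A)" "infinite (orb F' x' \<inter> B)" for F F' x x'
      using J[OF that(1,2,5,6)] .
    show "\<exists>e. loc e \<and> e ` A \<subseteq> orb F x" if "finite F" "x \<notin> F" "infinite (orb F x \<inter> A)" for F x
      using JA[OF that(1,3)] .
    show "\<exists>e. loc e \<and> e ` B \<subseteq> orb F x" if "finite F" "x \<notin> F" "infinite (orb F x \<inter> B)" for F x
      using JB[OF that(1,3)] .
  qed
  then show ?thesis by blast
qed

end

section \<open>Colourings of one-element substructures\<close>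

theorem theorem1p3:
  fixes ar :: "'r::finite \<Rightarrow> nat"
    and \<K> :: "(nat, 'r) rstruct set"
    and K :: "('a, 'r) rstruct"
    and ord :: "'r lit rel"
  assumes "language_convention ar"
    and "fraisse_class ar \<K>"
    and "fraisse_limit ar \<K> K"
    and "distinct_relations \<K>"
    and "nontrivial_relations ar K"
    and "unary_convention ar \<K>"
    and "formula_order ord"
    and "SDAP_plus ar ord K"
  shows "indivisible K"
proof -
  have K: "is_struct ar K" "age ar K = \<K>" using assms(3) unfolding fraisse_limit_def by auto
  obtain K0 where K0: "enumerated_limit ar \<K> K0" "isomorphic K0 K" "extension_property ar ord K0"
    and sdap: "SDAP ar \<K>" and dctp: "diagonal_coding_tree_property ar \<K>"
    using assms(8) unfolding SDAP_plus_def K(2) by blast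
  interpret convention_limit ar \<K> K0 ord
    by unfold_locales (use K0 sdap assms in \<open>auto simp: SDAP_def\<close>)
  \<comment> \<open>The argument runs in the enumerated limit \<open>K0\<close>;
    \<open>\<phi>\<close> transfers the result to \<open>K\<close>.\<close>
  obtain \<phi> where \<phi>: "isomorphism \<phi> K0 K" using K0(2) unfolding isomorphic_def by blast
  have emb: "embedding \<phi> K0 K" and surj: "range \<phi> = univ K"
    using \<phi> univ_K unfolding isomorphism_def by auto
  have inj: "\<phi> x = \<phi> y \<longleftrightarrow> x = y" for x y using emb univ_K unfolding embedding_def inj_on_def by auto
  \<comment> \<open>An isomorphism between one-element substructures is a finite partial isomorphism
    and extends to an automorphism, so isomorphic vertices lie in one orbit.\<close>
  have copy: "y \<in> orb {} x" if iso: "isomorphic (restr_struct K {\<phi> y}) (restr_struct K {\<phi> x})" for x y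
  proof -
    obtain h where h: "isomorphism h (restr_struct K {\<phi> y}) (restr_struct K {\<phi> x})"
      using iso unfolding isomorphic_def by blast
    have uy: "univ (restr_struct K {\<phi> z}) = {\<phi> z}" for z using surj by auto
    have hy: "h (\<phi> y) = \<phi> x" using h uy unfolding isomorphism_def by auto
    have "embedding (id(y := x)) (restr_struct K0 {y}) K0"
      unfolding embedding_def
    proof (intro conjI allI impI)
      fix R xs assume "set xs \<subseteq> univ (restr_struct K0 {y})"
      then have xs: "set xs \<subseteq> {y}" by simp
      have "xs \<in> interp K0 R \<longleftrightarrow> map \<phi> xs \<in> interp K R" using emb univ_K unfolding embedding_def by simp
      also have "\<dots> \<longleftrightarrow> map h (map \<phi> xs) \<in> interp (restr_struct K {\<phi> x}) R"
      proof -
        have "set (map \<phi> xs) \<subseteq> univ (restr_struct K {\<phi> y})" unfolding uy using xs by auto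
        moreover from this have "map \<phi> xs \<in> interp (restr_struct K {\<phi> y}) R \<longleftrightarrow> map \<phi> xs \<in> interp K R"
          unfolding interp_restr uy by simp
        ultimately show ?thesis using h unfolding isomorphism_def embedding_def by metis
      qed
      also have "\<dots> \<longleftrightarrow> map h (map \<phi> xs) \<in> interp K R" unfolding interp_restr using xs hy by auto
      also have "map h (map \<phi> xs) = map \<phi> (map (id(y := x)) xs)" using xs hy by auto
      also have "\<dots> \<in> interp K R \<longleftrightarrow> map (id(y := x)) xs \<in> interp K0 R"
        using emb univ_K unfolding embedding_def by simp
      finally show "xs \<in> interp (restr_struct K0 {y}) R \<longleftrightarrow> map (id(y := x)) xs \<in> interp K0 R"
        unfolding interp_restr using xs by simp
    qed (use univ_K in auto)
    then obtain G where "G \<in> Aut" "G y = x" using extend_partial[of "{y}" "id(y := x)"] by auto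
    then have "x \<in> orb {} y" unfolding orb_def by blast
    then show ?thesis by (rule orb_sym)
  qed
  show ?thesis unfolding indivisible_def
  proof (intro allI impI)
    fix A n and \<chi> :: "('a, 'r) rstruct \<Rightarrow> nat"
    assume A: "substruct A K \<and> card (univ A) = 1" and \<chi>: "\<chi> ` copies A K \<subseteq> {..<n}"
    obtain x0 where uA: "univ A = {\<phi> x0}" and Ar: "A = restr_struct K {\<phi> x0}"
    proof -
      obtain v where v: "univ A = {v}" using A card_1_singletonE by blast
      then have "v \<in> range \<phi>" using A surj unfolding substruct_def by auto
      then show thesis using that A v unfolding substruct_def by auto
    qed
    obtain P Q where "sided Aut x0 P Q" using sided_exists[OF dctp K0(3)] by blast
    then interpret sd: sided Aut x0 P Q .
    have in_copies: "restr_struct K {\<phi> y} \<in> copies A K" if y: "y \<in> orb {} x0" for y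
    proof -
      obtain G where G: "G \<in> Aut" "y = G x0" using y unfolding orb_def by auto
      define h where "h = (\<lambda>_::'a. \<phi> x0)"
      have uy: "univ (restr_struct K {\<phi> z}) = {\<phi> z}" for z using surj by auto
      have "isomorphism h (restr_struct K {\<phi> y}) A" unfolding isomorphism_def embedding_def uy uA
      proof (intro conjI allI impI)
        fix R xs assume xs: "set xs \<subseteq> {\<phi> y}"
        have e1: "xs = map \<phi> (map (\<lambda>_. y) xs)" using xs by (auto intro!: map_idI[symmetric])
        have "xs \<in> interp K R \<longleftrightarrow> map (\<lambda>_. y) xs \<in> interp K0 R"
          using emb univ_K e1 unfolding embedding_def by (metis subset_UNIV)
        also have "map (\<lambda>_. y) xs = map G (map (\<lambda>_. x0) xs)" using G(2) by simp
        also have "\<dots> \<in> interp K0 R \<longleftrightarrow> map (\<lambda>_. x0) xs \<in> interp K0 R" using G(1) unfolding Aut_iff by blast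
        also have "\<dots> \<longleftrightarrow> map \<phi> (map (\<lambda>_. x0) xs) \<in> interp K R" using emb univ_K unfolding embedding_def by simp
        also have "map \<phi> (map (\<lambda>_. x0) xs) = map h xs" unfolding h_def by simp
        finally show "xs \<in> interp (restr_struct K {\<phi> y}) R \<longleftrightarrow> map h xs \<in> interp A R"
          unfolding Ar interp_restr using xs by (auto simp: h_def)
      qed (auto simp: h_def)
      then show ?thesis unfolding copies_def isomorphic_def using restr_substruct[OF K(1)] by blast
    qed
    \<comment> \<open>Colouring the copies of \<open>A\<close> amounts to colouring the vertices in
      the orbit of \<open>x0\<close>.\<close>
    define c where "c y = \<chi> (restr_struct K {\<phi> y})" for y
    have "c ` orb {} x0 \<subseteq> {..<n}" using in_copies \<chi> unfolding c_def by blast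
    then obtain e where e: "loc e" "\<forall>y\<in>orb {} x0. \<forall>z\<in>orb {} x0. c (e y) = c (e z)"
      using sd.finitely_many_colours by blast
    have e_emb: "embedding e K0 K0" using e(1) loc_iff by blast
    \<comment> \<open>The required substructure is the image of the self-embedding \<open>e\<close>
      on whose values in the orbit \<open>c\<close> is constant.\<close>
    let ?Y = "range (\<phi> \<circ> e)"
    let ?M = "restr_struct K ?Y"
    have Ysub: "?Y \<subseteq> univ K" using surj by auto
    have uM: "univ ?M = ?Y" using Ysub by auto
    have "embedding (\<phi> \<circ> e) K0 ?M" by (rule embedding_restr_target[OF embedding_comp[OF e_emb emb]]) auto
    then have "isomorphism (\<phi> \<circ> e) K0 ?M" unfolding isomorphism_def uM using univ_K by simp
    then have i1: "isomorphism (inv_into (univ K0) (\<phi> \<circ> e)) ?M K0" by (rule isomorphism_inv)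
    then have "isomorphism (\<phi> \<circ> inv_into (univ K0) (\<phi> \<circ> e)) ?M K"
      using embedding_comp[OF _ emb] surj univ_K unfolding isomorphism_def by (metis image_comp)
    then have isoM: "isomorphic ?M K" unfolding isomorphic_def by blast
    \<comment> \<open>A copy of \<open>A\<close> in the image is a single vertex in the orbit of
      \<open>x0\<close>, and \<open>e\<close> reflects membership in that orbit.\<close>
    have key: "\<exists>y\<in>orb {} x0. B = restr_struct K {\<phi> (e y)}" if B: "B \<in> copies A ?M" for B
    proof -
      have sB: "substruct B ?M" and iB: "isomorphic B A" using B unfolding copies_def by auto
      obtain h where h: "isomorphism h B A" using iB unfolding isomorphic_def by blast
      then have inj': "inj_on h (univ B)" and im: "h ` univ B = {\<phi> x0}"
        using uA unfolding isomorphism_def embedding_def by auto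
      have "card (univ B) = 1" using card_image[OF inj'] im by simp
      then obtain v where v: "univ B = {v}" using card_1_singletonE by blast
      then obtain y where y: "v = \<phi> (e y)" using sB uM unfolding substruct_def by auto
      have "B = restr_struct ?M {v}" using sB v unfolding substruct_def by simp
      also have "\<dots> = restr_struct K {v}" using y unfolding restr_struct_def by auto
      finally have BB: "B = restr_struct K {\<phi> (e y)}" using y by simp
      then have "e y \<in> orb {} x0" using copy iB Ar by simp
      then have "y \<in> orb {} x0" using loc_orb_empty[OF e(1)] by simp
      then show ?thesis using BB by blast
    qed
    have "\<chi> B = \<chi> B'" if B: "B \<in> copies A ?M" and B': "B' \<in> copies A ?M" for B B'
    proof -
      obtain y where y: "y \<in> orb {} x0" "B = restr_struct K {\<phi> (e y)}" using key[OF B] by blast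
      obtain z where z: "z \<in> orb {} x0" "B' = restr_struct K {\<phi> (e z)}" using key[OF B'] by blast
      show ?thesis using bspec[OF bspec[OF e(2) y(1)] z(1)] unfolding y(2) z(2) c_def .
    qed
    then show "\<exists>M'. substruct M' K \<and> isomorphic M' K \<and>
        (\<forall>B\<in>copies A M'. \<forall>B'\<in>copies A M'. \<chi> B = \<chi> B')"
      using restr_substruct[OF K(1), of ?Y] isoM by blast
  qed
qed

end
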